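(* Consider the switched-mode optimal control problem with modes $i=1,\ldots,M$, dynamics $f_i$, running costs $L_i$, final cost $\phi$, compact control sets $U_i$, initial state $x_0$ and horizon $[0,t_f]$ described in the context. Suppose that: (A) for every $x\in\mathbb{R}^n$ and every $i=1,\ldots,M$, (i) $f_i(x,u_i)$ is affine in $u_i\in U_i$, i.e. there exist functions $\Phi_i:\mathbb{R}^n\to\mathbb{R}^{n\times k_i}$ and $\Psi_i:\mathbb{R}^n\to\mathbb{R}^n$ such that $f_i(x,u_i)=\Phi_i(x)u_i+\Psi_i(x)$, and (ii) $L_i(x,u_i)$ is convex in $u_i\in U_i$; (B) for every $i=1,\ldots,M$, (i) the functions $\Phi_i$ and $\Psi_i$ are twice continuously differentiable, and (ii) $L_i(x,u)$ is continuously differentiable in $x\in\mathbb{R}^n$ for every $u\in U_i$, and $L_i(x,u)$ and $\frac{\partial L_i}{\partial x}(x,u)$ are locally Lipschitz continuous in $(x,u)\in\mathbb{R}^n\times U_i$. Then for every $\eta\in(0,1)$ there exists $\bar\alpha\in(0,1)$ such that, for every choice of $\alpha\in(0,\bar\alpha)$ and $\beta\in(0,1)$, the algorithm with constants $(\eta,\alpha,\beta)$ described in the context has the property of sufficient descent with respect to the relaxed maximum principle, i.e. with respect to the optimality function $\theta$. That is, denoting by $\bar y=T(\bar w)$ the result of one iteration of the algorithm from $\bar w\in\mathcal{W}$: (i) $J(T(\bar w))\le J(\bar w)$ for every $\bar w\in\mathcal{W}$; and (ii) for every $\rho>0$ there exists $\delta>0$ such that, for every $\bar w\in\mathcal{W}$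 with $\theta(\bar w)<-\rho$, $$J(T(\bar w))-J(\bar w)<-\delta .$$
   Context: **Problem.** Given are $t_f>0$, $x_0\in\mathbb{R}^n$, an integer $M\ge1$, and for $i=1,\ldots,M$ a compact set $U_i\subset\mathbb{R}^{k_i}$ and functions $f_i:\mathbb{R}^n\times\mathbb{R}^{k_i}\to\mathbb{R}^n$ (the modes of the system) and $L_i:\mathbb{R}^n\times\mathbb{R}^{k_i}\to\mathbb{R}$ (mode-dependent running costs), together with a final-state cost function $\phi:\mathbb{R}^n\to\mathbb{R}$ with gradient $\nabla\phi$. **Controls.** Let $V$ be the set of pairs $v=(i,u_i)$ with $i\in\{1,\ldots,M\}$ and $u_i\in U_i$. An *admissible control* is a function $t\mapsto v(t)=(i(t),u_{i(t)}(t))\in V$ on $[0,t_f]$ that is piecewise continuously differentiable with finitely many discontinuities. A *relaxed control* is a mapping $\bar\nu=\{\nu(t)\}_{t\in[0,t_f]}$ from $[0,t_f]$ to the Borel probability measures on $V$ such that $t\mapsto\int_V\zeta\,d\nu(t)$ is Lebesgue measurable for every continuous $\zeta:V\to\mathbb{R}$. Let $W$ be the set of $M$-tuples of pairs $((\alpha_1,u_1),\ldots,(\alpha_M,u_M))$ with $\alpha_i\ge0$, $\sum_{i=1}^M\alpha_i=1$, $u_i\in U_i$. An *embedded control* is a Lebesgue measurable function $w:[0,t_f]\to W$, denoted $\bar w=\{w(t)\}_{t\in[0,t_f]}$; $\mathcal{W}$ is the space of embedded controls. **State, cost, costate.** For $\bar w=((\alpha_1(t),u_1(t)),\ldots,(\alpha_M(t),u_M(t)))_{t\in[0,t_f]}\in\mathcal{W}$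 the state equation is $$\dot x(t)=\sum_{i=1}^M\alpha_i(t)f_i(x(t),u_i(t)),\qquad x(0)=x_0,$$ the cost is $$J(\bar w)=\sum_{i=1}^M\int_0^{t_f}\alpha_i(t)L_i(x(t),u_i(t))\,dt+\phi(x(t_f)),$$ and the costate equation is $$\dot p(t)=-\sum_{i=1}^M\alpha_i(t)\Big[\Big(\tfrac{\partial f_i}{\partial x}(x(t),u_i(t))\Big)^{\top}p(t)+\Big(\tfrac{\partial L_i}{\partial x}(x(t),u_i(t))\Big)^{\top}\Big],\qquad p(t_f)=\nabla\phi(x(t_f)).$$ **Convex combination in the sense of measures.** For $\bar w_1,\bar w_2\in\mathcal{W}$ with $w_\ell(t)=((\alpha_{\ell,1}(t),u_{\ell,1}(t)),\ldots,(\alpha_{\ell,M}(t),u_{\ell,M}(t)))$, $\ell=1,2$, and $\lambda\in[0,1]$, $(1-\lambda)\bar w_1\oplus\lambda\bar w_2$ denotes the relaxed control that is the convex combination of $\bar w_1$ and $\bar w_2$ in the sense of measures. Its state equation is $$\dot x(t)=(1-\lambda)\sum_{i=1}^M\alpha_{1,i}(t)f_i(x(t),u_{1,i}(t))+\lambda\sum_{i=1}^M\alpha_{2,i}(t)f_i(x(t),u_{2,i}(t)),\quad x(0)=x_0,$$ and its cost, with this $x$, is $$J((1-\lambda)\bar w_1\oplus\lambda\bar w_2)=(1-\lambda)\sum_{i=1}^M\int_0^{t_f}\alpha_{1,i}(t)L_i(x(t),u_{1,i}(t))\,dt+\lambda\sum_{i=1}^M\int_0^{t_f}\alpha_{2,i}(t)L_i(x(t),u_{2,i}(t))\,dt+\phi(x(t_f)).$$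 **Hamiltonian and optimality function.** For $v=(i,u)\in V$ put $H(x,v,p)=p^\top f_i(x,u)+L_i(x,u)$; for a Borel probability measure $\nu$ on $V$ put $H(x,\nu,p)=\int_V H(x,v,p)\,d\nu(v)$; for $w=((\alpha_i,u_i))_{i=1}^M\in W$ put $H(x,w,p)=\sum_{i=1}^M\alpha_i\big(p^\top f_i(x,u_i)+L_i(x,u_i)\big)$. For $\bar w\in\mathcal{W}$ with state $x$ and costate $p$, $$\theta(\bar w)=\min_{\bar\nu}\int_0^{t_f}\big(H(x(t),\nu(t),p(t))-H(x(t),w(t),p(t))\big)\,dt,$$ the minimum being over all relaxed controls $\bar\nu$. This is an optimality function for the relaxed maximum principle: it is nonpositive, and it vanishes exactly when $\bar w$ satisfies the relaxed maximum principle, i.e. when $w(t)$ minimizes the Hamiltonian at almost every $t\in[0,t_f]$. **The algorithm (one iteration), with constants $\eta,\alpha,\beta\in(0,1)$.** Input $\bar w=((\alpha_1(t),u_1(t)),\ldots,(\alpha_M(t),u_M(t)))_{t\in[0,t_f]}\in\mathcal{W}$; output $\bar y=T(\bar w)\in\mathcal{W}$. (In the definition of sufficient descent, the iteration is represented by a measurable mapping $T$.) Step 1: Compute the state $x(t)$ and costate $p(t)$ of $\bar w$, $t\in[0,t_f]$. Step 2: Compute an admissible control $\bar u^*_\eta$ satisfying $$\int_0^{t_f}\big(H(x(t),u^*_\eta(t),p(t))-H(x(t),w(t),p(t))\big)\,dt<(1-\eta)\theta(\bar w).$$ For every $t$, $u^*_\eta(t)=(j(t),u^*_{j(t)}(t))$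 for some $j(t)\in\{1,\ldots,M\}$ and $u^*_{j(t)}(t)\in U_{j(t)}$; view it as an embedded control of the form $u^*_\eta(t)=((\alpha_1^*(t),u_1^*(t)),\ldots,(\alpha_M^*(t),u_M^*(t)))$ with $\alpha^*_{j(t)}(t)=1$ and $\alpha^*_i(t)=0$ for all $i\ne j(t)$. Step 3: Compute the largest $\lambda\in\{1,\beta,\beta^2,\ldots\}$ such that $$J\big((1-\lambda)\bar w\oplus\lambda\bar u^*_\eta\big)-J(\bar w)<\alpha\lambda\,\theta(\bar w),$$ and denote it by $\lambda_{\bar w}$. Step 4: For every $t\in[0,t_f]$ and $i=1,\ldots,M$ define $\gamma_i(t)=(1-\lambda_{\bar w})\alpha_i(t)+\lambda_{\bar w}\alpha_i^*(t)$, $\epsilon_i(t)=\lambda_{\bar w}\alpha_i^*(t)/\gamma_i(t)$ and $\tilde u_i(t)=(1-\epsilon_i(t))u_i(t)+\epsilon_i(t)u_i^*(t)$, and set $$\bar y=\big((\gamma_1(t),\tilde u_1(t)),\ldots,(\gamma_M(t),\tilde u_M(t))\big),\quad t\in[0,t_f].$$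
   Formalization: Made explicit: every embedded control has a state on [0,t_f] (else J is undefined); φ is continuously differentiable (else (ii) can fail); each U_i is convex (else Step 4 leaves W); if θ(w)=0, where Step 2 is infeasible, T(w)=w. *)

theory Defs
  imports "HOL-Probability.Probability"
begin

definition gradient :: "('a::real_inner \<Rightarrow> real) \<Rightarrow> 'a \<Rightarrow> 'a" where
  "gradient g x = (THE d. GDERIV g x :> d)"

definition C1_scalar :: "('a::real_inner \<Rightarrow> real) \<Rightarrow> bool" where
  "C1_scalar g \<longleftrightarrow> (\<forall>x. \<exists>d. GDERIV g x :> d) \<and> continuous_on UNIV (gradient g)"

definition C2_map :: "('a::real_normed_vector \<Rightarrow> 'b::real_normed_vector) \<Rightarrow> bool" where
  "C2_map g \<longleftrightarrow>
    (\<exists>(D :: 'a \<Rightarrow> 'a \<Rightarrow>\<^sub>L 'b) (D2 :: 'a \<Rightarrow> 'a \<Rightarrow>\<^sub>L ('a \<Rightarrow>\<^sub>L 'b)).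
       (\<forall>x. (g has_derivative blinfun_apply (D x)) (at x)) \<and>
       (\<forall>x. (D has_derivative blinfun_apply (D2 x)) (at x)) \<and>
       continuous_on UNIV D2)"

definition locally_lipschitz_on ::
  "'a::metric_space set \<Rightarrow> ('a \<Rightarrow> 'b::metric_space) \<Rightarrow> bool" where
  "locally_lipschitz_on S g \<longleftrightarrow> (\<forall>z\<in>S. \<exists>r>0. \<exists>C. C-lipschitz_on (cball z r \<inter> S) g)"

text \<open>
  Modes are the numbers \<open>1, \<dots>, modes P\<close>. Their control spaces may have different dimensions:
  each is a coordinate subspace of one common space \<open>real ^ 'k\<close> (see \<open>coord_subspace\<close>,
  of dimension \<open>card K\<close>).
\<close>

record ('n::finite, 'k::finite) switched_problem =
  horizon :: real
  init :: "real ^ 'n"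
  modes :: nat
  ctrl_set :: "nat \<Rightarrow> (real ^ 'k) set"
  dyn :: "nat \<Rightarrow> real ^ 'n \<Rightarrow> real ^ 'k \<Rightarrow> real ^ 'n"
  running_cost :: "nat \<Rightarrow> real ^ 'n \<Rightarrow> real ^ 'k \<Rightarrow> real"
  final_cost :: "real ^ 'n \<Rightarrow> real"

definition coord_subspace :: "'k::finite set \<Rightarrow> (real ^ 'k) set" where
  "coord_subspace K = {u. \<forall>j. j \<notin> K \<longrightarrow> u $ j = 0}"

definition mode_controls :: "('n::finite, 'k::finite) switched_problem \<Rightarrow> (nat \<times> (real ^ 'k)) set"
  where "mode_controls P = (SIGMA i:{1..modes P}. ctrl_set P i)"

text \<open>
  Finitely many break points are removed; away from them the mode (a natural number, hence with
  the discrete topology) is locally constant and the control value is continuously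
  differentiable. As in \<open>piecewise_C1_differentiable_on\<close>, one-sided limits of
  the derivative at the break points are not required; continuity there is not required either.
\<close>

definition admissible_controls ::
  "('n::finite, 'k::finite) switched_problem \<Rightarrow> (real \<Rightarrow> nat \<times> (real ^ 'k)) set" where
  "admissible_controls P = {v.
     (\<forall>t\<in>{0..horizon P}. v t \<in> mode_controls P) \<and>
     (\<exists>S. finite S \<and> continuous_on ({0..horizon P} - S) (\<lambda>t. fst (v t)) \<and>
          (\<lambda>t. snd (v t)) C1_differentiable_on ({0..horizon P} - S))}"

definition relaxed_controls ::
  "('n::finite, 'k::finite) switched_problem \<Rightarrow> (real \<Rightarrow> (nat \<times> (real ^ 'k)) measure) set" where
  "relaxed_controls P = {\<nu>.
     (\<forall>t\<in>{0..horizon P}. prob_space (\<nu> t) \<and>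
        sets (\<nu> t) = sets (restrict_space borel (mode_controls P))) \<and>
     (\<forall>\<zeta> :: nat \<times> (real ^ 'k) \<Rightarrow> real. continuous_on (mode_controls P) \<zeta> \<longrightarrow>
        (\<lambda>t. LINT v|\<nu> t. \<zeta> v) \<in> borel_measurable (lebesgue_on {0..horizon P}))}"

text \<open>
  An \<open>M\<close>-tuple is a function on \<open>nat\<close> of which only the values at
  \<open>1, \<dots>, M\<close> matter.
\<close>

definition embedded_values ::
  "('n::finite, 'k::finite) switched_problem \<Rightarrow> (nat \<Rightarrow> real \<times> (real ^ 'k)) set" where
  "embedded_values P = {w.
     (\<forall>i\<in>{1..modes P}. 0 \<le> fst (w i) \<and> snd (w i) \<in> ctrl_set P i) \<and>
     (\<Sum>i=1..modes P. fst (w i)) = 1}"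

definition embedded_controls ::
  "('n::finite, 'k::finite) switched_problem \<Rightarrow> (real \<Rightarrow> nat \<Rightarrow> real \<times> (real ^ 'k)) set" where
  "embedded_controls P = {w.
     (\<forall>t\<in>{0..horizon P}. w t \<in> embedded_values P) \<and>
     (\<forall>i\<in>{1..modes P}. (\<lambda>t. w t i) \<in> borel_measurable (lebesgue_on {0..horizon P}))}"

text \<open>
  In the modes that are not active the control value carries weight 0 and is irrelevant.
\<close>

definition embed ::
  "('n::finite, 'k::finite) switched_problem \<Rightarrow> (real \<Rightarrow> nat \<times> (real ^ 'k))
    \<Rightarrow> real \<Rightarrow> nat \<Rightarrow> real \<times> (real ^ 'k)" where
  "embed P v = (\<lambda>t i. if i = fst (v t) then (1, snd (v t)) else (0, SOME u. u \<in> ctrl_set P i))"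

text \<open>
  Controls are only measurable, so solutions of differential equations are understood in the
  sense of Caratheodory, i.e. as continuous solutions of the integral equation.
\<close>

definition velocity ::
  "('n::finite, 'k::finite) switched_problem \<Rightarrow> real ^ 'n \<Rightarrow> (nat \<Rightarrow> real \<times> (real ^ 'k)) \<Rightarrow> real ^ 'n"
  where "velocity P x w = (\<Sum>i=1..modes P. fst (w i) *\<^sub>R dyn P i x (snd (w i)))"

definition is_trajectory ::
  "('n::finite, 'k::finite) switched_problem \<Rightarrow> (real ^ 'n \<Rightarrow> real \<Rightarrow> real ^ 'n)
    \<Rightarrow> (real \<Rightarrow> real ^ 'n) \<Rightarrow> bool" where
  "is_trajectory P F x \<longleftrightarrow>
     continuous_on {0..horizon P} x \<and>
     set_integrable lebesgue {0..horizon P} (\<lambda>s. F (x s) s) \<and>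
     (\<forall>t\<in>{0..horizon P}. x t = init P + (LINT s:{0..t}|lebesgue. F (x s) s))"

definition is_state ::
  "('n::finite, 'k::finite) switched_problem \<Rightarrow> (real \<Rightarrow> nat \<Rightarrow> real \<times> (real ^ 'k))
    \<Rightarrow> (real \<Rightarrow> real ^ 'n) \<Rightarrow> bool" where
  "is_state P w x \<longleftrightarrow> is_trajectory P (\<lambda>y s. velocity P y (w s)) x"

text \<open>
  Under the smoothness assumptions of the theorem the state is unique on
  \<open>{0..horizon P}\<close>, and so is the costate below; the values elsewhere are never used.
\<close>

definition state ::
  "('n::finite, 'k::finite) switched_problem \<Rightarrow> (real \<Rightarrow> nat \<Rightarrow> real \<times> (real ^ 'k))
    \<Rightarrow> real \<Rightarrow> real ^ 'n" where
  "state P w = (SOME x. is_state P w x)"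

definition running_total ::
  "('n::finite, 'k::finite) switched_problem \<Rightarrow> (real \<Rightarrow> real ^ 'n)
    \<Rightarrow> (real \<Rightarrow> nat \<Rightarrow> real \<times> (real ^ 'k)) \<Rightarrow> real" where
  "running_total P x w =
     (\<Sum>i=1..modes P. LINT t:{0..horizon P}|lebesgue.
        fst (w t i) * running_cost P i (x t) (snd (w t i)))"

definition cost ::
  "('n::finite, 'k::finite) switched_problem \<Rightarrow> (real \<Rightarrow> nat \<Rightarrow> real \<times> (real ^ 'k)) \<Rightarrow> real" where
  "cost P w = running_total P (state P w) w + final_cost P (state P w (horizon P))"

definition costate_rhs ::
  "('n::finite, 'k::finite) switched_problem \<Rightarrow> real ^ 'n \<Rightarrow> (nat \<Rightarrow> real \<times> (real ^ 'k))
    \<Rightarrow> real ^ 'n \<Rightarrow> real ^ 'n" where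
  "costate_rhs P x w p =
     - (\<Sum>i=1..modes P. fst (w i) *\<^sub>R
          (transpose (jacobian (\<lambda>y. dyn P i y (snd (w i))) (at x)) *v p
           + gradient (\<lambda>y. running_cost P i y (snd (w i))) x))"

definition is_costate ::
  "('n::finite, 'k::finite) switched_problem \<Rightarrow> (real \<Rightarrow> nat \<Rightarrow> real \<times> (real ^ 'k))
    \<Rightarrow> (real \<Rightarrow> real ^ 'n) \<Rightarrow> bool" where
  "is_costate P w p \<longleftrightarrow>
     continuous_on {0..horizon P} p \<and>
     set_integrable lebesgue {0..horizon P} (\<lambda>s. costate_rhs P (state P w s) (w s) (p s)) \<and>
     (\<forall>t\<in>{0..horizon P}. p t = gradient (final_cost P) (state P w (horizon P))
        - (LINT s:{t..horizon P}|lebesgue. costate_rhs P (state P w s) (w s) (p s)))"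

definition costate ::
  "('n::finite, 'k::finite) switched_problem \<Rightarrow> (real \<Rightarrow> nat \<Rightarrow> real \<times> (real ^ 'k))
    \<Rightarrow> real \<Rightarrow> real ^ 'n" where
  "costate P w = (SOME p. is_costate P w p)"

text \<open>
  State and cost of the relaxed control \<open>(1 - l) w1 \<oplus> l w2\<close>, the convex combination
  in the sense of measures.
\<close>

definition mix_state ::
  "('n::finite, 'k::finite) switched_problem \<Rightarrow> real \<Rightarrow> (real \<Rightarrow> nat \<Rightarrow> real \<times> (real ^ 'k))
    \<Rightarrow> (real \<Rightarrow> nat \<Rightarrow> real \<times> (real ^ 'k)) \<Rightarrow> real \<Rightarrow> real ^ 'n" where
  "mix_state P l w1 w2 =
     (SOME x. is_trajectory P
        (\<lambda>y s. (1 - l) *\<^sub>R velocity P y (w1 s) + l *\<^sub>R velocity P y (w2 s)) x)"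

definition mix_cost ::
  "('n::finite, 'k::finite) switched_problem \<Rightarrow> real \<Rightarrow> (real \<Rightarrow> nat \<Rightarrow> real \<times> (real ^ 'k))
    \<Rightarrow> (real \<Rightarrow> nat \<Rightarrow> real \<times> (real ^ 'k)) \<Rightarrow> real" where
  "mix_cost P l w1 w2 =
     (let x = mix_state P l w1 w2 in
        (1 - l) * running_total P x w1 + l * running_total P x w2
        + final_cost P (x (horizon P)))"

definition ham ::
  "('n::finite, 'k::finite) switched_problem \<Rightarrow> real ^ 'n \<Rightarrow> nat \<times> (real ^ 'k) \<Rightarrow> real ^ 'n \<Rightarrow> real"
  where "ham P x v p = p \<bullet> dyn P (fst v) x (snd v) + running_cost P (fst v) x (snd v)"

definition ham_relaxed ::
  "('n::finite, 'k::finite) switched_problem \<Rightarrow> real ^ 'n \<Rightarrow> (nat \<times> (real ^ 'k)) measure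
    \<Rightarrow> real ^ 'n \<Rightarrow> real" where
  "ham_relaxed P x \<nu> p = (LINT v|\<nu>. ham P x v p)"

definition ham_embedded ::
  "('n::finite, 'k::finite) switched_problem \<Rightarrow> real ^ 'n \<Rightarrow> (nat \<Rightarrow> real \<times> (real ^ 'k))
    \<Rightarrow> real ^ 'n \<Rightarrow> real" where
  "ham_embedded P x w p = (\<Sum>i=1..modes P. fst (w i) * ham P x (i, snd (w i)) p)"

text \<open>The minimum over all relaxed controls, written as an infimum; the two agree, as the minimum is attained.\<close>

definition theta ::
  "('n::finite, 'k::finite) switched_problem \<Rightarrow> (real \<Rightarrow> nat \<Rightarrow> real \<times> (real ^ 'k)) \<Rightarrow> real" where
  "theta P w =
     (INF \<nu>\<in>relaxed_controls P.
        LINT t:{0..horizon P}|lebesgue.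
          (ham_relaxed P (state P w t) (\<nu> t) (costate P w t)
           - ham_embedded P (state P w t) (w t) (costate P w t)))"

definition descent_control ::
  "('n::finite, 'k::finite) switched_problem \<Rightarrow> real \<Rightarrow> (real \<Rightarrow> nat \<Rightarrow> real \<times> (real ^ 'k))
    \<Rightarrow> (real \<Rightarrow> nat \<times> (real ^ 'k)) \<Rightarrow> bool" where
  "descent_control P \<eta> w v \<longleftrightarrow>
     v \<in> admissible_controls P \<and>
     (LINT t:{0..horizon P}|lebesgue.
        (ham P (state P w t) (v t) (costate P w t)
         - ham_embedded P (state P w t) (w t) (costate P w t))) < (1 - \<eta>) * theta P w"

definition sufficient_step ::
  "('n::finite, 'k::finite) switched_problem \<Rightarrow> real \<Rightarrow> (real \<Rightarrow> nat \<Rightarrow> real \<times> (real ^ 'k))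
    \<Rightarrow> (real \<Rightarrow> nat \<times> (real ^ 'k)) \<Rightarrow> real \<Rightarrow> bool" where
  "sufficient_step P \<alpha> w v l \<longleftrightarrow>
     mix_cost P l w (embed P v) - cost P w < \<alpha> * l * theta P w"

definition armijo_step ::
  "('n::finite, 'k::finite) switched_problem \<Rightarrow> real \<Rightarrow> real \<Rightarrow> (real \<Rightarrow> nat \<Rightarrow> real \<times> (real ^ 'k))
    \<Rightarrow> (real \<Rightarrow> nat \<times> (real ^ 'k)) \<Rightarrow> real \<Rightarrow> bool" where
  "armijo_step P \<alpha> \<beta> w v l \<longleftrightarrow>
     l \<in> range (\<lambda>m::nat. \<beta> ^ m) \<and> sufficient_step P \<alpha> w v l \<and>
     (\<forall>l'\<in>range (\<lambda>m::nat. \<beta> ^ m). sufficient_step P \<alpha> w v l' \<longrightarrow> l' \<le> l)"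

text \<open>
  Where the new weight \<open>\<gamma>\<close> vanishes, the control value is irrelevant; the convention
  \<open>0 / 0 = 0\<close> then keeps the old value.
\<close>

definition update ::
  "real \<Rightarrow> (real \<Rightarrow> nat \<Rightarrow> real \<times> (real ^ 'k::finite)) \<Rightarrow> (real \<Rightarrow> nat \<Rightarrow> real \<times> (real ^ 'k))
    \<Rightarrow> real \<Rightarrow> nat \<Rightarrow> real \<times> (real ^ 'k)" where
  "update l w ws = (\<lambda>t i.
     let \<gamma> = (1 - l) * fst (w t i) + l * fst (ws t i);
         \<epsilon> = l * fst (ws t i) / \<gamma>
     in (\<gamma>, (1 - \<epsilon>) *\<^sub>R snd (w t i) + \<epsilon> *\<^sub>R snd (ws t i)))"

text \<open>
  If \<open>theta P w = 0\<close>, then \<open>w\<close> satisfies the relaxed maximum principle and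
  no descent control exists; the algorithm stops, i.e. leaves \<open>w\<close> unchanged.
\<close>

definition iteration ::
  "('n::finite, 'k::finite) switched_problem \<Rightarrow> real \<Rightarrow> real \<Rightarrow> real
    \<Rightarrow> (real \<Rightarrow> nat \<Rightarrow> real \<times> (real ^ 'k)) \<Rightarrow> (real \<Rightarrow> nat \<Rightarrow> real \<times> (real ^ 'k)) \<Rightarrow> bool" where
  "iteration P \<eta> \<alpha> \<beta> w y \<longleftrightarrow>
     (if theta P w < 0
      then \<exists>v l. descent_control P \<eta> w v \<and> armijo_step P \<alpha> \<beta> w v l \<and> y = update l w (embed P v)
      else y = w)"

definition algorithm_map ::
  "('n::finite, 'k::finite) switched_problem \<Rightarrow> real \<Rightarrow> real \<Rightarrow> real
    \<Rightarrow> ((real \<Rightarrow> nat \<Rightarrow> real \<times> (real ^ 'k)) \<Rightarrow> real \<Rightarrow> nat \<Rightarrow> real \<times> (real ^ 'k)) \<Rightarrow> bool" where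
  "algorithm_map P \<eta> \<alpha> \<beta> T \<longleftrightarrow> (\<forall>w\<in>embedded_controls P. iteration P \<eta> \<alpha> \<beta> w (T w))"

definition sufficient_descent ::
  "('n::finite, 'k::finite) switched_problem
    \<Rightarrow> ((real \<Rightarrow> nat \<Rightarrow> real \<times> (real ^ 'k)) \<Rightarrow> real \<Rightarrow> nat \<Rightarrow> real \<times> (real ^ 'k)) \<Rightarrow> bool" where
  "sufficient_descent P T \<longleftrightarrow>
     T \<in> embedded_controls P \<rightarrow> embedded_controls P \<and>
     (\<forall>w\<in>embedded_controls P. cost P (T w) \<le> cost P w) \<and>
     (\<forall>\<rho>>0. \<exists>\<delta>>0. \<forall>w\<in>embedded_controls P. theta P w < - \<rho> \<longrightarrow> cost P (T w) - cost P w < - \<delta>)"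

end

theory Submission
  imports Defs "HOL-Complex_Analysis.Great_Picard"
begin

text \<open>
  Let \<open>w\<close> be an embedded control with state \<open>x\<close> and costate \<open>p\<close>, let \<open>u\<close> be
  another one, and let \<open>y\<close> be the state of the relaxed control \<open>(1 - l) w \<oplus> l u\<close>. The
  costate is the adjoint of the linearized state equation; hence the cost of this mixture differs from
  the cost of \<open>w\<close> by \<open>l\<close> times the integral of
  \<open>H(x, u, p) - H(x, w, p)\<close>, up to an error \<open>o(l)\<close>
  (\<open>mix_cost_variation\<close>). For a descent control that integral is below
  \<open>(1 - \<eta>) \<theta>(w)\<close>, so every \<open>\<alpha> < 1 - \<eta>\<close> leaves room for the error,
  and the step-size test succeeds for all small \<open>l\<close>; \<open>1 - \<eta>\<close> serves as the bound
  on \<open>\<alpha>\<close>. The new control replaces the mixture in each mode by a convex combination of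
  control values. As the dynamics are affine in the control, this changes neither the velocity nor the
  state, and as the running costs are convex, it can only lower the cost
  (\<open>mix_state_eq\<close>, \<open>cost_update_le_mix_cost\<close>).

  Sufficient descent needs more than descent: the threshold for \<open>l\<close> may depend on
  \<open>\<rho>\<close>, but not on \<open>w\<close> or on the descent control. Then backtracking never goes below a
  fixed step, and the decrease is at least that step times \<open>\<alpha> \<rho>\<close>. All constants in the
  expansion are uniform as soon as the states of all embedded controls stay in one ball
  (\<open>states_bounded\<close>). No growth condition is at hand for this, only the existence of the
  state for each single control, and the bound comes from compactness. If the states were unbounded,
  take controls with larger and larger states and let a subsequence converge weakly in the coordinates
  \<open>(\<alpha>_i, \<alpha>_i u_i)\<close>, in which the velocity is linear and the set of values is
  convex and compact. The weak limit is again an embedded control; its state exists, hence is bounded,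
  and by a Gronwall estimate the states of the subsequence converge to it uniformly, a contradiction.

  Weak compactness is proved by hand (\<open>weak_sequential_compactness\<close>). The primitives of the
  controls converge uniformly along a subsequence by the theorem of Arzela and Ascoli. A density for
  the limit is found by minimizing the \<open>L2\<close> norm over the controls whose primitives are
  \<open>1/n\<close>-close to it: by the parallelogram law almost-minimizers form a Cauchy sequence, so a
  subsequence converges almost everywhere, and the limit takes its values in the same convex compact
  set.

  It remains to see that the algorithm is defined. The costate exists by a Picard iteration
  (\<open>costate_exists\<close>). If \<open>\<theta>(w) < 0\<close>, a descent control is obtained by sampling
  a minimizer of the Hamiltonian on a fine grid, which is almost optimal at every time because the state
  and the costate are continuous (\<open>descent_control_exists\<close>).
\<close>

section \<open>Gronwall inequalities and a backward initial value problem\<close>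

text \<open>
  The argument looks at the maximum of \<open>v / E\<close>. It bounds \<open>v\<close> inside the
  integral, and since \<open>E\<close> at least halves under \<open>L \<integral>\<close>, half of that maximum is
  absorbed. Leaving the domain \<open>I t\<close> of integration open covers integration from the left
  and from the right end alike.
\<close>

lemma gronwall_weighted:
  fixes v E :: "real \<Rightarrow> real" and I :: "real \<Rightarrow> real set"
  assumes S: "compact S" and v: "continuous_on S v" and E: "continuous_on S E"
    and E1: "\<And>t. t \<in> S \<Longrightarrow> 1 \<le> E t"
    and I: "\<And>t. t \<in> S \<Longrightarrow> I t \<subseteq> S"
    and iv: "\<And>t. t \<in> S \<Longrightarrow> v integrable_on I t" and iE: "\<And>t. t \<in> S \<Longrightarrow> E integrable_on I t"
    and wt: "\<And>t. t \<in> S \<Longrightarrow> L * integral (I t) E \<le> E t / 2"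
    and L: "0 \<le> L" and a: "0 \<le> a"
    and bound: "\<And>t. t \<in> S \<Longrightarrow> v t \<le> a + L * integral (I t) v"
    and t: "t \<in> S"
  shows "v t \<le> 2 * a * E t"
proof -
  have "continuous_on S (\<lambda>t. v t / E t)"
    using v E E1 by (intro continuous_intros) force+
  then obtain t0 where t0: "t0 \<in> S" and max: "\<And>s. s \<in> S \<Longrightarrow> v s / E s \<le> v t0 / E t0"
    using continuous_attains_sup[OF S, of "\<lambda>t. v t / E t"] t by blast
  define m where "m = v t0 / E t0"
  have vm: "v s \<le> m * E s" if "s \<in> S" for s
    using max[OF that] E1[OF that] by (simp add: m_def pos_divide_le_eq)
  have "m \<le> 2 * a"
  proof (cases "m \<le> 0")
    case False
    have "integral (I t0) v \<le> integral (I t0) (\<lambda>s. m * E s)"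
      using vm I[OF t0] iv[OF t0] integrable_on_cmult_left[OF iE[OF t0], of m]
      by (intro integral_le) auto
    also have "\<dots> = m * integral (I t0) E" by simp
    finally have "L * integral (I t0) v \<le> m * (L * integral (I t0) E)"
      using mult_left_mono[OF _ L] by (simp add: mult.left_commute)
    also have "\<dots> \<le> m * (E t0 / 2)"
      using wt[OF t0] False by (intro mult_left_mono) auto
    finally have "v t0 \<le> a + m * (E t0 / 2)" using bound[OF t0] by linarith
    moreover have "v t0 = m * E t0" using E1[OF t0] by (simp add: m_def)
    ultimately have "m * E t0 \<le> 2 * a" by simp
    moreover have "m * 1 \<le> m * E t0" using E1[OF t0] False by (intro mult_left_mono) auto
    ultimately show ?thesis by simp
  qed (use a in simp)
  then have "m * E t \<le> 2 * a * E t" using E1[OF t] by (intro mult_right_mono) auto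
  with vm[OF t] show ?thesis by simp
qed

lemma exp_weight_forward:
  fixes L t :: real
  assumes "0 < L" "0 \<le> t"
  shows "(\<lambda>s. exp (2 * L * s)) integrable_on {0..t}"
    and "L * integral {0..t} (\<lambda>s. exp (2 * L * s)) \<le> exp (2 * L * t) / 2"
proof -
  have "((\<lambda>s. exp (2 * L * s)) has_integral exp (2 * L * t) / (2 * L) - exp (2 * L * 0) / (2 * L)) {0..t}"
    using assms by (intro fundamental_theorem_of_calculus)
      (auto intro!: derivative_eq_intros simp: has_real_derivative_iff_has_vector_derivative[symmetric])
  then show "(\<lambda>s. exp (2 * L * s)) integrable_on {0..t}"
    and "L * integral {0..t} (\<lambda>s. exp (2 * L * s)) \<le> exp (2 * L * t) / 2"
    using assms by (auto simp: integral_unique field_simps)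
qed

lemma exp_weight_backward:
  fixes L t T :: real
  assumes "0 < L" "t \<le> T"
  shows "(\<lambda>s. exp (2 * L * (T - s))) integrable_on {t..T}"
    and "L * integral {t..T} (\<lambda>s. exp (2 * L * (T - s))) \<le> exp (2 * L * (T - t)) / 2"
proof -
  have "((\<lambda>s. exp (2 * L * (T - s))) has_integral - exp (2 * L * (T - T)) / (2 * L) - (- exp (2 * L * (T - t)) / (2 * L))) {t..T}"
    using assms by (intro fundamental_theorem_of_calculus)
      (auto intro!: derivative_eq_intros simp: has_real_derivative_iff_has_vector_derivative[symmetric])
  then show "(\<lambda>s. exp (2 * L * (T - s))) integrable_on {t..T}"
    and "L * integral {t..T} (\<lambda>s. exp (2 * L * (T - s))) \<le> exp (2 * L * (T - t)) / 2"
    using assms by (auto simp: integral_unique field_simps)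
qed

lemma gronwall_forward:
  fixes v :: "real \<Rightarrow> real"
  assumes v: "continuous_on {0..T} v" and L: "0 < L" and a: "0 \<le> a"
    and bound: "\<And>t. t \<in> {0..T} \<Longrightarrow> v t \<le> a + L * integral {0..t} v"
    and t: "t \<in> {0..T}"
  shows "v t \<le> 2 * a * exp (2 * L * T)"
proof -
  have "v t \<le> 2 * a * exp (2 * L * t)"
  proof (rule gronwall_weighted[where S="{0..T}" and I="\<lambda>t. {0..t}" and v=v and E="\<lambda>t. exp (2 * L * t)" and L=L])
    show "v integrable_on {0..t}" if "t \<in> {0..T}" for t
      using that by (intro integrable_continuous_interval) (auto intro: continuous_on_subset[OF v])
  qed (use assms exp_weight_forward[OF L] in \<open>auto intro!: continuous_intros\<close>)
  also have "\<dots> \<le> 2 * a * exp (2 * L * T)"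
    using t L a by (intro mult_left_mono) auto
  finally show ?thesis .
qed

lemma gronwall_backward:
  fixes v :: "real \<Rightarrow> real"
  assumes v: "continuous_on {0..T} v" and L: "0 < L" and a: "0 \<le> a"
    and bound: "\<And>t. t \<in> {0..T} \<Longrightarrow> v t \<le> a + L * integral {t..T} v"
    and t: "t \<in> {0..T}"
  shows "v t \<le> 2 * a * exp (2 * L * T)"
proof -
  have "v t \<le> 2 * a * exp (2 * L * (T - t))"
  proof (rule gronwall_weighted[where S="{0..T}" and I="\<lambda>t. {t..T}" and v=v and E="\<lambda>t. exp (2 * L * (T - t))" and L=L])
    show "v integrable_on {t..T}" if "t \<in> {0..T}" for t
      using that by (intro integrable_continuous_interval) (auto intro: continuous_on_subset[OF v])
  qed (use assms exp_weight_backward[OF L] in \<open>auto intro!: continuous_intros\<close>)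
  also have "\<dots> \<le> 2 * a * exp (2 * L * T)"
    using t L a by (intro mult_left_mono) auto
  finally show ?thesis .
qed

text \<open>
  In the norm weighted by \<open>exp (2 * L * (T - t))\<close> the Picard map contracts by the factor
  \<open>1/2\<close> on the whole interval, so the differences of the iterates form a geometric series.
  The integrability assumption is stated for compositions with continuous functions since the field
  itself is only measurable in time.
\<close>

lemma picard_backward:
  fixes r :: "real \<Rightarrow> 'a::euclidean_space \<Rightarrow> 'a"
  assumes T: "0 \<le> T" and L: "0 < L"
    and int: "\<And>p. continuous_on {0..T} p \<Longrightarrow> (\<lambda>s. r s (p s)) integrable_on {0..T}"
    and lip: "\<And>s y z. s \<in> {0..T} \<Longrightarrow> norm (r s y - r s z) \<le> L * norm (y - z)"
  obtains p where "continuous_on {0..T} p"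
    "\<And>t. t \<in> {0..T} \<Longrightarrow> p t = \<xi> - integral {t..T} (\<lambda>s. r s (p s))"
proof -
  define E where "E = (\<lambda>t. exp (2 * L * (T - t)))"
  define G where "G = (\<lambda>p t. \<xi> - integral {t..T} (\<lambda>s. r s (p s)))"
  define q where "q = (\<lambda>n. (G ^^ n) (\<lambda>_. \<xi>))"
  have Gc: "continuous_on {0..T} (G p)" if "continuous_on {0..T} p" for p
    unfolding G_def by (intro continuous_intros indefinite_integral_continuous_1' int that)
  have qc: "continuous_on {0..T} (q n)" for n
    by (induction n) (auto simp: q_def Gc)
  have sub: "(\<lambda>s. r s (p s)) integrable_on {t..T}"
    if "continuous_on {0..T} p" "t \<in> {0..T}" for p t
    using that by (intro integrable_subinterval_real[OF int[OF that(1)]]) auto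
  have Gdiff: "norm (G p t - G p' t) \<le> m * E t / 2"
    if p: "continuous_on {0..T} p" "continuous_on {0..T} p'" and t: "t \<in> {0..T}" and m: "0 \<le> m"
      and le: "\<And>s. s \<in> {0..T} \<Longrightarrow> norm (p s - p' s) \<le> m * E s" for p p' t m
  proof -
    have "norm (G p t - G p' t) = norm (integral {t..T} (\<lambda>s. r s (p' s) - r s (p s)))"
      using sub p t by (simp add: G_def integral_diff algebra_simps)
    also have "\<dots> \<le> integral {t..T} (\<lambda>s. L * m * E s)"
    proof (rule Henstock_Kurzweil_Integration.integral_norm_bound_integral)
      show "(\<lambda>s. L * m * E s) integrable_on {t..T}"
        unfolding E_def using integrable_on_cmult_left[OF exp_weight_backward(1)[OF L, of t T], of "L * m"] t by simp
      fix s assume "s \<in> {t..T}"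
      with t have s: "s \<in> {0..T}" by auto
      have "norm (r s (p' s) - r s (p s)) \<le> L * norm (p s - p' s)"
        using lip[OF s] by (simp add: norm_minus_commute)
      also have "\<dots> \<le> L * (m * E s)" using le[OF s] L by (intro mult_left_mono) auto
      finally show "norm (r s (p' s) - r s (p s)) \<le> L * m * E s" by (simp add: mult.assoc)
    qed (use sub p t in \<open>auto intro!: integrable_diff\<close>)
    also have "\<dots> = m * (L * integral {t..T} E)" by simp
    also have "\<dots> \<le> m * (E t / 2)"
      unfolding E_def using exp_weight_backward(2)[OF L, of t T] t m by (intro mult_left_mono) auto
    finally show ?thesis by simp
  qed
  have "bounded ((\<lambda>t. q 1 t - q 0 t) ` {0..T})"
    by (intro compact_imp_bounded compact_continuous_image continuous_on_diff qc) simp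
  then obtain m where "m > 0" and m: "\<And>t. t \<in> {0..T} \<Longrightarrow> norm (q 1 t - q 0 t) \<le> m"
    unfolding bounded_pos by (metis imageI)
  have E1: "1 \<le> E t" "E t \<le> E 0" if "t \<in> {0..T}" for t
    using that L by (auto simp: E_def)
  have step: "\<forall>t\<in>{0..T}. norm (q (Suc n) t - q n t) \<le> m * (1/2)^n * E t" for n
  proof (induction n)
    case 0
    have "m * 1 \<le> m * E t" if "t \<in> {0..T}" for t
      using E1[OF that] \<open>m > 0\<close> by (intro mult_left_mono) auto
    then show ?case using m by fastforce
  next
    case (Suc n)
    have "norm (q (Suc (Suc n)) t - q (Suc n) t) \<le> m * (1/2)^n * E t / 2" if "t \<in> {0..T}" for t
      using Gdiff[OF qc qc that, of "m * (1/2)^n" "Suc n" n] Suc \<open>m > 0\<close> by (auto simp: q_def)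
    then show ?case by (simp add: field_simps)
  qed
  define p where "p = (\<lambda>t. q 0 t + (\<Sum>n. q (Suc n) t - q n t))"
  have "uniform_limit {0..T} (\<lambda>n t. \<Sum>i<n. q (Suc i) t - q i t) (\<lambda>t. \<Sum>n. q (Suc n) t - q n t) sequentially"
  proof (rule Weierstrass_m_test)
    show "norm (q (Suc n) t - q n t) \<le> m * (1/2)^n * E 0" if "t \<in> {0..T}" for n t
    proof (rule order.trans[OF bspec[OF step that]])
      show "m * (1/2)^n * E t \<le> m * (1/2)^n * E 0"
        using \<open>m > 0\<close> E1[OF that] by (intro mult_left_mono) auto
    qed
    show "summable (\<lambda>n. m * (1/2)^n * E 0)"
      by (intro summable_mult summable_mult2 summable_geometric) auto
  qed
  from uniform_limit_add[OF uniform_limit_const this, of "q 0"]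
  have lim: "uniform_limit {0..T} q p sequentially"
    using sum_lessThan_telescope[of "\<lambda>i. q i t" for t] by (simp add: p_def)
  have pc: "continuous_on {0..T} p"
    using uniform_limit_theorem[OF _ lim] qc by (auto intro: always_eventually)
  have "p t = G p t" if t: "t \<in> {0..T}" for t
  proof -
    have "(\<lambda>n. q (Suc n) t) \<longlonglongrightarrow> G p t"
    proof (rule LIMSEQ_I)
      fix e :: real assume "e > 0"
      with E1[OF t] have "e / E t > 0" by auto
      then have "\<forall>\<^sub>F n in sequentially. \<forall>s\<in>{0..T}. dist (q n s) (p s) < e / E t"
        using lim by (auto simp: uniform_limit_iff)
      then obtain N where N: "\<And>n s. n \<ge> N \<Longrightarrow> s \<in> {0..T} \<Longrightarrow> dist (q n s) (p s) < e / E t"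
        unfolding eventually_sequentially by blast
      have "norm (q (Suc n) t - G p t) < e" if "n \<ge> N" for n
      proof -
        have "norm (q n s - p s) \<le> e / E t * E s" if s: "s \<in> {0..T}" for s
          using N[OF \<open>n \<ge> N\<close> s] mult_left_mono[OF E1(1)[OF s], of "e / E t"] \<open>e / E t > 0\<close>
          by (simp add: dist_norm)
        then have "norm (G (q n) t - G p t) \<le> e / E t * E t / 2"
          using \<open>e / E t > 0\<close> by (intro Gdiff[OF qc pc t]) auto
        with \<open>e > 0\<close> E1[OF t] show ?thesis by (simp add: q_def)
      qed
      then show "\<exists>N. \<forall>n\<ge>N. norm (q (Suc n) t - G p t) < e" by blast
    qed
    moreover have "(\<lambda>n. q (Suc n) t) \<longlonglongrightarrow> p t"
      using tendsto_uniform_limitI[OF lim t] by (rule LIMSEQ_Suc)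
    ultimately show ?thesis using LIMSEQ_unique by blast
  qed
  with pc that show ?thesis unfolding G_def by blast
qed

section \<open>Tools for continuous and absolutely continuous functions\<close>

text \<open>
  A bound on \<open>[0, t]\<close> that improves itself to a strict one cannot be lost: at the first time
  where \<open>norm (e t)\<close> reaches \<open>c\<close> it would be both equal to and smaller than
  \<open>c\<close>. It allows estimates that are valid only while a trajectory stays in a given ball.
\<close>

lemma bootstrap_bound:
  fixes e :: "real \<Rightarrow> 'a::real_normed_vector"
  assumes e: "continuous_on {0..T} e" and e0: "e 0 = 0" and "0 < c"
    and step: "\<And>t. \<lbrakk>t \<in> {0..T}; \<And>s. s \<in> {0..t} \<Longrightarrow> norm (e s) \<le> c\<rbrakk> \<Longrightarrow> norm (e t) < c"
    and t: "t \<in> {0..T}"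
  shows "norm (e t) < c"
proof (rule ccontr)
  assume neg: "\<not> norm (e t) < c"
  define A where "A = {s \<in> {0..T}. c \<le> norm (e s)}"
  have "closed A"
    using continuous_closed_preimage[OF continuous_on_norm[OF e] closed_atLeastAtMost closed_atLeast[of c]]
    by (simp add: A_def Int_def vimage_def)
  then have "compact A"
    using bounded_subset[OF bounded_closed_interval[of 0 T], of A] by (auto simp: compact_eq_bounded_closed A_def subset_eq)
  moreover have "A \<noteq> {}" using neg t by (auto simp: A_def)
  ultimately obtain \<tau> where \<tau>: "\<tau> \<in> A" "\<And>s. s \<in> A \<Longrightarrow> \<tau> \<le> s"
    using compact_attains_inf[of A] by metis
  have \<tau>T: "\<tau> \<in> {0..T}" and c\<tau>: "c \<le> norm (e \<tau>)" using \<tau> by (auto simp: A_def)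
  have "\<exists>s\<ge>0. s \<le> \<tau> \<and> norm (e s) = c"
    using \<tau>T c\<tau> \<open>0 < c\<close> e0 by (intro IVT' continuous_intros continuous_on_subset[OF e]) auto
  then obtain s where "0 \<le> s" "s \<le> \<tau>" "norm (e s) = c" by blast
  moreover from this have "s \<in> A" using \<tau>T by (auto simp: A_def)
  ultimately have "norm (e \<tau>) = c" using \<tau>(2)[of s] by (auto simp: antisym)
  moreover have "norm (e s) \<le> c" if "s \<in> {0..\<tau>}" for s
    using \<tau>(2)[of s] that \<tau>T \<open>norm (e \<tau>) = c\<close> by (cases "s = \<tau>") (auto simp: A_def not_le[symmetric] intro: ccontr)
  ultimately show False using step[OF \<tau>T] by fastforce
qed

text \<open>
  Over \<open>n\<close> equal steps the increments add up to at most \<open>C * T\<^sup>2 / n\<close>.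
\<close>

lemma eq_endpoints_if_quadratic_modulus:
  fixes W :: "real \<Rightarrow> real"
  assumes T: "0 \<le> T" and W: "\<And>s t. \<lbrakk>0 \<le> s; s \<le> t; t \<le> T\<rbrakk> \<Longrightarrow> \<bar>W t - W s\<bar> \<le> C * (t - s)\<^sup>2"
  shows "W T = W 0"
proof -
  have bound: "\<bar>W T - W 0\<bar> \<le> C * T\<^sup>2 * inverse (real (Suc n))" for n
  proof -
    define N where "N = real (Suc n)"
    define \<tau> where "\<tau> = (\<lambda>k::nat. real k * T / N)"
    have N: "N > 0" by (simp add: N_def)
    have "W T - W 0 = (\<Sum>k<Suc n. W (\<tau> (Suc k)) - W (\<tau> k))"
      using N sum_lessThan_telescope[of "\<lambda>k. W (\<tau> k)" "Suc n"] by (simp add: \<tau>_def N_def)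
    also have "\<bar>\<dots>\<bar> \<le> (\<Sum>k<Suc n. C * (T / N)\<^sup>2)"
    proof (rule order.trans[OF sum_abs], rule sum_mono)
      fix k assume "k \<in> {..<Suc n}"
      then have "real (Suc k) \<le> N" by (auto simp: N_def)
      then have "\<tau> (Suc k) \<le> T" using T N mult_right_mono[of "real (Suc k)" N T] by (simp add: \<tau>_def divide_le_eq mult.commute)
      moreover have "0 \<le> \<tau> k" "\<tau> k \<le> \<tau> (Suc k)" using T N by (auto simp: \<tau>_def divide_right_mono mult_right_mono)
      moreover have "\<tau> (Suc k) - \<tau> k = T / N" using N by (simp add: \<tau>_def field_simps)
      ultimately show "\<bar>W (\<tau> (Suc k)) - W (\<tau> k)\<bar> \<le> C * (T / N)\<^sup>2" using W by metis
    qed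
    also have "\<dots> = C * T\<^sup>2 * inverse N" using N by (simp only: sum_constant card_lessThan N_def[symmetric]) (simp add: power2_eq_square field_simps)
    finally show ?thesis by (simp add: N_def)
  qed
  have "(\<lambda>n. C * T\<^sup>2 * inverse (real (Suc n))) \<longlonglongrightarrow> C * T\<^sup>2 * 0"
    by (intro tendsto_intros LIMSEQ_inverse_real_of_nat)
  then have "\<bar>W T - W 0\<bar> \<le> C * T\<^sup>2 * 0" using bound by (intro LIMSEQ_le_const) auto
  then show ?thesis by simp
qed

lemma continuous_inner_absolutely_integrable:
  fixes p g :: "real \<Rightarrow> 'a::euclidean_space"
  assumes "continuous_on {a..b} p" and "g absolutely_integrable_on {a..b}"
  shows "(\<lambda>s. p s \<bullet> g s) absolutely_integrable_on {a..b}"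
proof (rule absolutely_integrable_bounded_measurable_product[where h="(\<bullet>)" and f=p, OF _ _ _ _ assms(2)])
  show "bilinear ((\<bullet>) :: 'a \<Rightarrow> 'a \<Rightarrow> real)" by (simp add: bilinear_def inner_left_distrib inner_right_distrib linear_iff)
  show "p \<in> borel_measurable (lebesgue_on {a..b})"
    using assms by (intro continuous_imp_measurable_on_sets_lebesgue) auto
  show "bounded (p ` {a..b})" using assms by (intro compact_imp_bounded compact_continuous_image) auto
qed auto

text \<open>
  Integration by parts for Lipschitz primitives. The defect
  \<open>p t \<bullet> h t - integral {0..t} (\<dots>)\<close> has increments that are quadratic in the step,
  because over a short interval \<open>p\<close> and \<open>h\<close> may be frozen; thus it is constant.
\<close>

lemma inner_integral_by_parts:
  fixes g r h p :: "real \<Rightarrow> 'a::euclidean_space"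
  assumes T: "0 \<le> T"
    and g: "g absolutely_integrable_on {0..T}" and r: "r absolutely_integrable_on {0..T}"
    and gC: "\<And>s. s \<in> {0..T} \<Longrightarrow> norm (g s) \<le> C" and rC: "\<And>s. s \<in> {0..T} \<Longrightarrow> norm (r s) \<le> C"
    and h: "\<And>t. t \<in> {0..T} \<Longrightarrow> h t = integral {0..t} g"
    and p: "\<And>t. t \<in> {0..T} \<Longrightarrow> p t = \<xi> - integral {t..T} r"
  shows "p T \<bullet> h T = integral {0..T} (\<lambda>s. p s \<bullet> g s + h s \<bullet> r s)"
proof -
  note gi = set_lebesgue_integral_eq_integral(1)[OF g] and ri = set_lebesgue_integral_eq_integral(1)[OF r]
  have sub: "f integrable_on {s..t}" if "f integrable_on {0..T}" "0 \<le> s" "t \<le> T" for f :: "real \<Rightarrow> 'b::banach" and s t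
    using that by (intro integrable_subinterval_real[OF that(1)]) auto
  have hc: "continuous_on {0..T} h"
    using indefinite_integral_continuous_1[OF gi] by (rule continuous_on_eq) (simp add: h)
  have pc: "continuous_on {0..T} p"
    using continuous_on_diff[OF continuous_on_const indefinite_integral_continuous_1'[OF ri], of \<xi>]
    by (rule continuous_on_eq) (simp add: p)
  define q where "q = (\<lambda>s. p s \<bullet> g s + h s \<bullet> r s)"
  have pg: "(\<lambda>s. p s \<bullet> g s) integrable_on {0..T}" and hr: "(\<lambda>s. h s \<bullet> r s) integrable_on {0..T}"
    by (intro set_lebesgue_integral_eq_integral(1) continuous_inner_absolutely_integrable pc hc g r)+
  have qi: "q integrable_on {0..T}" unfolding q_def by (intro integrable_add pg hr)
  have hst: "h t - h s = integral {s..t} g" and pst: "p t - p s = integral {s..t} r"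
    if "0 \<le> s" "s \<le> t" "t \<le> T" for s t
  proof -
    show "h t - h s = integral {s..t} g"
      using Henstock_Kurzweil_Integration.integral_combine[of 0 s t g] sub[OF gi, of 0 t] that by (simp add: h algebra_simps)
    show "p t - p s = integral {s..t} r"
      using Henstock_Kurzweil_Integration.integral_combine[of s t T r] sub[OF ri, of s T] that by (simp add: p algebra_simps)
  qed
  have C: "0 \<le> C" using gC[of 0] T order.trans[OF norm_ge_zero] by auto
  have intC: "norm (integral {s..t} f) \<le> C * (t - s)"
    if "f integrable_on {0..T}" "\<And>s. s \<in> {0..T} \<Longrightarrow> norm (f s) \<le> C" "0 \<le> s" "s \<le> t" "t \<le> T" for f :: "real \<Rightarrow> 'a" and s t
    using has_integral_bound_real[OF C finite.emptyI integrable_integral[OF sub[OF that(1,3,5)]]] that by auto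
  have hlip: "norm (h t - h s) \<le> C * (t - s)" and plip: "norm (p t - p s) \<le> C * (t - s)"
    if "0 \<le> s" "s \<le> t" "t \<le> T" for s t
    using that intC[OF gi gC] intC[OF ri rC] by (auto simp: hst pst)
  \<comment> \<open>The defect of the product rule; freezing \<open>p\<close> and \<open>h\<close> at the left end of a step shows that
    its increments are quadratic.\<close>
  define W where "W = (\<lambda>t. p t \<bullet> h t - integral {0..t} q)"
  have "W T = W 0"
  proof (rule eq_endpoints_if_quadratic_modulus[OF T])
    fix s t :: real assume st: "0 \<le> s" "s \<le> t" "t \<le> T"
    note si = sub[OF _ st(1) st(3)]
    have "integral {s..t} q = p s \<bullet> (h t - h s) + h s \<bullet> (p t - p s)
        + integral {s..t} (\<lambda>u. (p u - p s) \<bullet> g u + (h u - h s) \<bullet> r u)"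
    proof -
      have 1: "integral {s..t} (\<lambda>u. p s \<bullet> g u) = p s \<bullet> (h t - h s)"
        "integral {s..t} (\<lambda>u. h s \<bullet> r u) = h s \<bullet> (p t - p s)"
        using integral_linear[OF si[OF gi] bounded_linear_inner_right[of "p s"]]
          integral_linear[OF si[OF ri] bounded_linear_inner_right[of "h s"]] by (simp_all add: o_def hst pst st)
      have 2: "(\<lambda>u. p s \<bullet> g u) integrable_on {s..t}" "(\<lambda>u. h s \<bullet> r u) integrable_on {s..t}"
        using integrable_linear[OF si[OF gi] bounded_linear_inner_right[of "p s"]]
          integrable_linear[OF si[OF ri] bounded_linear_inner_right[of "h s"]] by (simp_all add: o_def)
      have "integral {s..t} (\<lambda>u. (p u - p s) \<bullet> g u + (h u - h s) \<bullet> r u)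
          = integral {s..t} (\<lambda>u. q u - (p s \<bullet> g u + h s \<bullet> r u))"
        by (intro integral_cong) (simp add: q_def inner_diff_left)
      also have "\<dots> = integral {s..t} q - (p s \<bullet> (h t - h s) + h s \<bullet> (p t - p s))"
        using 2 si[OF qi] by (subst integral_diff) (auto simp: integral_add 1 intro: integrable_add)
      finally show ?thesis by simp
    qed
    moreover have "norm (integral {s..t} (\<lambda>u. (p u - p s) \<bullet> g u + (h u - h s) \<bullet> r u)) \<le> 2 * C\<^sup>2 * (t - s) * (t - s)"
    proof -
      have "(\<lambda>u. (p u - p s) \<bullet> g u + (h u - h s) \<bullet> r u) integrable_on {s..t}"
        by (rule si, intro integrable_add set_lebesgue_integral_eq_integral(1) continuous_inner_absolutely_integrable continuous_intros pc hc g r)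
      moreover have "norm ((p u - p s) \<bullet> g u + (h u - h s) \<bullet> r u) \<le> 2 * C\<^sup>2 * (t - s)" if u: "u \<in> {s..t}" for u
      proof -
        have "\<bar>(p u - p s) \<bullet> g u\<bar> \<le> (C * (t - s)) * C"
          using plip[of s u] gC[of u] u st C mult_left_mono[of "u - s" "t - s" C]
          by (intro order.trans[OF Cauchy_Schwarz_ineq2] mult_mono) auto
        moreover have "\<bar>(h u - h s) \<bullet> r u\<bar> \<le> (C * (t - s)) * C"
          using hlip[of s u] rC[of u] u st C mult_left_mono[of "u - s" "t - s" C]
          by (intro order.trans[OF Cauchy_Schwarz_ineq2] mult_mono) auto
        ultimately show ?thesis by (simp add: power2_eq_square algebra_simps)
      qed
      ultimately have "norm (integral {s..t} (\<lambda>u. (p u - p s) \<bullet> g u + (h u - h s) \<bullet> r u))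
          \<le> 2 * C\<^sup>2 * (t - s) * measure lborel {s..t}"
        using st by (intro has_integral_bound_real[OF _ finite.emptyI integrable_integral]) auto
      then show ?thesis using st by simp
    qed
    moreover have "integral {0..t} q = integral {0..s} q + integral {s..t} q"
      using Henstock_Kurzweil_Integration.integral_combine[of 0 s t q] sub[OF qi, of 0 t] st by simp
    moreover have "\<bar>(p t - p s) \<bullet> (h t - h s)\<bar> \<le> C * (t - s) * (C * (t - s))"
      using plip[OF st] hlip[OF st] C st by (intro order.trans[OF Cauchy_Schwarz_ineq2] mult_mono) auto
    moreover have "p t \<bullet> h t - p s \<bullet> h s = p s \<bullet> (h t - h s) + h s \<bullet> (p t - p s) + (p t - p s) \<bullet> (h t - h s)"
      by (simp add: inner_diff_left inner_diff_right inner_commute algebra_simps)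
    ultimately have "\<bar>W t - W s\<bar> \<le> C * (t - s) * (C * (t - s)) + 2 * C\<^sup>2 * (t - s) * (t - s)"
      unfolding W_def by simp
    also have "\<dots> = 3 * C\<^sup>2 * (t - s)\<^sup>2" by (simp add: power2_eq_square algebra_simps)
    finally show "\<bar>W t - W s\<bar> \<le> 3 * C\<^sup>2 * (t - s)\<^sup>2" .
  qed
  then show ?thesis using T by (simp add: W_def q_def h)
qed
lemma norm_fst_le': "norm (fst z) \<le> norm z"
  using norm_fst_le[of "fst z" "snd z"] by simp

lemma norm_le_if_inner_le:
  fixes a :: "'a::real_inner"
  assumes "\<And>h. a \<bullet> h \<le> C * norm h" "0 \<le> C"
  shows "norm a \<le> C"
proof (cases "a = 0")
  case False
  have "norm a * norm a \<le> C * norm a" using assms(1)[of a] by (simp add: dot_square_norm power2_eq_square)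
  then show ?thesis using False by simp
qed (use assms in simp)

section \<open>Weak sequential compactness of measurable controls\<close>

text \<open>
  Successive extraction, one index after the other; it needs a property that is inherited by
  subsequences.
\<close>

lemma finite_common_subseq:
  fixes Q :: "'i \<Rightarrow> (nat \<Rightarrow> nat) \<Rightarrow> bool"
  assumes "finite I"
    and ex: "\<And>i (r :: nat \<Rightarrow> nat). i \<in> I \<Longrightarrow> strict_mono r \<Longrightarrow> \<exists>s :: nat \<Rightarrow> nat. strict_mono s \<and> Q i (r \<circ> s)"
    and sub: "\<And>i r (s :: nat \<Rightarrow> nat). i \<in> I \<Longrightarrow> Q i r \<Longrightarrow> strict_mono s \<Longrightarrow> Q i (r \<circ> s)"
  shows "\<exists>r. strict_mono r \<and> (\<forall>i\<in>I. Q i r)"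
proof -
  have "F \<subseteq> I \<longrightarrow> (\<exists>r. strict_mono r \<and> (\<forall>i\<in>F. Q i r))" if "finite F" for F
    using that
  proof (induction F)
    case empty
    have "strict_mono (id :: nat \<Rightarrow> nat)" by (simp add: strict_mono_def)
    then show ?case by blast
  next
    case (insert j F)
    show ?case
    proof
      assume j: "insert j F \<subseteq> I"
      then obtain r where r: "strict_mono r" "\<forall>i\<in>F. Q i r" using insert.IH by blast
      obtain s :: "nat \<Rightarrow> nat" where s: "strict_mono s" "Q j (r \<circ> s)" using ex[of j r] r(1) j by blast
      have "\<forall>i\<in>insert j F. Q i (r \<circ> s)" using sub[OF _ _ s(1)] r(2) s(2) j by blast
      then show "\<exists>r. strict_mono r \<and> (\<forall>i\<in>insert j F. Q i r)" using strict_mono_o[OF r(1) s(1)] by blast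
    qed
  qed
  from this[OF \<open>finite I\<close>] show ?thesis by simp
qed

lemma bounded_measurable_absolutely_integrable:
  fixes f :: "real \<Rightarrow> 'a::euclidean_space"
  assumes "f \<in> borel_measurable (lebesgue_on {a..b})" and "\<And>s. s \<in> {a..b} \<Longrightarrow> norm (f s) \<le> B"
  shows "f absolutely_integrable_on {a..b}"
  using assms by (intro measurable_bounded_by_integrable_imp_absolutely_integrable[where g="\<lambda>_. B"]) auto

lemma integrable_on_initial:
  fixes f :: "real \<Rightarrow> 'a::euclidean_space"
  assumes "f absolutely_integrable_on {0..T}" "t \<in> {0..T}"
  shows "f integrable_on {0..t}"
  using assms set_lebesgue_integral_eq_integral(1)[OF assms(1)] by (auto intro: integrable_subinterval_real)

lemma norm_integral_le_const:
  fixes f :: "real \<Rightarrow> 'a::euclidean_space"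
  assumes "f integrable_on {s..t}" "s \<le> t" "\<And>u. u \<in> {s..t} \<Longrightarrow> norm (f u) \<le> B"
  shows "norm (integral {s..t} f) \<le> B * (t - s)"
proof -
  have "0 \<le> B" using assms(2) order.trans[OF norm_ge_zero assms(3)[of s]] by auto
  from has_integral_bound_real[OF this finite.emptyI integrable_integral[OF assms(1)]] assms show ?thesis by auto
qed

lemma parallelogram_half:
  fixes a b :: "'a::real_inner"
  shows "(norm (a - b))\<^sup>2 = 2 * (norm a)\<^sup>2 + 2 * (norm b)\<^sup>2 - 4 * (norm ((1/2) *\<^sub>R a + (1/2) *\<^sub>R b))\<^sup>2"
  by (simp add: power2_norm_eq_inner inner_diff_left inner_diff_right inner_add_left inner_add_right inner_commute field_simps)

text \<open>
  Integrates \<open>2 * norm x \<le> e + (norm x)\<^sup>2 / e\<close>. It turns smallness in \<open>L2\<close>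
  into smallness in \<open>L1\<close>.
\<close>

lemma integral_norm_le_sq:
  fixes f :: "real \<Rightarrow> 'a::euclidean_space"
  assumes f: "f absolutely_integrable_on {0..T}" and f2: "(\<lambda>s. (norm (f s))\<^sup>2) integrable_on {0..T}"
    and T: "0 \<le> T" and e: "0 < e"
  shows "integral {0..T} (\<lambda>s. norm (f s)) \<le> (e * T + integral {0..T} (\<lambda>s. (norm (f s))\<^sup>2) / e) / 2"
proof -
  have "integral {0..T} (\<lambda>s. norm (f s)) \<le> integral {0..T} (\<lambda>s. (e + (norm (f s))\<^sup>2 * (1 / e)) * (1/2))"
  proof (rule integral_le)
    show "(\<lambda>s. norm (f s)) integrable_on {0..T}" using f by (simp add: absolutely_integrable_on_def)
    show "(\<lambda>s. (e + (norm (f s))\<^sup>2 * (1 / e)) * (1/2)) integrable_on {0..T}"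
      by (intro integrable_on_mult_left integrable_add f2) auto
    show "norm (f s) \<le> (e + (norm (f s))\<^sup>2 * (1 / e)) * (1/2)" for s
      using e zero_le_power2[of "norm (f s) - e"] by (simp add: field_simps power2_eq_square)
  qed
  also have "\<dots> = (e * T + integral {0..T} (\<lambda>s. (norm (f s))\<^sup>2) / e) / 2"
  proof -
    have "(\<lambda>s. (norm (f s))\<^sup>2 * (1 / e)) integrable_on {0..T}" using f2 by (rule integrable_on_mult_left)
    then show ?thesis using T by (simp only: integral_mult_left integral_add integrable_const_ivl) simp
  qed
  finally show ?thesis .
qed

text \<open>
  Let \<open>S k\<close> be the set of admissible \<open>g\<close> whose primitives are
  \<open>1 / (k + 1)\<close>-close to \<open>G\<close>. These sets decrease and are closed under midpoints, so
  the infima \<open>d k\<close> of the squared \<open>L2\<close> norm \<open>Q\<close> increase, and by the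
  parallelogram law almost-minimizers \<open>g k\<close> are Cauchy in \<open>L2\<close>. A subsequence
  converges almost everywhere. Convexity enters only through midpoints, and compactness through
  sequential closedness and boundedness.

  The family is indexed by a finite set since the values at different indices are coupled through
  \<open>C\<close>.
\<close>

lemma mazur_representation:
  fixes G :: "'i \<Rightarrow> real \<Rightarrow> 'a::euclidean_space" and C :: "('i \<Rightarrow> 'a) set"
    and A :: "(real \<Rightarrow> 'i \<Rightarrow> 'a) set"
  assumes A_def: "A = {g. (\<forall>s\<in>{0..T}. g s \<in> C) \<and> (\<forall>i\<in>I. (\<lambda>s. g s i) \<in> borel_measurable (lebesgue_on {0..T}))}"
    and I: "finite I" and T: "0 \<le> T"
    and mid: "\<And>a b. a \<in> C \<Longrightarrow> b \<in> C \<Longrightarrow> (\<lambda>i. (1/2) *\<^sub>R a i + (1/2) *\<^sub>R b i) \<in> C"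
    and closed: "\<And>a l. (\<And>n::nat. a n \<in> C) \<Longrightarrow> (\<And>i. i \<in> I \<Longrightarrow> (\<lambda>n. a n i) \<longlonglongrightarrow> l i) \<Longrightarrow> l \<in> C"
    and bound: "\<And>a i. a \<in> C \<Longrightarrow> i \<in> I \<Longrightarrow> norm (a i) \<le> B"
    and approx: "\<And>k::nat. \<exists>g\<in>A. \<forall>i\<in>I. \<forall>t\<in>{0..T}.
        norm (integral {0..t} (\<lambda>s. g s i) - G i t) \<le> 1 / real (Suc k)"
  shows "\<exists>\<zeta>\<in>A. \<forall>i\<in>I. \<forall>t\<in>{0..T}. integral {0..t} (\<lambda>s. \<zeta> s i) = G i t"
proof -
  have AC: "g s \<in> C" if "g \<in> A" "s \<in> {0..T}" for g s using that by (auto simp: A_def)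
  have Am [measurable]: "(\<lambda>s. g s i) \<in> borel_measurable (lebesgue_on {0..T})" if "g \<in> A" "i \<in> I" for g i
    using that by (auto simp: A_def)
  have Ab: "norm (g s i) \<le> B" if "g \<in> A" "i \<in> I" "s \<in> {0..T}" for g i s
    using bound AC that by blast
  have Aint: "(\<lambda>s. g s i) absolutely_integrable_on {0..T}" if "g \<in> A" "i \<in> I" for g i
    using Am Ab that by (intro bounded_measurable_absolutely_integrable[where B=B]) auto
  have sqint: "(\<lambda>s. (norm (g s i))\<^sup>2) integrable_on {0..T}" if "g \<in> A" "i \<in> I" for g i
  proof (intro set_lebesgue_integral_eq_integral(1) bounded_measurable_absolutely_integrable[where B="B\<^sup>2"])
    show "(\<lambda>s. (norm (g s i))\<^sup>2) \<in> borel_measurable (lebesgue_on {0..T})"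
      using Am[OF that] by measurable
    show "norm ((norm (g s i))\<^sup>2) \<le> B\<^sup>2" if "s \<in> {0..T}" for s
      using Ab[OF \<open>g \<in> A\<close> \<open>i \<in> I\<close> that] by (simp add: power_mono)
  qed
  define Q :: "(real \<Rightarrow> 'i \<Rightarrow> 'a) \<Rightarrow> real" where "Q = (\<lambda>g. \<Sum>i\<in>I. integral {0..T} (\<lambda>s. (norm (g s i))\<^sup>2))"
  define S where "S = (\<lambda>k::nat. {g \<in> A. \<forall>i\<in>I. \<forall>t\<in>{0..T}.
      norm (integral {0..t} (\<lambda>s. g s i) - G i t) \<le> 1 / real (Suc k)})"
  define d where "d = (\<lambda>k. Inf (Q ` S k))"
  have SA: "g \<in> A" if "g \<in> S k" for g k using that by (auto simp: S_def)
  have Sne: "S k \<noteq> {}" for k using approx[of k] by (auto simp: S_def)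
  have Santi: "S m \<subseteq> S n" if "n \<le> m" for m n
  proof -
    have "1 / real (Suc m) \<le> 1 / real (Suc n)" using that by (intro divide_left_mono) auto
    then show ?thesis unfolding S_def by (blast intro: order.trans)
  qed
  have "0 \<le> integral {0..T} (\<lambda>s. (norm (f s))\<^sup>2)" for f :: "real \<Rightarrow> 'a"
    by (cases "(\<lambda>s. (norm (f s))\<^sup>2) integrable_on {0..T}")
      (simp_all add: Henstock_Kurzweil_Integration.integral_nonneg not_integrable_integral)
  then have Qpos: "0 \<le> Q g" for g
    unfolding Q_def by (intro sum_nonneg) auto
  have Qbound: "Q g \<le> card I * (B\<^sup>2 * T)" if "g \<in> A" for g
  proof -
    have "integral {0..T} (\<lambda>s. (norm (g s i))\<^sup>2) \<le> B\<^sup>2 * T" if "i \<in> I" for i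
    proof -
      have "integral {0..T} (\<lambda>s. (norm (g s i))\<^sup>2) \<le> integral {0..T} (\<lambda>s. B\<^sup>2)"
        using Ab[OF \<open>g \<in> A\<close> that] sqint[OF \<open>g \<in> A\<close> that] by (intro integral_le) (auto intro: power_mono)
      then show ?thesis using T by (simp add: mult.commute)
    qed
    then show ?thesis unfolding Q_def by (intro sum_bounded_above[where K="B\<^sup>2 * T", simplified]) auto
  qed
  have bdd: "bdd_below (Q ` S k)" for k using Qpos by (intro bdd_belowI[of _ 0]) auto
  have "\<exists>g. g \<in> S k \<and> Q g < d k + 1 / real (Suc k)" for k
    using cInf_lessD[of "Q ` S k" "d k + 1 / real (Suc k)"] Sne[of k] by (auto simp: d_def)
  then obtain g where gS: "\<And>k. g k \<in> S k" and gQ: "\<And>k. Q (g k) < d k + 1 / real (Suc k)" by metis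
  note gA = SA[OF gS]
  have "incseq d" unfolding incseq_def d_def
    using Santi Sne bdd by (auto intro!: cInf_superset_mono image_mono)
  moreover have "d k \<le> card I * (B\<^sup>2 * T)" for k
    using cInf_lower[OF imageI[OF gS[of k]] bdd] Qbound[OF gA[of k]] by (auto simp: d_def intro: order.trans)
  ultimately obtain D where "d \<longlonglongrightarrow> D" using incseq_convergent[of d "card I * (B\<^sup>2 * T)"] by blast
  then have "Cauchy d" by (rule LIMSEQ_imp_Cauchy)
  have sqdiff: "integral {0..T} (\<lambda>s. (norm (g n s i - g m s i))\<^sup>2) \<le> 2 * (d m - d n) + 2 * (1 / real (Suc n)) + 2 * (1 / real (Suc m))"
    and sqdint: "(\<lambda>s. (norm (g n s i - g m s i))\<^sup>2) integrable_on {0..T}"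
    if "n \<le> m" "i \<in> I" for n m i
  proof -
    \<comment> \<open>The midpoint of \<open>g n\<close> and \<open>g m\<close> competes in \<open>S n\<close>, so \<open>Q h\<close> is at least \<open>d n\<close>.\<close>
    define h where "h = (\<lambda>s i. (1/2) *\<^sub>R g n s i + (1/2) *\<^sub>R g m s i)"
    have hA: "h \<in> A"
      unfolding A_def mem_Collect_eq h_def
      by (intro conjI ballI mid AC gA borel_measurable_add borel_measurable_scaleR borel_measurable_const Am)
    have gm: "g m \<in> S n" using Santi[OF \<open>n \<le> m\<close>] gS by blast
    have "h \<in> S n"
    proof -
      have "norm (integral {0..t} (\<lambda>s. h s i) - G i t) \<le> 1 / real (Suc n)" if "i \<in> I" "t \<in> {0..T}" for i t
      proof -
        have "integral {0..t} (\<lambda>s. h s i)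
            = (1/2) *\<^sub>R integral {0..t} (\<lambda>s. g n s i) + (1/2) *\<^sub>R integral {0..t} (\<lambda>s. g m s i)"
          unfolding h_def using integrable_on_initial[OF Aint[OF gA that(1)] that(2)]
          by (subst integral_add) (auto intro: integrable_cmul)
        then have "integral {0..t} (\<lambda>s. h s i) - G i t = (1/2) *\<^sub>R (integral {0..t} (\<lambda>s. g n s i) - G i t)
            + (1/2) *\<^sub>R (integral {0..t} (\<lambda>s. g m s i) - G i t)"
          by (simp add: algebra_simps flip: scaleR_add_left)
        also have "norm \<dots> \<le> (1/2) * norm (integral {0..t} (\<lambda>s. g n s i) - G i t)
            + (1/2) * norm (integral {0..t} (\<lambda>s. g m s i) - G i t)"
          by (rule order.trans[OF norm_triangle_ineq]) simp
        also have "\<dots> \<le> 1 / real (Suc n)"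
        proof -
          have "norm (integral {0..t} (\<lambda>s. g n s i) - G i t) \<le> 1 / real (Suc n)"
            "norm (integral {0..t} (\<lambda>s. g m s i) - G i t) \<le> 1 / real (Suc n)"
            using gS[of n] gm that unfolding S_def by blast+
          then show ?thesis by linarith
        qed
        finally show ?thesis .
      qed
      with hA show ?thesis by (auto simp: S_def)
    qed
    then have dQ: "d n \<le> Q h" unfolding d_def by (intro cInf_lower bdd imageI)
    have sq: "(\<lambda>s. (norm (g n s i - g m s i))\<^sup>2) integrable_on {0..T}"
      "integral {0..T} (\<lambda>s. (norm (g n s i - g m s i))\<^sup>2) = 2 * integral {0..T} (\<lambda>s. (norm (g n s i))\<^sup>2)
        + 2 * integral {0..T} (\<lambda>s. (norm (g m s i))\<^sup>2) - 4 * integral {0..T} (\<lambda>s. (norm (h s i))\<^sup>2)"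
      if "i \<in> I" for i
    proof -
      note * = sqint[OF gA[of n] that] sqint[OF gA[of m] that] sqint[OF hA that]
      have "((\<lambda>s. 2 * (norm (g n s i))\<^sup>2 + 2 * (norm (g m s i))\<^sup>2 - 4 * (norm (h s i))\<^sup>2) has_integral
         2 * integral {0..T} (\<lambda>s. (norm (g n s i))\<^sup>2)
        + 2 * integral {0..T} (\<lambda>s. (norm (g m s i))\<^sup>2) - 4 * integral {0..T} (\<lambda>s. (norm (h s i))\<^sup>2)) {0..T}"
        by (intro has_integral_diff has_integral_add has_integral_mult_right integrable_integral *)
      then show "(\<lambda>s. (norm (g n s i - g m s i))\<^sup>2) integrable_on {0..T}"
        "integral {0..T} (\<lambda>s. (norm (g n s i - g m s i))\<^sup>2) = 2 * integral {0..T} (\<lambda>s. (norm (g n s i))\<^sup>2)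
        + 2 * integral {0..T} (\<lambda>s. (norm (g m s i))\<^sup>2) - 4 * integral {0..T} (\<lambda>s. (norm (h s i))\<^sup>2)"
        unfolding parallelogram_half h_def by (auto simp: integrable_on_def integral_unique)
    qed
    show "(\<lambda>s. (norm (g n s i - g m s i))\<^sup>2) integrable_on {0..T}" using sq(1) that by blast
    have "integral {0..T} (\<lambda>s. (norm (g n s i - g m s i))\<^sup>2)
        \<le> (\<Sum>i\<in>I. integral {0..T} (\<lambda>s. (norm (g n s i - g m s i))\<^sup>2))"
      using that I by (intro member_le_sum Henstock_Kurzweil_Integration.integral_nonneg sq(1)) auto
    also have "\<dots> = 2 * Q (g n) + 2 * Q (g m) - 4 * Q h"
      by (simp add: sq(2) Q_def sum.distrib sum_subtractf sum_distrib_left)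
    also have "\<dots> \<le> 2 * (d n + 1 / real (Suc n)) + 2 * (d m + 1 / real (Suc m)) - 4 * d n"
    proof -
      have "2 * x + 2 * y - 4 * Q h \<le> 2 * a + 2 * b - 4 * d n" if "x < a" "y < b" for x y a b
        using that dQ by linarith
      from this[OF gQ gQ] show ?thesis .
    qed
    also have "\<dots> = 2 * (d m - d n) + 2 * (1 / real (Suc n)) + 2 * (1 / real (Suc m))" by simp
    finally show "integral {0..T} (\<lambda>s. (norm (g n s i - g m s i))\<^sup>2) \<le> 2 * (d m - d n) + 2 * (1 / real (Suc n)) + 2 * (1 / real (Suc m))" .
  qed
  have L2: "\<exists>N. \<forall>n\<ge>N. \<forall>m\<ge>N. (\<lambda>s. (norm (g n s i - g m s i))\<^sup>2) integrable_on {0..T}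
      \<and> integral {0..T} (\<lambda>s. (norm (g n s i - g m s i))\<^sup>2) < e" if "i \<in> I" "e > 0" for i e
  proof -
    obtain N1 where N1: "\<And>n m. n \<ge> N1 \<Longrightarrow> m \<ge> N1 \<Longrightarrow> \<bar>d m - d n\<bar> < e / 6"
      using CauchyD[OF \<open>Cauchy d\<close>, of "e / 6"] \<open>e > 0\<close> by auto
    obtain N2 where N2: "1 / real (Suc N2) < e / 6"
      using nat_approx_posE[of "e / 6"] \<open>e > 0\<close> by (auto simp: field_simps)
    define N where "N = max N1 N2"
    have *: "(\<lambda>s. (norm (g n s i - g m s i))\<^sup>2) integrable_on {0..T}
      \<and> integral {0..T} (\<lambda>s. (norm (g n s i - g m s i))\<^sup>2) < e" if "N \<le> n" "n \<le> m" for n m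
    proof -
      have "1 / real (Suc n) \<le> 1 / real (Suc N2)" "1 / real (Suc m) \<le> 1 / real (Suc N2)"
        using that by (auto intro!: divide_left_mono simp: N_def)
      moreover have "d m - d n < e / 6" using le_less_trans[OF abs_ge_self N1[of n m]] that by (simp add: N_def)
      moreover have "x < e" if "x \<le> 2 * z + 2 * a + 2 * b" "a \<le> c" "b \<le> c" "c < e / 6" "z < e / 6" for x z a b c
        using that by linarith
      ultimately show ?thesis
        using sqdiff[OF that(2) \<open>i \<in> I\<close>] sqdint[OF that(2) \<open>i \<in> I\<close>] N2 by blast
    qed
    have "(\<lambda>s. (norm (g n s i - g m s i))\<^sup>2) integrable_on {0..T}
      \<and> integral {0..T} (\<lambda>s. (norm (g n s i - g m s i))\<^sup>2) < e" if "N \<le> n" "N \<le> m" for n m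
      using *[of n m] *[of m n] that by (cases "n \<le> m") (auto simp: norm_minus_commute)
    then show ?thesis by blast
  qed
  have L1: "\<exists>N. \<forall>n\<ge>N. \<forall>m\<ge>N. (LINT s|lebesgue_on {0..T}. norm (g n s i - g m s i)) < e"
    if "i \<in> I" "e > 0" for i e
  proof -
    define c where "c = e / (T + 1)"
    have c: "c > 0" "c * T < e" using T \<open>e > 0\<close> by (auto simp: c_def field_simps)
    obtain N where N: "\<And>n m. n \<ge> N \<Longrightarrow> m \<ge> N \<Longrightarrow> (\<lambda>s. (norm (g n s i - g m s i))\<^sup>2) integrable_on {0..T}
      \<and> integral {0..T} (\<lambda>s. (norm (g n s i - g m s i))\<^sup>2) < c * e"
      using L2[OF \<open>i \<in> I\<close> mult_pos_pos[OF c(1) \<open>e > 0\<close>]] by blast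
    have "(LINT s|lebesgue_on {0..T}. norm (g n s i - g m s i)) < e" if "n \<ge> N" "m \<ge> N" for n m
    proof -
      have ai: "(\<lambda>s. g n s i - g m s i) absolutely_integrable_on {0..T}"
        using Aint gA \<open>i \<in> I\<close> by (intro set_integral_diff) auto
      have "(LINT s|lebesgue_on {0..T}. norm (g n s i - g m s i)) = integral {0..T} (\<lambda>s. norm (g n s i - g m s i))"
        by (intro lebesgue_integral_eq_integral absolutely_integrable_imp_integrable set_integrable_norm ai) auto
      also have "\<dots> \<le> (c * T + integral {0..T} (\<lambda>s. (norm (g n s i - g m s i))\<^sup>2) / c) / 2"
        using N[OF that] by (intro integral_norm_le_sq ai T c) auto
      also have "\<dots> < e"
      proof -
        have "integral {0..T} (\<lambda>s. (norm (g n s i - g m s i))\<^sup>2) / c < e"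
          using N[OF that] c by (simp add: pos_divide_less_eq mult.commute)
        then show ?thesis using c by simp
      qed
      finally show ?thesis .
    qed
    then show ?thesis by blast
  qed
  have gint: "integrable (lebesgue_on {0..T}) (\<lambda>s. g n s i)" if "i \<in> I" for n i
    using Aint[OF gA that] by (intro absolutely_integrable_imp_integrable) auto
  have "\<exists>r. strict_mono r \<and> (\<forall>i\<in>I. AE s in lebesgue_on {0..T}. Cauchy (\<lambda>n. g (r n) s i))"
  proof (rule finite_common_subseq[OF I])
    fix i and r :: "nat \<Rightarrow> nat" assume i: "i \<in> I" and r: "strict_mono r"
    have "\<exists>N. \<forall>n\<ge>N. \<forall>m\<ge>N. (LINT s|lebesgue_on {0..T}. norm (g (r n) s i - g (r m) s i)) < e" if "e > 0" for e
    proof -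
      obtain N where "\<forall>n\<ge>N. \<forall>m\<ge>N. (LINT s|lebesgue_on {0..T}. norm (g n s i - g m s i)) < e"
        using L1[OF i \<open>e > 0\<close>] by blast
      then have "\<forall>n\<ge>N. \<forall>m\<ge>N. (LINT s|lebesgue_on {0..T}. norm (g (r n) s i - g (r m) s i)) < e"
        using order.trans[OF _ seq_suble[OF r]] by blast
      then show ?thesis by blast
    qed
    then obtain q where "strict_mono q" "AE s in lebesgue_on {0..T}. Cauchy (\<lambda>n. g (r (q n)) s i)"
      using cauchy_L1_AE_cauchy_subseq[of "lebesgue_on {0..T}" "\<lambda>n s. g (r n) s i"] gint[OF i] by blast
    then show "\<exists>q. strict_mono q \<and> (AE s in lebesgue_on {0..T}. Cauchy (\<lambda>n. g ((r \<circ> q) n) s i))" by auto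
  next
    fix i and r q :: "nat \<Rightarrow> nat"
    assume q: "strict_mono q" and "AE s in lebesgue_on {0..T}. Cauchy (\<lambda>n. g (r n) s i)"
    from this(2) show "AE s in lebesgue_on {0..T}. Cauchy (\<lambda>n. g ((r \<circ> q) n) s i)"
    proof (rule eventually_mono)
      fix s assume "Cauchy (\<lambda>n. g (r n) s i)"
      from Cauchy_subseq_Cauchy[OF this q] show "Cauchy (\<lambda>n. g ((r \<circ> q) n) s i)" by (simp add: o_def)
    qed
  qed
  then obtain r where r: "strict_mono r"
    and rC: "\<And>i. i \<in> I \<Longrightarrow> AE s in lebesgue_on {0..T}. Cauchy (\<lambda>n. g (r n) s i)" by blast
  define good where "good = (\<lambda>s. \<forall>i\<in>I. Cauchy (\<lambda>n. g (r n) s i))"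
  \<comment> \<open>On the null set without convergence any admissible value will do.\<close>
  define \<zeta> where "\<zeta> = (\<lambda>s. if good s then (\<lambda>i. lim (\<lambda>n. g (r n) s i)) else g 0 s)"
  have goodm: "{s \<in> space (lebesgue_on {0..T}). good s} \<in> sets (lebesgue_on {0..T})"
    unfolding good_def using I by (intro sets.sets_Collect_finite_All sets_Collect_Cauchy Am gA) auto
  have \<zeta>lim: "(\<lambda>n. g (r n) s i) \<longlonglongrightarrow> \<zeta> s i" if "good s" "i \<in> I" for s i
    using that convergent_LIMSEQ_iff Cauchy_convergent by (force simp: good_def \<zeta>_def)
  have \<zeta>A: "\<zeta> \<in> A"
  proof -
    have "\<zeta> s \<in> C" if "s \<in> {0..T}" for s
    proof (cases "good s")
      case True
      show ?thesis using closed[of "\<lambda>n. g (r n) s" "\<zeta> s"] AC[OF gA that] \<zeta>lim[OF True] by blast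
    next
      case False
      then show ?thesis using AC[OF gA that] by (simp add: \<zeta>_def)
    qed
    moreover have "(\<lambda>s. \<zeta> s i) \<in> borel_measurable (lebesgue_on {0..T})" if "i \<in> I" for i
    proof -
      have "(\<lambda>s. if good s then lim (\<lambda>n. g (r n) s i) else g 0 s i) \<in> borel_measurable (lebesgue_on {0..T})"
        by (intro measurable_If goodm borel_measurable_lim_metric Am gA that)
      then show ?thesis by (simp add: \<zeta>_def if_distrib[of "\<lambda>f. f i"] cong: if_cong)
    qed
    ultimately show ?thesis unfolding A_def by blast
  qed
  have "integral {0..t} (\<lambda>s. \<zeta> s i) = G i t" if i: "i \<in> I" and t: "t \<in> {0..T}" for i t
  proof -
    have sub: "f absolutely_integrable_on {0..t}" if "f absolutely_integrable_on {0..T}" for f :: "real \<Rightarrow> 'a"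
      using that t by (intro absolutely_integrable_on_subinterval[OF that]) auto
    have eq: "integral {0..t} (\<lambda>s. f s i) = (LINT s|lebesgue. indicator {0..t} s *\<^sub>R f s i)" if "f \<in> A" for f
      using set_lebesgue_integral_eq_integral(2)[OF sub[OF Aint[OF that i]]] by (simp add: set_lebesgue_integral_def)
    have "(\<lambda>n. LINT s|lebesgue. indicator {0..t} s *\<^sub>R g (r n) s i) \<longlonglongrightarrow> (LINT s|lebesgue. indicator {0..t} s *\<^sub>R \<zeta> s i)"
    proof (rule integral_dominated_convergence[where w="\<lambda>s. indicator {0..t} s *\<^sub>R B"])
      show "(\<lambda>s. indicator {0..t} s *\<^sub>R \<zeta> s i) \<in> borel_measurable lebesgue"
        using sub[OF Aint[OF \<zeta>A i]] by (simp add: set_integrable_def)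
      show "(\<lambda>s. indicator {0..t} s *\<^sub>R g (r n) s i) \<in> borel_measurable lebesgue" for n
        using sub[OF Aint[OF gA i]] by (simp add: set_integrable_def)
      show "integrable lebesgue (\<lambda>s. indicator {0..t} s *\<^sub>R B)"
        using absolutely_integrable_continuous_real[of 0 t "\<lambda>_. B"] by (simp add: set_integrable_def)
      show "AE s in lebesgue. norm (indicator {0..t} s *\<^sub>R g (r n) s i) \<le> indicator {0..t} s *\<^sub>R B" for n
        using Ab[OF gA i] t by (intro AE_I2) (auto simp: indicator_def)
      have "AE s in lebesgue_on {0..T}. good s"
        unfolding good_def using rC I by (subst AE_finite_all) auto
      then have "AE s in lebesgue. s \<in> {0..T} \<longrightarrow> good s"
        by (subst (asm) AE_restrict_space_iff) auto
      then show "AE s in lebesgue. (\<lambda>n. indicator {0..t} s *\<^sub>R g (r n) s i) \<longlonglongrightarrow> indicator {0..t} s *\<^sub>R \<zeta> s i"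
      proof (rule eventually_mono)
        fix s assume "s \<in> {0..T} \<longrightarrow> good s"
        then show "(\<lambda>n. indicator {0..t} s *\<^sub>R g (r n) s i) \<longlonglongrightarrow> indicator {0..t} s *\<^sub>R \<zeta> s i"
          using \<zeta>lim[of s i] i t by (cases "s \<in> {0..t}") auto
      qed
    qed
    then have 1: "(\<lambda>n. integral {0..t} (\<lambda>s. g (r n) s i)) \<longlonglongrightarrow> integral {0..t} (\<lambda>s. \<zeta> s i)"
      by (simp add: eq[OF gA] eq[OF \<zeta>A])
    have l0: "(\<lambda>n. 1 / real (Suc (r n))) \<longlonglongrightarrow> 0"
      using LIMSEQ_subseq_LIMSEQ[OF LIMSEQ_inverse_real_of_nat r] by (simp add: o_def inverse_eq_divide)
    have nb: "norm (integral {0..t} (\<lambda>s. g (r n) s i) - G i t) \<le> 1 / real (Suc (r n))" for n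
      using gS[of "r n"] i t unfolding S_def by blast
    have "(\<lambda>n. integral {0..t} (\<lambda>s. g (r n) s i) - G i t) \<longlonglongrightarrow> 0"
      by (rule Lim_null_comparison[OF always_eventually[OF allI[OF nb]] l0])
    then have "(\<lambda>n. integral {0..t} (\<lambda>s. g (r n) s i)) \<longlonglongrightarrow> G i t" by (simp add: LIM_zero_iff)
    with 1 show ?thesis by (rule LIMSEQ_unique)
  qed
  with \<zeta>A show ?thesis by blast
qed
text \<open>
  The primitives are uniformly Lipschitz, hence converge uniformly along a subsequence, and the limits
  are primitives of an admissible family by \<open>mazur_representation\<close>. Convergence of the
  primitives, uniformly in \<open>t\<close>, is the form of weak convergence that is used below.
\<close>

lemma weak_sequential_compactness:
  fixes z :: "nat \<Rightarrow> real \<Rightarrow> 'i \<Rightarrow> 'a::euclidean_space" and C :: "('i \<Rightarrow> 'a) set"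
  assumes I: "finite I" and T: "0 \<le> T"
    and mid: "\<And>a b. a \<in> C \<Longrightarrow> b \<in> C \<Longrightarrow> (\<lambda>i. (1/2) *\<^sub>R a i + (1/2) *\<^sub>R b i) \<in> C"
    and closed: "\<And>a l. (\<And>n::nat. a n \<in> C) \<Longrightarrow> (\<And>i. i \<in> I \<Longrightarrow> (\<lambda>n. a n i) \<longlonglongrightarrow> l i) \<Longrightarrow> l \<in> C"
    and bound: "\<And>a i. a \<in> C \<Longrightarrow> i \<in> I \<Longrightarrow> norm (a i) \<le> B"
    and zC: "\<And>n s. s \<in> {0..T} \<Longrightarrow> z n s \<in> C"
    and zm: "\<And>n i. i \<in> I \<Longrightarrow> (\<lambda>s. z n s i) \<in> borel_measurable (lebesgue_on {0..T})"
  shows "\<exists>r \<zeta>. strict_mono (r :: nat \<Rightarrow> nat) \<and> (\<forall>s\<in>{0..T}. \<zeta> s \<in> C) \<and>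
     (\<forall>i\<in>I. (\<lambda>s. \<zeta> s i) \<in> borel_measurable (lebesgue_on {0..T})) \<and>
     (\<forall>i\<in>I. \<forall>e>0. \<exists>N. \<forall>n\<ge>N. \<forall>t\<in>{0..T}. norm (integral {0..t} (\<lambda>s. z (r n) s i - \<zeta> s i)) < e)"
proof -
  have zb: "norm (z n s i) \<le> B" if "s \<in> {0..T}" "i \<in> I" for n s i
    using bound zC that by blast
  have zint: "(\<lambda>s. z n s i) absolutely_integrable_on {0..T}" if "i \<in> I" for n i
    using zm zb that by (intro bounded_measurable_absolutely_integrable[where B=B]) auto
  define F where "F = (\<lambda>i n t. integral {0..t} (\<lambda>s. z n s i))"
  define Q where "Q = (\<lambda>i r. \<exists>G. \<forall>e>0. \<exists>N::nat. \<forall>n\<ge>N. \<forall>t\<in>{0..T}. norm (F i (r n) t - G t) < e)"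
  have lip: "norm (F i n x - F i n y) \<le> B * \<bar>x - y\<bar>" if "i \<in> I" "x \<in> {0..T}" "y \<in> {0..T}" for i n x y
  proof -
    have *: "norm (F i n y - F i n x) \<le> B * (y - x)" if "x \<in> {0..T}" "y \<in> {0..T}" "x \<le> y" for x y
    proof -
      have "F i n y - F i n x = integral {x..y} (\<lambda>s. z n s i)"
        using Henstock_Kurzweil_Integration.integral_combine[of 0 x y "\<lambda>s. z n s i"]
          integrable_on_initial[OF zint[OF \<open>i \<in> I\<close>] that(2)] that by (simp add: F_def algebra_simps)
      moreover have "(\<lambda>s. z n s i) integrable_on {x..y}"
        using that by (intro integrable_subinterval_real[OF set_lebesgue_integral_eq_integral(1)[OF zint[OF \<open>i \<in> I\<close>]]]) auto
      ultimately show ?thesis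
        using norm_integral_le_const[of "\<lambda>s. z n s i" x y B] zb[OF _ \<open>i \<in> I\<close>] that by auto
    qed
    show ?thesis
      using *[OF that(2,3)] *[OF that(3,2)] by (cases "x \<le> y") (auto simp: norm_minus_commute)
  qed
  have "\<exists>r. strict_mono r \<and> (\<forall>i\<in>I. Q i r)"
  proof (rule finite_common_subseq[OF I])
    fix i and r :: "nat \<Rightarrow> nat" assume i: "i \<in> I" and r: "strict_mono r"
    have B: "0 \<le> B" using order.trans[OF norm_ge_zero zb[of 0 i 0]] i T by auto
    have bd: "norm (F i (r n) x) \<le> B * T" if "x \<in> {0..T}" for n x
        using lip[OF i that, of 0 "r n"] that T B mult_left_mono[of x T B] by (auto simp: F_def)
    have eq: "\<exists>d>0. \<forall>n y. y \<in> {0..T} \<and> norm (x - y) < d \<longrightarrow> norm (F i (r n) x - F i (r n) y) < e"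
        if "x \<in> {0..T}" "0 < e" for x e
      proof (intro exI[of _ "e / (B + 1)"] conjI allI impI)
        show "0 < e / (B + 1)" using that B by auto
        fix n y assume y: "y \<in> {0..T} \<and> norm (x - y) < e / (B + 1)"
        have "norm (F i (r n) x - F i (r n) y) \<le> B * \<bar>x - y\<bar>" using lip[OF i that(1)] y by blast
        also have "\<dots> \<le> (B + 1) * \<bar>x - y\<bar>" by (simp add: mult_right_mono)
        also have "\<dots> < e" using y B by (simp add: pos_less_divide_eq mult.commute)
        finally show "norm (F i (r n) x - F i (r n) y) < e" .
      qed
    obtain g k where k: "strict_mono (k::nat\<Rightarrow>nat)"
      and gk: "\<And>e. e > 0 \<Longrightarrow> \<exists>N. \<forall>n x. n \<ge> N \<and> x \<in> {0..T} \<longrightarrow> norm (F i (r (k n)) x - g x) < e"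
      using Arzela_Ascoli[OF compact_Icc bd eq] by metis
    have "Q i (r \<circ> k)" unfolding Q_def o_def using gk by blast
    with k show "\<exists>q. strict_mono q \<and> Q i (r \<circ> q)" by blast
  next
    fix i and r q :: "nat \<Rightarrow> nat"
    assume q: "strict_mono q" and "Q i r"
    then obtain G where "\<forall>e>0. \<exists>N. \<forall>n\<ge>N. \<forall>t\<in>{0..T}. norm (F i (r n) t - G t) < e" by (auto simp: Q_def)
    then have "\<forall>e>0. \<exists>N. \<forall>n\<ge>N. \<forall>t\<in>{0..T}. norm (F i ((r \<circ> q) n) t - G t) < e"
      unfolding o_def using order.trans[OF _ seq_suble[OF q]] by meson
    then show "Q i (r \<circ> q)" unfolding Q_def by blast
  qed
  then obtain r where r: "strict_mono r" and "\<forall>i\<in>I. Q i r" by blast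
  then obtain G where G: "\<And>i e. i \<in> I \<Longrightarrow> e > 0 \<Longrightarrow> \<exists>N. \<forall>n\<ge>N. \<forall>t\<in>{0..T}. norm (F i (r n) t - G i t) < e"
    unfolding Q_def by metis
  define A where "A = {g. (\<forall>s\<in>{0..T}. g s \<in> C) \<and> (\<forall>i\<in>I. (\<lambda>s. g s i) \<in> borel_measurable (lebesgue_on {0..T}))}"
  have "\<exists>\<zeta>\<in>A. \<forall>i\<in>I. \<forall>t\<in>{0..T}. integral {0..t} (\<lambda>s. \<zeta> s i) = G i t"
  proof (rule mazur_representation[where C=C and G=G and B=B, OF A_def I T])
    show "(\<lambda>i. (1/2) *\<^sub>R a i + (1/2) *\<^sub>R b i) \<in> C" if "a \<in> C" "b \<in> C" for a b by (rule mid[OF that])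
    show "l \<in> C" if "\<And>n::nat. a n \<in> C" "\<And>i. i \<in> I \<Longrightarrow> (\<lambda>n. a n i) \<longlonglongrightarrow> l i" for a l using that by (rule closed)
    show "norm (a i) \<le> B" if "a \<in> C" "i \<in> I" for a i by (rule bound[OF that])
  next
    fix k :: nat
    obtain N where N: "\<And>i. i \<in> I \<Longrightarrow> \<forall>n\<ge>N i. \<forall>t\<in>{0..T}. norm (F i (r n) t - G i t) < 1 / real (Suc k)"
      using G[of _ "1 / real (Suc k)"] by (metis of_nat_0_less_iff zero_less_Suc zero_less_divide_1_iff)
    define n where "n = (\<Sum>i\<in>I. N i)"
    have "N i \<le> n" if "i \<in> I" for i using I that by (auto simp: n_def intro: member_le_sum)
    then have "\<forall>i\<in>I. \<forall>t\<in>{0..T}. norm (F i (r n) t - G i t) \<le> 1 / real (Suc k)" using N less_imp_le by blast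
    moreover have "z (r n) \<in> A" using zC zm by (auto simp: A_def)
    ultimately show "\<exists>g\<in>A. \<forall>i\<in>I. \<forall>t\<in>{0..T}. norm (integral {0..t} (\<lambda>s. g s i) - G i t) \<le> 1 / real (Suc k)"
      unfolding F_def by blast
  qed
  then obtain \<zeta> where \<zeta>: "\<zeta> \<in> A" and \<zeta>G: "\<And>i t. i \<in> I \<Longrightarrow> t \<in> {0..T} \<Longrightarrow> integral {0..t} (\<lambda>s. \<zeta> s i) = G i t"
    by blast
  have \<zeta>int: "(\<lambda>s. \<zeta> s i) absolutely_integrable_on {0..T}" if "i \<in> I" for i
    using \<zeta> bound that unfolding A_def by (intro bounded_measurable_absolutely_integrable[where B=B]) auto
  have "integral {0..t} (\<lambda>s. z (r n) s i - \<zeta> s i) = F i (r n) t - G i t" if "i \<in> I" "t \<in> {0..T}" for i n t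
    using integral_diff[OF integrable_on_initial[OF zint[OF that(1)] that(2)] integrable_on_initial[OF \<zeta>int[OF that(1)] that(2)]]
      \<zeta>G[OF that] by (simp add: F_def)
  then have "\<forall>i\<in>I. \<forall>e>0. \<exists>N. \<forall>n\<ge>N. \<forall>t\<in>{0..T}. norm (integral {0..t} (\<lambda>s. z (r n) s i - \<zeta> s i)) < e"
    using G by simp
  with r \<zeta> show ?thesis unfolding A_def by blast
qed

lemma continuous_blinfun_apply_absolutely_integrable:
  fixes c :: "real \<Rightarrow> 'a::euclidean_space \<Rightarrow>\<^sub>L 'b::euclidean_space"
  assumes c: "continuous_on {a..b} c" and f: "f \<in> borel_measurable (lebesgue_on {a..b})"
    and fB: "\<And>s. s \<in> {a..b} \<Longrightarrow> norm (f s) \<le> B"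
  shows "(\<lambda>s. c s (f s)) absolutely_integrable_on {a..b}"
proof -
  have "bounded (c ` {a..b})" using c by (intro compact_imp_bounded compact_continuous_image) auto
  then obtain K where K: "K > 0" "\<And>s. s \<in> {a..b} \<Longrightarrow> norm (c s) \<le> K" unfolding bounded_pos by blast
  show ?thesis
  proof (rule bounded_measurable_absolutely_integrable)
    have "(\<lambda>s. c s e) \<in> borel_measurable (lebesgue_on {a..b})" for e
      by (intro continuous_imp_measurable_on_sets_lebesgue continuous_intros c) auto
    then have "(\<lambda>s. \<Sum>e\<in>Basis. (f s \<bullet> e) *\<^sub>R c s e) \<in> borel_measurable (lebesgue_on {a..b})"
      by (intro borel_measurable_sum borel_measurable_scaleR borel_measurable_inner f borel_measurable_const)
    moreover have "c s (f s) = (\<Sum>e\<in>Basis. (f s \<bullet> e) *\<^sub>R c s e)" for s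
      using arg_cong[OF euclidean_representation[of "f s"], of "c s"] by (simp add: blinfun.sum_right blinfun.scaleR_right)
    ultimately show "(\<lambda>s. c s (f s)) \<in> borel_measurable (lebesgue_on {a..b})" by simp
    show "norm (c s (f s)) \<le> K * B" if "s \<in> {a..b}" for s
      using K(2)[OF that] fB[OF that] K(1) by (intro order.trans[OF norm_blinfun] mult_mono) auto
  qed
qed

text \<open>
  If the primitive of \<open>f\<close> is small, so are its integrals against a continuous coefficient:
  the coefficient is nearly constant on each of \<open>N\<close> short intervals, where its value can be
  pulled out of the integral. The threshold \<open>d\<close> depends on \<open>f\<close> only through its
  bound.
\<close>

lemma weak_null_against_continuous:
  fixes c :: "real \<Rightarrow> 'a::euclidean_space \<Rightarrow>\<^sub>L 'b::euclidean_space"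
  assumes T: "0 < T" and c: "continuous_on {0..T} c" and e: "0 < e" and B: "0 \<le> B"
  shows "\<exists>d>0. \<forall>f :: real \<Rightarrow> 'a. f \<in> borel_measurable (lebesgue_on {0..T}) \<longrightarrow> (\<forall>s\<in>{0..T}. norm (f s) \<le> B) \<longrightarrow>
      (\<forall>t\<in>{0..T}. norm (integral {0..t} f) < d) \<longrightarrow>
      (\<forall>t\<in>{0..T}. norm (integral {0..t} (\<lambda>s. c s (f s))) < e)"
proof -
  define y where "y = B * T + 1"
  have "y > 0" unfolding y_def using B T by (auto intro: add_nonneg_pos)
  define e' where "e' = e / (2 * y)"
  have e': "e' > 0" "e' * y = e / 2"
    using e \<open>y > 0\<close> by (auto simp: e'_def)
  then have e'T: "e' * B * T < e / 2" unfolding y_def by (simp add: algebra_simps)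
  have "uniformly_continuous_on {0..T} c" using c by (intro compact_uniformly_continuous) auto
  then obtain \<delta> where \<delta>: "\<delta> > 0" "\<And>s t. s \<in> {0..T} \<Longrightarrow> t \<in> {0..T} \<Longrightarrow> dist s t < \<delta> \<Longrightarrow> dist (c s) (c t) < e'"
    using e' unfolding uniformly_continuous_on_def by metis
  obtain N :: nat where "T / \<delta> < N" using reals_Archimedean2 by blast
  moreover have "0 < T / \<delta>" using T \<delta> by simp
  ultimately have "0 < real N" by (rule less_trans[rotated])
  with \<open>T / \<delta> < N\<close> \<delta>(1) have N: "N > 0" "T / N < \<delta>"
    by (simp_all add: pos_divide_less_eq mult.commute)
  have "bounded (c ` {0..T})" using c by (intro compact_imp_bounded compact_continuous_image) auto
  then obtain K where K: "K > 0" "\<And>s. s \<in> {0..T} \<Longrightarrow> norm (c s) \<le> K" unfolding bounded_pos by blast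
  define d where "d = e / (4 * N * K)"
  have d: "d > 0" "2 * real N * K * d = e / 2" using e N K by (auto simp: d_def)
  show ?thesis
  proof (intro exI[of _ d] conjI allI impI)
    fix f :: "real \<Rightarrow> 'a" assume fm: "f \<in> borel_measurable (lebesgue_on {0..T})" and fB: "\<forall>s\<in>{0..T}. norm (f s) \<le> B"
      and fd: "\<forall>t\<in>{0..T}. norm (integral {0..t} f) < d"
    have fa: "f absolutely_integrable_on {0..T}"
      using fm fB by (intro bounded_measurable_absolutely_integrable[where B=B]) auto
    have cfa: "(\<lambda>s. c s (f s)) absolutely_integrable_on {0..T}"
      using continuous_blinfun_apply_absolutely_integrable[OF c fm] fB by blast
    note fi = set_lebesgue_integral_eq_integral(1)[OF fa] and cfi = set_lebesgue_integral_eq_integral(1)[OF cfa]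
    define \<tau> where "\<tau> = (\<lambda>k::nat. real k * (T / N))"
    have piece: "\<forall>t\<in>{0..T}. t \<le> \<tau> k \<longrightarrow> norm (integral {0..t} (\<lambda>s. c s (f s))) \<le> e' * B * t + 2 * real k * K * d" for k
    proof (induction k)
      case 0
      then show ?case by (auto simp: \<tau>_def)
    next
      case (Suc k)
      have *: "norm (integral {0..t} (\<lambda>s. c s (f s))) \<le> e' * B * t + 2 * real (Suc k) * K * d"
        if t: "t \<in> {0..T}" "t \<le> \<tau> (Suc k)" "\<tau> k < t" for t
      proof -
        have \<tau>: "\<tau> k \<in> {0..T}" using t T by (auto simp: \<tau>_def)
        have sub: "g integrable_on {\<tau> k..t}" if "g integrable_on {0..T}" for g :: "real \<Rightarrow> 'b"
          using \<tau> t by (intro integrable_subinterval_real[OF that]) auto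
        have fsub: "f integrable_on {\<tau> k..t}"
          using \<tau> t by (intro integrable_subinterval_real[OF fi]) auto
        have cfk: "(\<lambda>s. c (\<tau> k) (f s)) integrable_on {\<tau> k..t}"
          "integral {\<tau> k..t} (\<lambda>s. c (\<tau> k) (f s)) = c (\<tau> k) (integral {\<tau> k..t} f)"
          using integrable_linear[OF fsub blinfun.bounded_linear_right] integral_linear[OF fsub blinfun.bounded_linear_right]
          by (auto simp: o_def)
        have split: "integral {0..t} (\<lambda>s. c s (f s)) = integral {0..\<tau> k} (\<lambda>s. c s (f s))
            + (integral {\<tau> k..t} (\<lambda>s. (c s - c (\<tau> k)) (f s)) + c (\<tau> k) (integral {\<tau> k..t} f))"
        proof -
          have "integral {0..t} (\<lambda>s. c s (f s)) = integral {0..\<tau> k} (\<lambda>s. c s (f s)) + integral {\<tau> k..t} (\<lambda>s. c s (f s))"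
            using Henstock_Kurzweil_Integration.integral_combine[of 0 "\<tau> k" t "\<lambda>s. c s (f s)"]
              integrable_on_initial[OF cfa t(1)] \<tau> t by simp
          moreover have "integral {\<tau> k..t} (\<lambda>s. (c s - c (\<tau> k)) (f s)) = integral {\<tau> k..t} (\<lambda>s. c s (f s)) - c (\<tau> k) (integral {\<tau> k..t} f)"
            using integral_diff[OF sub[OF cfi] cfk(1)] by (simp add: blinfun.diff_left cfk(2))
          ultimately show ?thesis by simp
        qed
        have "norm (integral {0..\<tau> k} (\<lambda>s. c s (f s))) \<le> e' * B * \<tau> k + 2 * real k * K * d"
          using Suc \<tau> by blast
        moreover have "norm (integral {\<tau> k..t} (\<lambda>s. (c s - c (\<tau> k)) (f s))) \<le> e' * B * (t - \<tau> k)"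
        proof (rule norm_integral_le_const)
          show "(\<lambda>s. (c s - c (\<tau> k)) (f s)) integrable_on {\<tau> k..t}"
            using integrable_diff[OF sub[OF cfi] cfk(1)] by (simp add: blinfun.diff_left)
          show "\<tau> k \<le> t" using t by simp
          fix s assume s: "s \<in> {\<tau> k..t}"
          have "\<tau> (Suc k) - \<tau> k = T / N" by (simp add: \<tau>_def algebra_simps flip: add_divide_distrib)
          then have "dist s (\<tau> k) < \<delta>" using s t N by (auto simp: dist_real_def)
          then have "norm (c s - c (\<tau> k)) \<le> e'" using \<delta>(2)[of s "\<tau> k"] s \<tau> t by (auto simp: dist_norm)
          moreover have "norm (f s) \<le> B" using fB s \<tau> t by auto
          ultimately show "norm ((c s - c (\<tau> k)) (f s)) \<le> e' * B"
            using e' by (intro order.trans[OF norm_blinfun] mult_mono) auto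
        qed
        moreover have "norm (c (\<tau> k) (integral {\<tau> k..t} f)) \<le> K * (2 * d)"
        proof -
          have "integral {\<tau> k..t} f = integral {0..t} f - integral {0..\<tau> k} f"
            using Henstock_Kurzweil_Integration.integral_combine[of 0 "\<tau> k" t f]
              integrable_on_initial[OF fa t(1)] \<tau> t by (simp add: algebra_simps)
          then have "norm (integral {\<tau> k..t} f) \<le> norm (integral {0..t} f) + norm (integral {0..\<tau> k} f)"
            by (simp add: norm_triangle_ineq4)
          also have "\<dots> \<le> 2 * d" using bspec[OF fd t(1)] bspec[OF fd \<tau>] by simp
          finally show ?thesis using K \<tau> by (intro order.trans[OF norm_blinfun] mult_mono) auto
        qed
        ultimately have "norm (integral {0..t} (\<lambda>s. c s (f s)))
            \<le> (e' * B * \<tau> k + 2 * real k * K * d) + (e' * B * (t - \<tau> k) + K * (2 * d))"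
          unfolding split by (intro norm_triangle_mono) auto
        also have "\<dots> = e' * B * t + 2 * real (Suc k) * K * d" by (simp add: algebra_simps)
        finally show ?thesis .
      qed
      have "2 * real k * K * d \<le> 2 * real (Suc k) * K * d" using K d by (intro mult_right_mono) auto
      then have "norm (integral {0..t} (\<lambda>s. c s (f s))) \<le> e' * B * t + 2 * real (Suc k) * K * d"
        if "t \<in> {0..T}" "t \<le> \<tau> k" for t
        using Suc that by (blast intro: order.trans add_left_mono)
      with * show ?case by (meson not_le)
    qed
    show "\<forall>t\<in>{0..T}. norm (integral {0..t} (\<lambda>s. c s (f s))) < e"
    proof
      fix t assume t: "t \<in> {0..T}"
      then have "norm (integral {0..t} (\<lambda>s. c s (f s))) \<le> e' * B * t + 2 * real N * K * d"
        using piece[of N] N by (auto simp: \<tau>_def)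
      also have "e' * B * t \<le> e' * B * T" using t e' B by (intro mult_left_mono) auto
      finally show "norm (integral {0..t} (\<lambda>s. c s (f s))) < e" using e'T d by simp
    qed
  qed (use d in simp)
qed
section \<open>Fields that are continuously differentiable in the state\<close>

text \<open>
  Joint continuity of the state derivative in \<open>(x, u)\<close> is what makes bounds, Lipschitz
  constants and linearization errors uniform over compact sets of control values.
\<close>

definition C1_in_state ::
  "'u::metric_space set \<Rightarrow> ('a::euclidean_space \<Rightarrow> 'u \<Rightarrow> 'c::euclidean_space) \<Rightarrow> ('a \<Rightarrow> 'u \<Rightarrow> 'a \<Rightarrow>\<^sub>L 'c) \<Rightarrow> bool" where
  "C1_in_state U g D \<longleftrightarrow> continuous_on (UNIV \<times> U) (\<lambda>(x, u). g x u) \<and> continuous_on (UNIV \<times> U) (\<lambda>(x, u). D x u) \<and>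
     (\<forall>x. \<forall>u\<in>U. ((\<lambda>y. g y u) has_derivative D x u) (at x))"

lemma C1_in_state_bounded:
  fixes g :: "'a::euclidean_space \<Rightarrow> 'u::metric_space \<Rightarrow> 'c::euclidean_space"
  assumes "C1_in_state U g D" and "compact U"
  shows "\<exists>B>0. \<forall>x\<in>cball 0 R. \<forall>u\<in>U. norm (g x u) \<le> B \<and> norm (D x u) \<le> B"
proof -
  have sub: "cball (0::'a) R \<times> U \<subseteq> UNIV \<times> U" by auto
  have "compact (cball (0::'a) R \<times> U)" using assms by (intro compact_Times) auto
  then have "bounded ((\<lambda>(x, u). g x u) ` (cball 0 R \<times> U))" "bounded ((\<lambda>(x, u). D x u) ` (cball 0 R \<times> U))"
    using assms by (auto simp: C1_in_state_def intro!: compact_imp_bounded compact_continuous_image intro: continuous_on_subset[OF _ sub])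
  then obtain b1 b2 where "\<forall>z\<in>(\<lambda>(x, u). g x u) ` (cball 0 R \<times> U). norm z \<le> b1"
    "\<forall>z\<in>(\<lambda>(x, u). D x u) ` (cball 0 R \<times> U). norm z \<le> b2" unfolding bounded_iff by blast
  then have "norm (g x u) \<le> \<bar>b1\<bar> + \<bar>b2\<bar> + 1 \<and> norm (D x u) \<le> \<bar>b1\<bar> + \<bar>b2\<bar> + 1"
    if "x \<in> cball 0 R" "u \<in> U" for x u
    using that by (force simp del: mem_cball)
  then show ?thesis by (intro exI[of _ "\<bar>b1\<bar> + \<bar>b2\<bar> + 1"]) auto
qed

lemma C1_in_state_lipschitz:
  assumes C1: "C1_in_state U g D" and B: "\<forall>x\<in>cball 0 R. norm (D x u) \<le> B" and u: "u \<in> U"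
    and xy: "x \<in> cball 0 R" "y \<in> cball 0 R"
  shows "norm (g y u - g x u) \<le> B * norm (y - x)"
proof (rule differentiable_bound[OF convex_cball _ _ xy(2,1)])
  show "((\<lambda>y. g y u) has_derivative D z u) (at z within cball 0 R)" for z
    using C1 u by (auto simp: C1_in_state_def intro: has_derivative_at_withinI)
  show "onorm (D z u) \<le> B" if "z \<in> cball 0 R" for z using B that by (simp add: norm_blinfun.rep_eq)
qed

lemma C1_in_state_linearization:
  fixes g :: "'a::euclidean_space \<Rightarrow> 'u::metric_space \<Rightarrow> 'c::euclidean_space"
  assumes C1: "C1_in_state U g D" and U: "compact U" and e: "e > 0"
  shows "\<exists>d>0. \<forall>x\<in>cball 0 R. \<forall>y\<in>cball 0 R. \<forall>u\<in>U. norm (y - x) < d \<longrightarrow>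
     norm (g y u - g x u - D x u (y - x)) \<le> e * norm (y - x)"
proof -
  have sub: "cball (0::'a) R \<times> U \<subseteq> UNIV \<times> U" by auto
  have "compact (cball (0::'a) R \<times> U)" using U by (intro compact_Times) auto
  then have "uniformly_continuous_on (cball 0 R \<times> U) (\<lambda>(x, u). D x u)"
    using C1 by (intro compact_uniformly_continuous) (auto simp: C1_in_state_def intro: continuous_on_subset[OF _ sub])
  then obtain d where d: "d > 0" "\<And>z z'. z \<in> cball 0 R \<times> U \<Longrightarrow> z' \<in> cball 0 R \<times> U \<Longrightarrow> dist z' z < d \<Longrightarrow>
      dist (case z' of (x, u) \<Rightarrow> D x u) (case z of (x, u) \<Rightarrow> D x u) < e"
    using e unfolding uniformly_continuous_on_def by blast
  have "norm (g y u - g x u - D x u (y - x)) \<le> e * norm (y - x)"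
    if xy: "x \<in> cball 0 R" "y \<in> cball 0 R" and u: "u \<in> U" and close: "norm (y - x) < d" for x y u
  proof -
    define S where "S = closed_segment x y"
    have "norm (g y u - g x u - D x u (y - x)) \<le> norm (y - x) * e"
    proof (rule differentiable_bound_linearization[where S=S])
      show "x + t *\<^sub>R (y - x) \<in> S" if "t \<in> {0..1}" for t
        using that unfolding S_def closed_segment_def by (auto intro!: exI[of _ t] simp: algebra_simps)
      show "((\<lambda>y. g y u) has_derivative D z u) (at z within S)" for z
        using C1 u by (auto simp: C1_in_state_def intro: has_derivative_at_withinI)
      show "x \<in> S" by (simp add: S_def)
      show "onorm (blinfun_apply (D z u) - blinfun_apply (D x u)) \<le> e" if "z \<in> S" for z
      proof -
        have "z \<in> cball 0 R" using that xy closed_segment_subset[OF xy convex_cball] by (auto simp: S_def)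
        moreover have "dist z x < d"
          using segment_bound(1)[of z x y] that close by (auto simp: S_def dist_norm norm_minus_commute)
        ultimately have "norm (D z u - D x u) < e"
          using d(2)[of "(x, u)" "(z, u)"] xy u by (simp add: dist_Pair_Pair dist_norm)
        then show ?thesis by (simp add: norm_blinfun.rep_eq minus_blinfun.rep_eq fun_diff_def)
      qed
    qed
    then show ?thesis by (simp add: mult.commute)
  qed
  with d(1) show ?thesis by blast
qed

lemma bounded_bilinear_matrix_vector_mult:
  "bounded_bilinear ((*v) :: real ^ 'k ^ 'n \<Rightarrow> real ^ 'k \<Rightarrow> real ^ 'n)"
  unfolding bilinear_conv_bounded_bilinear[symmetric] bilinear_def
  by (auto simp: linear_iff matrix_vector_mult_add_rdistrib matrix_vector_right_distrib
      matrix_vector_mult_scaleR scaleR_matrix_vector_assoc)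

text \<open>
  The definite description in \<open>gradient\<close> is legitimate because an inner product
  representation of the derivative is unique.
\<close>

lemma C1_scalar_gradient:
  assumes "C1_scalar g"
  shows "(g has_derivative (\<lambda>h. gradient g x \<bullet> h)) (at x)"
proof -
  obtain d where d: "GDERIV g x :> d" using assms by (auto simp: C1_scalar_def)
  have "gradient g x = d" unfolding gradient_def
  proof (rule the_equality[where P="\<lambda>d. GDERIV g x :> d", OF d])
    fix d' assume "GDERIV g x :> d'"
    then have "(\<lambda>h. h \<bullet> d') = (\<lambda>h. h \<bullet> d)"
      using d has_derivative_unique unfolding gderiv_def by blast
    from fun_cong[OF this] show "d' = d" using vector_eq_ldot[of d' d] by blast
  qed
  then show ?thesis using d by (simp add: gderiv_def inner_commute)
qed

lemma locally_lipschitz_on_imp_continuous_on: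
  assumes "locally_lipschitz_on S g"
  shows "continuous_on S g"
  unfolding continuous_on_eq_continuous_within
proof
  fix z assume z: "z \<in> S"
  then obtain r C where r: "r > 0" and "C-lipschitz_on (cball z r \<inter> S) g"
    using assms by (auto simp: locally_lipschitz_on_def)
  then have "continuous_on (cball z r \<inter> S) g" by (intro lipschitz_on_continuous_on)
  then have "continuous (at z within cball z r \<inter> S) g"
    using z r by (simp add: continuous_on_eq_continuous_within)
  moreover have "at z within cball z r \<inter> S = at z within S"
    by (rule at_within_nhd[of z "ball z r"]) (use r in auto)
  ultimately show "continuous (at z within S) g" by simp
qed

lemma borel_measurable_fst_snd:
  fixes f :: "'s \<Rightarrow> 'a::second_countable_topology \<times> 'b::second_countable_topology"
  assumes "f \<in> borel_measurable M"
  shows "(\<lambda>s. fst (f s)) \<in> borel_measurable M" "(\<lambda>s. snd (f s)) \<in> borel_measurable M"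
  using measurable_compose[OF assms, of fst borel] measurable_compose[OF assms, of snd borel]
  by (simp_all add: borel_measurable_continuous_onI continuous_on_fst continuous_on_snd)

lemma continuous_image_measurable:
  fixes f :: "'a::euclidean_space \<times> 'u::euclidean_space \<Rightarrow> 'c::euclidean_space"
  assumes f: "continuous_on (UNIV \<times> U) f"
    and x: "x \<in> borel_measurable (lebesgue_on S)" and u: "u \<in> borel_measurable (lebesgue_on S)"
    and S: "S \<in> sets lebesgue" and U: "\<And>s. s \<in> S \<Longrightarrow> u s \<in> U"
  shows "(\<lambda>s. f (x s, u s)) \<in> borel_measurable (lebesgue_on S)"
proof (rule measurable_compose[OF _ borel_measurable_continuous_on_restrict[OF f]])
  show "(\<lambda>s. (x s, u s)) \<in> lebesgue_on S \<rightarrow>\<^sub>M restrict_space borel (UNIV \<times> U)"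
    using U by (intro measurable_restrict_space2 borel_measurable_Pair x u) auto
qed

section \<open>Averages over the modes\<close>

text \<open>
  The average of a mode-dependent quantity with the weights and control values of \<open>w\<close>. The
  velocity, the running cost rate and the right-hand side of the costate equation all have this form.
\<close>

definition mean :: "('n::finite, 'k::finite) switched_problem \<Rightarrow> (nat \<Rightarrow> real ^ 'k \<Rightarrow> 'c::real_vector)
    \<Rightarrow> (nat \<Rightarrow> real \<times> (real ^ 'k)) \<Rightarrow> 'c" where
  "mean P f w = (\<Sum>i=1..modes P. fst (w i) *\<^sub>R f i (snd (w i)))"

lemma mean_diff: "mean P (\<lambda>i u. f i u - g i u) w = mean P f w - mean P g w"
  by (simp add: mean_def scaleR_right_diff_distrib sum_subtractf)

text \<open>
  The weights are nonnegative and add up to 1, so any bound that is uniform over the modes passes to the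
  average with the same constant. Applied to differences, it transfers Lipschitz and linearization
  estimates.
\<close>

lemma mean_norm_le:
  fixes f :: "nat \<Rightarrow> real ^ 'k \<Rightarrow> 'c::real_normed_vector"
  assumes w: "w \<in> embedded_values P"
    and f: "\<And>i u. i \<in> {1..modes P} \<Longrightarrow> u \<in> ctrl_set P i \<Longrightarrow> norm (f i u) \<le> B"
  shows "norm (mean P f w) \<le> B"
proof -
  have "norm (mean P f w) \<le> (\<Sum>i=1..modes P. fst (w i) * B)"
    unfolding mean_def using w f by (intro sum_norm_le) (auto simp: embedded_values_def intro!: mult_left_mono)
  also have "\<dots> = B" using w by (simp add: embedded_values_def flip: sum_distrib_right)
  finally show ?thesis .
qed

lemma embedded_controls_values: "w \<in> embedded_controls P \<Longrightarrow> s \<in> {0..horizon P} \<Longrightarrow> w s \<in> embedded_values P"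
  by (simp add: embedded_controls_def)

lemma mean_measurable:
  fixes P :: "('n::finite, 'k::finite) switched_problem"
    and f :: "nat \<Rightarrow> 'a::euclidean_space \<times> (real ^ 'k) \<Rightarrow> 'c::euclidean_space"
  assumes w: "w \<in> embedded_controls P"
    and x: "continuous_on {0..horizon P} x"
    and f: "\<And>i. i \<in> {1..modes P} \<Longrightarrow> continuous_on (UNIV \<times> ctrl_set P i) (f i)"
  shows "(\<lambda>s. mean P (\<lambda>i u. f i (x s, u)) (w s)) \<in> borel_measurable (lebesgue_on {0..horizon P})"
  unfolding mean_def
proof (intro borel_measurable_sum borel_measurable_scaleR)
  fix i assume i: "i \<in> {1..modes P}"
  then have wi: "(\<lambda>s. w s i) \<in> borel_measurable (lebesgue_on {0..horizon P})"
    using w by (simp add: embedded_controls_def)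
  then show "(\<lambda>s. fst (w s i)) \<in> borel_measurable (lebesgue_on {0..horizon P})"
    by (rule borel_measurable_fst_snd)
  have "(\<lambda>s. snd (w s i)) \<in> borel_measurable (lebesgue_on {0..horizon P})"
    using wi by (rule borel_measurable_fst_snd)
  then show "(\<lambda>s. f i (x s, snd (w s i))) \<in> borel_measurable (lebesgue_on {0..horizon P})"
  proof (intro continuous_image_measurable[OF f[OF i]])
    show "x \<in> borel_measurable (lebesgue_on {0..horizon P})"
      using x by (intro continuous_imp_measurable_on_sets_lebesgue) auto
    show "snd (w s i) \<in> ctrl_set P i" if "s \<in> {0..horizon P}" for s
      using embedded_controls_values[OF w that] i by (simp add: embedded_values_def)
  qed auto
qed

lemma mean_absolutely_integrable:
  fixes P :: "('n::finite, 'k::finite) switched_problem"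
    and f :: "nat \<Rightarrow> 'a::euclidean_space \<times> (real ^ 'k) \<Rightarrow> 'c::euclidean_space"
  assumes w: "w \<in> embedded_controls P"
    and x: "continuous_on {0..horizon P} x"
    and f: "\<And>i. i \<in> {1..modes P} \<Longrightarrow> continuous_on (UNIV \<times> ctrl_set P i) (f i)"
    and U: "\<And>i. i \<in> {1..modes P} \<Longrightarrow> compact (ctrl_set P i)"
  shows "(\<lambda>s. mean P (\<lambda>i u. f i (x s, u)) (w s)) absolutely_integrable_on {0..horizon P}"
proof -
  have "\<exists>B. \<forall>z\<in>x ` {0..horizon P} \<times> ctrl_set P i. norm (f i z) \<le> B" if i: "i \<in> {1..modes P}" for i
  proof -
    have "compact (f i ` (x ` {0..horizon P} \<times> ctrl_set P i))"
      using x U[OF i] by (intro compact_continuous_image compact_Times continuous_on_subset[OF f[OF i]]) auto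
    from compact_imp_bounded[OF this] obtain B where "\<forall>y\<in>f i ` (x ` {0..horizon P} \<times> ctrl_set P i). norm y \<le> B"
      unfolding bounded_iff by (elim exE)
    then show ?thesis by (intro exI[of _ B] ballI) (drule bspec, erule imageI)
  qed
  then have "\<forall>i\<in>{1..modes P}. \<exists>B. \<forall>z\<in>x ` {0..horizon P} \<times> ctrl_set P i. norm (f i z) \<le> B" by blast
  from bchoice[OF this] obtain B where
    B: "\<And>i z. i \<in> {1..modes P} \<Longrightarrow> z \<in> x ` {0..horizon P} \<times> ctrl_set P i \<Longrightarrow> norm (f i z) \<le> B i"
    by blast
  define b where "b = (\<Sum>j=1..modes P. \<bar>B j\<bar>)"
  have Bb: "B i \<le> b" if "i \<in> {1..modes P}" for i
  proof -
    have "\<bar>B i\<bar> \<le> b" unfolding b_def using that by (intro member_le_sum) auto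
    then show ?thesis by simp
  qed
  have "norm (mean P (\<lambda>i u. f i (x s, u)) (w s)) \<le> b" if s: "s \<in> {0..horizon P}" for s
  proof (rule mean_norm_le[OF embedded_controls_values[OF w s]])
    fix i u assume i: "i \<in> {1..modes P}" and u: "u \<in> ctrl_set P i"
    have "(x s, u) \<in> x ` {0..horizon P} \<times> ctrl_set P i" using s u by blast
    from order.trans[OF B[OF i this] Bb[OF i]] show "norm (f i (x s, u)) \<le> b" .
  qed
  then show ?thesis
    by (intro bounded_measurable_absolutely_integrable mean_measurable w x f)
qed
text \<open>
  Stated for the predicates and not for a single trajectory, so that the choices made by
  \<open>state\<close> and \<open>mix_state\<close> coincide, without an appeal to uniqueness.
\<close>

lemma is_trajectory_cong:
  assumes "\<And>y s. s \<in> {0..horizon P} \<Longrightarrow> F y s = F' y s"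
  shows "is_trajectory P F = is_trajectory P F'"
proof
  fix x
  have "set_integrable lebesgue {0..horizon P} (\<lambda>s. F (x s) s) = set_integrable lebesgue {0..horizon P} (\<lambda>s. F' (x s) s)"
    using assms by (intro set_integrable_cong) auto
  moreover have "(LINT s:{0..t}|lebesgue. F (x s) s) = (LINT s:{0..t}|lebesgue. F' (x s) s)" if "t \<in> {0..horizon P}" for t
    using assms that by (intro set_lebesgue_integral_cong) auto
  ultimately show "is_trajectory P F x = is_trajectory P F' x"
    by (simp add: is_trajectory_def)
qed

lemma is_trajectory_integral:
  assumes "is_trajectory P F x"
  shows "(\<lambda>s. F (x s) s) absolutely_integrable_on {0..horizon P}"
    and "\<And>t. t \<in> {0..horizon P} \<Longrightarrow> x t = init P + integral {0..t} (\<lambda>s. F (x s) s)"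
proof -
  show *: "(\<lambda>s. F (x s) s) absolutely_integrable_on {0..horizon P}" using assms by (simp add: is_trajectory_def)
  fix t assume t: "t \<in> {0..horizon P}"
  have "(\<lambda>s. F (x s) s) absolutely_integrable_on {0..t}"
    using t by (intro absolutely_integrable_on_subinterval[OF *]) auto
  from set_lebesgue_integral_eq_integral(2)[OF this]
  show "x t = init P + integral {0..t} (\<lambda>s. F (x s) s)"
    using assms t by (simp add: is_trajectory_def)
qed

lemma measurable_lebesgue_on_finite_exception:
  assumes f: "f \<in> measurable (lebesgue_on (A - S)) N" and S: "finite S" and A: "A \<in> sets lebesgue"
    and fN: "\<And>x. x \<in> A \<Longrightarrow> f x \<in> space N"
  shows "f \<in> measurable (lebesgue_on A) N"
proof (rule measurableI)
  show "f x \<in> space N" if "x \<in> space (lebesgue_on A)" for x using fN that by simp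
  fix B assume "B \<in> sets N"
  have fin: "F \<in> sets lebesgue" if "finite F" for F :: "'a set"
    using that by (intro negligible_imp_sets negligible_finite)
  have "f -` B \<inter> space (lebesgue_on (A - S)) \<in> sets (lebesgue_on (A - S))"
    using f \<open>B \<in> sets N\<close> by (rule measurable_sets)
  then have "f -` B \<inter> (A - S) \<in> sets lebesgue"
    using A fin[OF S] by (subst (asm) sets_restrict_space_iff) auto
  moreover have "f -` B \<inter> A = (f -` B \<inter> (A - S)) \<union> (S \<inter> A \<inter> f -` B)" by auto
  moreover have "S \<inter> A \<inter> f -` B \<in> sets lebesgue" using S by (intro fin) auto
  ultimately have "f -` B \<inter> A \<in> sets lebesgue" by simp
  then show "f -` B \<inter> space (lebesgue_on A) \<in> sets (lebesgue_on A)"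
    using A by (subst sets_restrict_space_iff) auto
qed

lemma C2_map_continuous:
  assumes "C2_map g"
  shows "continuous_on UNIV g"
proof -
  obtain D where "\<And>x. (g has_derivative blinfun_apply (D x)) (at x)"
    using assms unfolding C2_map_def by blast
  then show ?thesis by (rule has_derivative_continuous_on)
qed

text \<open>
  With \<open>a = (1 - l) * fst (w t i)\<close> and \<open>b = l * fst (ws t i)\<close> the new weight is
  \<open>a + b\<close>, and \<open>\<epsilon> = b / (a + b)\<close> makes
  \<open>(a + b) * \<epsilon> = b\<close> and \<open>(a + b) * (1 - \<epsilon>) = a\<close>. This holds also
  when \<open>a + b = 0\<close>, because then \<open>a = b = 0\<close>. All claims follow by convexity.
\<close>

lemma update_component:
  fixes w ws :: "real \<Rightarrow> nat \<Rightarrow> real \<times> (real ^ 'k::finite)"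
  assumes l: "0 \<le> l" "l \<le> 1" and pos: "0 \<le> fst (w t i)" "0 \<le> fst (ws t i)"
    and U: "convex U" "snd (w t i) \<in> U" "snd (ws t i) \<in> U"
  shows "fst (update l w ws t i) = (1 - l) * fst (w t i) + l * fst (ws t i)"
    and "snd (update l w ws t i) \<in> U"
    and "convex_on U f \<Longrightarrow> fst (update l w ws t i) * f (snd (update l w ws t i))
        \<le> (1 - l) * fst (w t i) * f (snd (w t i)) + l * fst (ws t i) * f (snd (ws t i))"
    and "fst (update l w ws t i) *\<^sub>R snd (update l w ws t i)
        = ((1 - l) * fst (w t i)) *\<^sub>R snd (w t i) + (l * fst (ws t i)) *\<^sub>R snd (ws t i)"
proof -
  define a b where "a = (1 - l) * fst (w t i)" and "b = l * fst (ws t i)"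
  have ab: "0 \<le> a" "0 \<le> b" using l pos by (auto simp: a_def b_def)
  define \<epsilon> where "\<epsilon> = b / (a + b)"
  have f: "fst (update l w ws t i) = a + b" and s: "snd (update l w ws t i) = (1 - \<epsilon>) *\<^sub>R snd (w t i) + \<epsilon> *\<^sub>R snd (ws t i)"
    by (simp_all add: update_def Let_def a_def b_def \<epsilon>_def)
  show "fst (update l w ws t i) = (1 - l) * fst (w t i) + l * fst (ws t i)" by (simp add: f a_def b_def)
  have \<epsilon>: "0 \<le> \<epsilon>" "0 \<le> 1 - \<epsilon>" using ab by (auto simp: \<epsilon>_def divide_le_eq_1)
  show "snd (update l w ws t i) \<in> U"
    unfolding s using convexD[OF U(1,2,3) \<epsilon>(2,1)] by simp
  have eq: "(a + b) * \<epsilon> = b" "(a + b) * (1 - \<epsilon>) = a"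
  proof -
    show 1: "(a + b) * \<epsilon> = b" using ab by (cases "a + b = 0") (auto simp: \<epsilon>_def add_nonneg_eq_0_iff)
    show "(a + b) * (1 - \<epsilon>) = a" using 1 by (simp add: right_diff_distrib)
  qed
  show "fst (update l w ws t i) *\<^sub>R snd (update l w ws t i)
        = ((1 - l) * fst (w t i)) *\<^sub>R snd (w t i) + (l * fst (ws t i)) *\<^sub>R snd (ws t i)"
    unfolding f s scaleR_right_distrib scaleR_scaleR eq by (simp add: a_def b_def)
  assume "convex_on U f"
  then have "f ((1 - \<epsilon>) *\<^sub>R snd (w t i) + \<epsilon> *\<^sub>R snd (ws t i)) \<le> (1 - \<epsilon>) * f (snd (w t i)) + \<epsilon> * f (snd (ws t i))"
    using U \<epsilon> unfolding convex_on_def by simp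
  then have "(a + b) * f ((1 - \<epsilon>) *\<^sub>R snd (w t i) + \<epsilon> *\<^sub>R snd (ws t i))
      \<le> (a + b) * ((1 - \<epsilon>) * f (snd (w t i)) + \<epsilon> * f (snd (ws t i)))"
    using ab by (intro mult_left_mono) auto
  also have "\<dots> = ((a + b) * (1 - \<epsilon>)) * f (snd (w t i)) + ((a + b) * \<epsilon>) * f (snd (ws t i))"
    by (simp add: algebra_simps)
  finally show "fst (update l w ws t i) * f (snd (update l w ws t i))
        \<le> (1 - l) * fst (w t i) * f (snd (w t i)) + l * fst (ws t i) * f (snd (ws t i))"
    unfolding f s eq by (simp add: a_def b_def)
qed

section \<open>The switched system and its augmented field\<close>

text \<open>
  Running cost and velocity are treated as one field; the Hamiltonian is then the inner product of this
  field with \<open>(p, 1)\<close>.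
\<close>

definition aug :: "('n::finite, 'k::finite) switched_problem \<Rightarrow> nat \<Rightarrow> real ^ 'n \<Rightarrow> real ^ 'k \<Rightarrow> (real ^ 'n) \<times> real" where
  "aug P i x u = (dyn P i x u, running_cost P i x u)"

definition daug :: "('n::finite, 'k::finite) switched_problem \<Rightarrow> nat \<Rightarrow> real ^ 'n \<Rightarrow> real ^ 'k
    \<Rightarrow> ((real ^ 'n) \<Rightarrow>\<^sub>L ((real ^ 'n) \<times> real))" where
  "daug P i x u = Blinfun (\<lambda>h. (frechet_derivative (\<lambda>y. dyn P i y u) (at x) h,
     gradient (\<lambda>y. running_cost P i y u) x \<bullet> h))"

text \<open>
  Empty control sets are excluded; if some mode had one, there would be no embedded controls at all.
\<close>

locale switched_system =
  fixes P :: "('n::finite, 'k::finite) switched_problem"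
    and \<Phi> :: "nat \<Rightarrow> real ^ 'n \<Rightarrow> real ^ 'k ^ 'n"
    and \<Psi> :: "nat \<Rightarrow> real ^ 'n \<Rightarrow> real ^ 'n"
  assumes horizon: "0 < horizon P" and modes: "1 \<le> modes P"
    and ctrl_compact: "\<And>i. i \<in> {1..modes P} \<Longrightarrow> compact (ctrl_set P i)"
    and ctrl_nonempty: "\<And>i. i \<in> {1..modes P} \<Longrightarrow> ctrl_set P i \<noteq> {}"
    and final_C1: "C1_scalar (final_cost P)"
    and state_exists: "\<And>w. w \<in> embedded_controls P \<Longrightarrow> \<exists>x. is_state P w x"
    and dyn_affine: "\<And>i x u. i \<in> {1..modes P} \<Longrightarrow> u \<in> ctrl_set P i \<Longrightarrow> dyn P i x u = \<Phi> i x *v u + \<Psi> i x"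
    and cost_convex: "\<And>i x. i \<in> {1..modes P} \<Longrightarrow> convex_on (ctrl_set P i) (running_cost P i x)"
    and coeff_C2: "\<And>i. i \<in> {1..modes P} \<Longrightarrow> C2_map (\<Phi> i) \<and> C2_map (\<Psi> i)"
    and cost_C1: "\<And>i u. i \<in> {1..modes P} \<Longrightarrow> u \<in> ctrl_set P i \<Longrightarrow> C1_scalar (\<lambda>x. running_cost P i x u)"
    and cost_lipschitz: "\<And>i. i \<in> {1..modes P} \<Longrightarrow>
           locally_lipschitz_on (UNIV \<times> ctrl_set P i) (\<lambda>(x, u). running_cost P i x u) \<and>
           locally_lipschitz_on (UNIV \<times> ctrl_set P i)
             (\<lambda>(x, u). gradient (\<lambda>y. running_cost P i y u) x)"
begin

abbreviation "T \<equiv> horizon P"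

abbreviation "avg_aug x \<equiv> mean P (\<lambda>i u. aug P i x u)"

abbreviation "avg_daug x \<equiv> mean P (\<lambda>i u. daug P i x u)"

lemma ctrl_convex: "i \<in> {1..modes P} \<Longrightarrow> convex (ctrl_set P i)"
  using cost_convex[of i 0] by (simp add: convex_on_def)

lemma coeff_continuous:
  assumes "i \<in> {1..modes P}"
  shows "continuous_on UNIV (\<Phi> i)" "continuous_on UNIV (\<Psi> i)"
  using coeff_C2[OF assms] C2_map_continuous by blast+

text \<open>
  On the control sets the dynamics equal \<open>\<Phi> i x *v u + \<Psi> i x\<close>, which provides their state
  derivative and its continuity; for the running cost these are assumed.
\<close>

lemma aug_C1:
  assumes i: "i \<in> {1..modes P}"
  shows "C1_in_state (ctrl_set P i) (aug P i) (daug P i)"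
proof -
  let ?U = "ctrl_set P i"
  obtain D1 E1 where D1: "\<And>x. (\<Phi> i has_derivative blinfun_apply (D1 x)) (at x)"
    and E1: "\<And>x. (D1 has_derivative blinfun_apply (E1 x)) (at x)"
    using coeff_C2[OF i] by (auto simp: C2_map_def)
  obtain D2 E2 where D2: "\<And>x. (\<Psi> i has_derivative blinfun_apply (D2 x)) (at x)"
    and E2: "\<And>x. (D2 has_derivative blinfun_apply (E2 x)) (at x)"
    using coeff_C2[OF i] by (auto simp: C2_map_def)
  have D1c: "continuous_on UNIV D1" and D2c: "continuous_on UNIV D2"
    by (rule has_derivative_continuous_on[OF E1], rule has_derivative_continuous_on[OF E2])
  have fst_c: "continuous_on (UNIV \<times> ?U) (\<lambda>z. h (fst z))" if "continuous_on UNIV h" for h :: "real ^ 'n \<Rightarrow> 'z::topological_space"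
    using continuous_on_compose2[OF that continuous_on_fst[OF continuous_on_id]] by simp
  have dyn_der: "((\<lambda>y. dyn P i y u) has_derivative (\<lambda>h. D1 x h *v u + D2 x h)) (at x)" if u: "u \<in> ?U" for u x
  proof -
    have "((\<lambda>y. \<Phi> i y *v u + \<Psi> i y) has_derivative (\<lambda>h. (\<Phi> i x *v 0 + D1 x h *v u) + D2 x h)) (at x)"
      by (intro has_derivative_add D2 bounded_bilinear.FDERIV[OF bounded_bilinear_matrix_vector_mult D1 has_derivative_const])
    then show ?thesis using dyn_affine[OF i u] by simp
  qed
  have daug_apply: "daug P i x u h = (D1 x h *v u + D2 x h, gradient (\<lambda>y. running_cost P i y u) x \<bullet> h)"
    and aug_der: "((\<lambda>y. aug P i y u) has_derivative daug P i x u) (at x)" if u: "u \<in> ?U" for u x h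
  proof -
    have *: "((\<lambda>y. aug P i y u) has_derivative (\<lambda>h. (D1 x h *v u + D2 x h, gradient (\<lambda>y. running_cost P i y u) x \<bullet> h))) (at x)"
      unfolding aug_def by (intro has_derivative_Pair dyn_der u C1_scalar_gradient cost_C1 i)
    have "daug P i x u = Blinfun (\<lambda>h. (D1 x h *v u + D2 x h, gradient (\<lambda>y. running_cost P i y u) x \<bullet> h))"
      unfolding daug_def frechet_derivative_at[OF dyn_der[OF u], symmetric] by simp
    then have eq: "blinfun_apply (daug P i x u) = (\<lambda>h. (D1 x h *v u + D2 x h, gradient (\<lambda>y. running_cost P i y u) x \<bullet> h))"
      using bounded_linear_Blinfun_apply[OF has_derivative_bounded_linear[OF *]] by simp
    show "daug P i x u h = (D1 x h *v u + D2 x h, gradient (\<lambda>y. running_cost P i y u) x \<bullet> h)"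
      by (simp add: eq)
    show "((\<lambda>y. aug P i y u) has_derivative daug P i x u) (at x)" using * by (simp add: eq)
  qed
  have "continuous_on (UNIV \<times> ?U) (\<lambda>z. (\<Phi> i (fst z) *v snd z + \<Psi> i (fst z), running_cost P i (fst z) (snd z)))"
    using locally_lipschitz_on_imp_continuous_on[OF conjunct1[OF cost_lipschitz[OF i]]]
    by (intro continuous_intros bounded_bilinear.continuous_on[OF bounded_bilinear_matrix_vector_mult]
        fst_c coeff_continuous[OF i]) (simp add: case_prod_beta')
  then have 1: "continuous_on (UNIV \<times> ?U) (\<lambda>(x, u). aug P i x u)"
    by (rule continuous_on_eq) (auto simp: aug_def dyn_affine[OF i])
  have 2: "continuous_on (UNIV \<times> ?U) (\<lambda>(x, u). daug P i x u)"
  proof (rule continuous_on_blinfun_componentwise)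
    fix b :: "real ^ 'n"
    have "continuous_on (UNIV \<times> ?U) (\<lambda>z. (D1 (fst z) b *v snd z + D2 (fst z) b,
        gradient (\<lambda>y. running_cost P i y (snd z)) (fst z) \<bullet> b))"
      using locally_lipschitz_on_imp_continuous_on[OF conjunct2[OF cost_lipschitz[OF i]]]
      by (intro continuous_intros bounded_bilinear.continuous_on[OF bounded_bilinear_matrix_vector_mult]
          fst_c D1c D2c) (simp add: case_prod_beta')
    then show "continuous_on (UNIV \<times> ?U) (\<lambda>z. (case z of (x, u) \<Rightarrow> daug P i x u) b)"
      by (rule continuous_on_eq) (auto simp: daug_apply)
  qed
  from 1 2 aug_der show ?thesis by (simp add: C1_in_state_def)
qed

lemma aug_continuous: "i \<in> {1..modes P} \<Longrightarrow> continuous_on (UNIV \<times> ctrl_set P i) (\<lambda>(x, u). aug P i x u)"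
  using aug_C1 by (simp add: C1_in_state_def)

lemma aug_bounds:
  "\<exists>B>0. \<forall>i\<in>{1..modes P}. \<forall>x\<in>cball 0 R. \<forall>u\<in>ctrl_set P i. norm (aug P i x u) \<le> B \<and> norm (daug P i x u) \<le> B"
proof -
  have "\<forall>i\<in>{1..modes P}. \<exists>B>0. \<forall>x\<in>cball 0 R. \<forall>u\<in>ctrl_set P i. norm (aug P i x u) \<le> B \<and> norm (daug P i x u) \<le> B"
    using C1_in_state_bounded[OF aug_C1 ctrl_compact] by blast
  from bchoice[OF this] obtain B where B: "\<And>i. i \<in> {1..modes P} \<Longrightarrow> B i > 0 \<and>
      (\<forall>x\<in>cball 0 R. \<forall>u\<in>ctrl_set P i. norm (aug P i x u) \<le> B i \<and> norm (daug P i x u) \<le> B i)" by blast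
  define b where "b = (\<Sum>i=1..modes P. B i)"
  have Bb: "B i \<le> b" if "i \<in> {1..modes P}" for i
    unfolding b_def using that B by (intro member_le_sum) (auto intro: less_imp_le)
  have "b > 0" unfolding b_def using modes B by (intro sum_pos) auto
  moreover have "norm (aug P i x u) \<le> b \<and> norm (daug P i x u) \<le> b"
    if i: "i \<in> {1..modes P}" and "x \<in> cball 0 R" "u \<in> ctrl_set P i" for i x u
    using B[OF i] Bb[OF i] that(2,3) order.trans by blast
  ultimately show ?thesis by blast
qed

text \<open>
  The modulus can be taken as the minimum over the finitely many modes.
\<close>

lemma aug_linearization:
  assumes "e > 0"
  shows "\<exists>d>0. \<forall>i\<in>{1..modes P}. \<forall>x\<in>cball 0 R. \<forall>y\<in>cball 0 R. \<forall>u\<in>ctrl_set P i. norm (y - x) < d \<longrightarrow>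
     norm (aug P i y u - aug P i x u - daug P i x u (y - x)) \<le> e * norm (y - x)"
proof -
  have "\<forall>i\<in>{1..modes P}. \<exists>d>0. \<forall>x\<in>cball 0 R. \<forall>y\<in>cball 0 R. \<forall>u\<in>ctrl_set P i. norm (y - x) < d \<longrightarrow>
     norm (aug P i y u - aug P i x u - daug P i x u (y - x)) \<le> e * norm (y - x)"
    using C1_in_state_linearization[OF aug_C1 ctrl_compact assms] by blast
  from bchoice[OF this] obtain d where d: "\<And>i. i \<in> {1..modes P} \<Longrightarrow> d i > 0 \<and>
     (\<forall>x\<in>cball 0 R. \<forall>y\<in>cball 0 R. \<forall>u\<in>ctrl_set P i. norm (y - x) < d i \<longrightarrow>
     norm (aug P i y u - aug P i x u - daug P i x u (y - x)) \<le> e * norm (y - x))" by blast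
  define \<delta> where "\<delta> = Min (d ` {1..modes P})"
  have "\<delta> > 0" unfolding \<delta>_def using modes d by (subst Min_gr_iff) auto
  moreover have "\<delta> \<le> d i" if "i \<in> {1..modes P}" for i unfolding \<delta>_def using that by (intro Min_le) auto
  ultimately show ?thesis using d less_le_trans by (intro exI[of _ \<delta>]) blast
qed
lemma mean_aug_bounds:
  "\<exists>B>0. \<forall>w\<in>embedded_values P. \<forall>x\<in>cball 0 R.
     norm (avg_aug x w) \<le> B \<and> norm (avg_daug x w) \<le> B \<and>
     (\<forall>y\<in>cball 0 R. norm (avg_aug y w - avg_aug x w) \<le> B * norm (y - x))"
proof -
  obtain B where "B > 0" and B: "\<And>i x u. i \<in> {1..modes P} \<Longrightarrow> x \<in> cball 0 R \<Longrightarrow> u \<in> ctrl_set P i \<Longrightarrow>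
      norm (aug P i x u) \<le> B \<and> norm (daug P i x u) \<le> B"
    using aug_bounds[of R] by blast
  have "norm (avg_aug x w) \<le> B \<and> norm (avg_daug x w) \<le> B \<and>
     (\<forall>y\<in>cball 0 R. norm (avg_aug y w - avg_aug x w) \<le> B * norm (y - x))"
    if w: "w \<in> embedded_values P" and x: "x \<in> cball 0 R" for w x
  proof (intro conjI ballI)
    show "norm (avg_aug x w) \<le> B" "norm (avg_daug x w) \<le> B"
      using B x by (intro mean_norm_le[OF w]; blast)+
    fix y :: "real ^ 'n" assume y: "y \<in> cball 0 R"
    have "norm (aug P i y u - aug P i x u) \<le> B * norm (y - x)" if i: "i \<in> {1..modes P}" and u: "u \<in> ctrl_set P i" for i u
      using B[OF i _ u] by (intro C1_in_state_lipschitz[OF aug_C1[OF i] _ u x y]) blast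
    then show "norm (avg_aug y w - avg_aug x w) \<le> B * norm (y - x)"
      unfolding mean_diff[symmetric] by (rule mean_norm_le[OF w])
  qed
  with \<open>B > 0\<close> show ?thesis by blast
qed

lemma fst_mean_aug: "fst (avg_aug x w) = velocity P x w"
  and snd_mean_aug: "snd (avg_aug x w) = mean P (\<lambda>i u. running_cost P i x u) w"
  by (simp_all add: velocity_def mean_def aug_def fst_sum snd_sum)

lemma mean_aug_integrable:
  assumes "w \<in> embedded_controls P" "continuous_on {0..T} x"
  shows "(\<lambda>s. avg_aug (x s) (w s)) absolutely_integrable_on {0..T}"
  using mean_absolutely_integrable[OF assms, of "\<lambda>i (x, u). aug P i x u", OF aug_continuous ctrl_compact] by simp

lemma velocity_integrable:
  assumes "w \<in> embedded_controls P" "continuous_on {0..T} x"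
  shows "(\<lambda>s. velocity P (x s) (w s)) absolutely_integrable_on {0..T}"
  using absolutely_integrable_linear[OF mean_aug_integrable[OF assms] bounded_linear_fst]
  by (simp add: o_def fst_mean_aug)

section \<open>Convex combinations of controls\<close>

lemma embedded_component:
  assumes "w \<in> embedded_controls P" "s \<in> {0..T}" "i \<in> {1..modes P}"
  shows "0 \<le> fst (w s i)" "snd (w s i) \<in> ctrl_set P i"
  using embedded_controls_values[OF assms(1,2)] assms(3) by (auto simp: embedded_values_def)

lemma update_values:
  assumes w: "w s \<in> embedded_values P" and ws: "ws s \<in> embedded_values P" and l: "0 \<le> l" "l \<le> 1"
  shows "update l w ws s \<in> embedded_values P"
proof -
  have comp: "fst (update l w ws s i) = (1 - l) * fst (w s i) + l * fst (ws s i)" "snd (update l w ws s i) \<in> ctrl_set P i"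
    and pos: "0 \<le> fst (w s i)" "0 \<le> fst (ws s i)" if i: "i \<in> {1..modes P}" for i
  proof -
    have *: "0 \<le> fst (w s i)" "0 \<le> fst (ws s i)" "snd (w s i) \<in> ctrl_set P i" "snd (ws s i) \<in> ctrl_set P i"
      using w ws i by (auto simp: embedded_values_def)
    from update_component(1,2)[where w=w and ws=ws and t=s and i=i, OF l *(1,2) ctrl_convex[OF i] *(3,4)]
    show "fst (update l w ws s i) = (1 - l) * fst (w s i) + l * fst (ws s i)" "snd (update l w ws s i) \<in> ctrl_set P i" .
    from * show "0 \<le> fst (w s i)" "0 \<le> fst (ws s i)" by blast+
  qed
  have "(\<Sum>i=1..modes P. fst (update l w ws s i))
      = (\<Sum>i=1..modes P. (1 - l) * fst (w s i) + l * fst (ws s i))"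
    using comp(1) by (intro sum.cong) auto
  also have "\<dots> = (1 - l) * (\<Sum>i=1..modes P. fst (w s i)) + l * (\<Sum>i=1..modes P. fst (ws s i))"
    by (simp only: sum.distrib sum_distrib_left)
  also have "\<dots> = 1" using w ws by (simp add: embedded_values_def)
  finally have "(\<Sum>i=1..modes P. fst (update l w ws s i)) = 1" .
  moreover have "0 \<le> fst (update l w ws s i)" if "i \<in> {1..modes P}" for i
    using comp(1)[OF that] pos[OF that] l by simp
  ultimately show ?thesis using comp(2) by (simp add: embedded_values_def)
qed

lemma update_embedded:
  assumes w: "w \<in> embedded_controls P" and ws: "ws \<in> embedded_controls P" and l: "0 \<le> l" "l \<le> 1"
  shows "update l w ws \<in> embedded_controls P"
proof -
  have "update l w ws s \<in> embedded_values P" if "s \<in> {0..T}" for s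
    using that by (intro update_values l embedded_controls_values w ws)
  moreover have "(\<lambda>s. update l w ws s i) \<in> borel_measurable (lebesgue_on {0..T})" if i: "i \<in> {1..modes P}" for i
  proof -
    have wi: "(\<lambda>s. w s i) \<in> borel_measurable (lebesgue_on {0..T})" "(\<lambda>s. ws s i) \<in> borel_measurable (lebesgue_on {0..T})"
      using w ws i by (auto simp: embedded_controls_def)
    show ?thesis unfolding update_def Let_def
      by (intro borel_measurable_Pair borel_measurable_add borel_measurable_scaleR borel_measurable_times
          borel_measurable_divide borel_measurable_diff borel_measurable_const borel_measurable_fst_snd wi)
  qed
  ultimately show ?thesis by (simp add: embedded_controls_def)
qed

text \<open>
  For affine dynamics, the update in every mode and the convex combination in the sense of measures have
  the same velocity.
\<close>

lemma velocity_update: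
  assumes w: "w \<in> embedded_controls P" and ws: "ws \<in> embedded_controls P" and l: "0 \<le> l" "l \<le> 1"
    and s: "s \<in> {0..T}"
  shows "velocity P y (update l w ws s) = (1 - l) *\<^sub>R velocity P y (w s) + l *\<^sub>R velocity P y (ws s)"
proof -
  have "fst (update l w ws s i) *\<^sub>R dyn P i y (snd (update l w ws s i))
      = (1 - l) *\<^sub>R (fst (w s i) *\<^sub>R dyn P i y (snd (w s i))) + l *\<^sub>R (fst (ws s i) *\<^sub>R dyn P i y (snd (ws s i)))"
    if i: "i \<in> {1..modes P}" for i
  proof -
    note comp = update_component[where w=w and ws=ws and t=s and i=i, OF l embedded_component(1)[OF w s i] embedded_component(1)[OF ws s i]
      ctrl_convex[OF i] embedded_component(2)[OF w s i] embedded_component(2)[OF ws s i]]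
    have "fst (update l w ws s i) *\<^sub>R (\<Phi> i y *v snd (update l w ws s i))
        = \<Phi> i y *v (((1 - l) * fst (w s i)) *\<^sub>R snd (w s i) + (l * fst (ws s i)) *\<^sub>R snd (ws s i))"
      unfolding comp(4)[symmetric] by (simp add: matrix_vector_mult_scaleR)
    also have "\<dots> = ((1 - l) * fst (w s i)) *\<^sub>R (\<Phi> i y *v snd (w s i)) + (l * fst (ws s i)) *\<^sub>R (\<Phi> i y *v snd (ws s i))"
      by (simp add: matrix_vector_right_distrib matrix_vector_mult_scaleR)
    finally show ?thesis
      using dyn_affine[OF i comp(2)] dyn_affine[OF i embedded_component(2)[OF w s i]]
        dyn_affine[OF i embedded_component(2)[OF ws s i]]
      by (simp add: comp(1) algebra_simps)
  qed
  then show ?thesis unfolding velocity_def scaleR_sum_right sum.distrib[symmetric] by (intro sum.cong refl) simp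
qed

lemma mix_state_eq:
  assumes "w \<in> embedded_controls P" "ws \<in> embedded_controls P" "0 \<le> l" "l \<le> 1"
  shows "mix_state P l w ws = state P (update l w ws)"
proof -
  have "is_trajectory P (\<lambda>y s. (1 - l) *\<^sub>R velocity P y (w s) + l *\<^sub>R velocity P y (ws s))
      = is_trajectory P (\<lambda>y s. velocity P y (update l w ws s))"
    by (rule is_trajectory_cong) (simp add: velocity_update[OF assms])
  then show ?thesis by (simp add: mix_state_def state_def is_state_def)
qed

lemma state_is_state: "w \<in> embedded_controls P \<Longrightarrow> is_state P w (state P w)"
  unfolding state_def using state_exists by (rule someI_ex)

lemma state_continuous: "w \<in> embedded_controls P \<Longrightarrow> continuous_on {0..T} (state P w)"
  using state_is_state by (auto simp: is_state_def is_trajectory_def)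

lemma running_cost_continuous:
  "i \<in> {1..modes P} \<Longrightarrow> continuous_on (UNIV \<times> ctrl_set P i) (\<lambda>z. running_cost P i (fst z) (snd z))"
  using locally_lipschitz_on_imp_continuous_on[OF conjunct1[OF cost_lipschitz]] by (simp add: case_prod_beta')

text \<open>
  A single summand is itself an average, namely of the family that vanishes in all other modes.
\<close>

lemma component_cost_integrable:
  assumes w: "w \<in> embedded_controls P" and x: "continuous_on {0..T} x" and i: "i \<in> {1..modes P}"
  shows "(\<lambda>s. fst (w s i) * running_cost P i (x s) (snd (w s i))) absolutely_integrable_on {0..T}"
proof -
  define f where "f = (\<lambda>j z. if j = i then running_cost P i (fst z) (snd z) else 0)"
  have "(\<lambda>s. mean P (\<lambda>j u. f j (x s, u)) (w s)) absolutely_integrable_on {0..T}"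
  proof (rule mean_absolutely_integrable[OF w x])
    show "continuous_on (UNIV \<times> ctrl_set P j) (f j)" if "j \<in> {1..modes P}" for j
      using running_cost_continuous[OF i] by (cases "j = i") (auto simp: f_def)
  qed (rule ctrl_compact)
  moreover have "mean P (\<lambda>j u. f j (x s, u)) (w s) = fst (w s i) * running_cost P i (x s) (snd (w s i))" for s
    using i by (simp add: mean_def f_def if_distrib[of "\<lambda>r. _ * r"] cong: if_cong)
  ultimately show ?thesis by simp
qed

lemma running_total_mean:
  assumes w: "w \<in> embedded_controls P" and x: "continuous_on {0..T} x"
  shows "running_total P x w = integral {0..T} (\<lambda>s. mean P (\<lambda>i u. running_cost P i (x s) u) (w s))"
proof -
  have "running_total P x w
      = (\<Sum>i=1..modes P. integral {0..T} (\<lambda>s. fst (w s i) * running_cost P i (x s) (snd (w s i))))"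
    unfolding running_total_def
    by (intro sum.cong refl set_lebesgue_integral_eq_integral(2) component_cost_integrable w x)
  also have "\<dots> = integral {0..T} (\<lambda>s. \<Sum>i=1..modes P. fst (w s i) * running_cost P i (x s) (snd (w s i)))"
    by (intro integral_sum[symmetric] set_lebesgue_integral_eq_integral(1) component_cost_integrable w x) auto
  finally show ?thesis by (simp add: mean_def)
qed

lemma running_total_update_le:
  assumes w: "w \<in> embedded_controls P" and ws: "ws \<in> embedded_controls P" and l: "0 \<le> l" "l \<le> 1"
    and x: "continuous_on {0..T} x"
  shows "running_total P x (update l w ws) \<le> (1 - l) * running_total P x w + l * running_total P x ws"
proof -
  note int = set_lebesgue_integral_eq_integral[OF component_cost_integrable[OF _ x]]
  have "(LINT t:{0..T}|lebesgue. fst (update l w ws t i) * running_cost P i (x t) (snd (update l w ws t i)))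
      \<le> (1 - l) * (LINT t:{0..T}|lebesgue. fst (w t i) * running_cost P i (x t) (snd (w t i)))
        + l * (LINT t:{0..T}|lebesgue. fst (ws t i) * running_cost P i (x t) (snd (ws t i)))"
    if i: "i \<in> {1..modes P}" for i
  proof -
    note u = update_embedded[OF w ws l]
    have "integral {0..T} (\<lambda>t. fst (update l w ws t i) * running_cost P i (x t) (snd (update l w ws t i)))
      \<le> integral {0..T} (\<lambda>t. (1 - l) * (fst (w t i) * running_cost P i (x t) (snd (w t i)))
        + l * (fst (ws t i) * running_cost P i (x t) (snd (ws t i))))"
    proof (rule integral_le)
      show "(\<lambda>t. (1 - l) * (fst (w t i) * running_cost P i (x t) (snd (w t i)))
        + l * (fst (ws t i) * running_cost P i (x t) (snd (ws t i)))) integrable_on {0..T}"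
        by (intro integrable_add integrable_on_mult_right int(1) w ws i)
      fix t assume t: "t \<in> {0..T}"
      show "fst (update l w ws t i) * running_cost P i (x t) (snd (update l w ws t i))
        \<le> (1 - l) * (fst (w t i) * running_cost P i (x t) (snd (w t i)))
        + l * (fst (ws t i) * running_cost P i (x t) (snd (ws t i)))"
        using update_component(3)[where w=w and ws=ws and t=t and i=i, OF l embedded_component(1)[OF w t i] embedded_component(1)[OF ws t i]
          ctrl_convex[OF i] embedded_component(2)[OF w t i] embedded_component(2)[OF ws t i] cost_convex[OF i, of "x t"]]
        by (simp add: mult.assoc)
    qed (intro int(1) u i)
    also have "\<dots> = (1 - l) * integral {0..T} (\<lambda>t. fst (w t i) * running_cost P i (x t) (snd (w t i)))
        + l * integral {0..T} (\<lambda>t. fst (ws t i) * running_cost P i (x t) (snd (ws t i)))"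
      by (subst integral_add) (auto intro!: integrable_on_mult_right int(1) w ws i)
    finally show ?thesis unfolding int(2)[OF u i] int(2)[OF w i] int(2)[OF ws i] .
  qed
  then show ?thesis unfolding running_total_def sum_distrib_left sum.distrib[symmetric] by (intro sum_mono)
qed

lemma cost_update_le_mix_cost:
  assumes "w \<in> embedded_controls P" "ws \<in> embedded_controls P" "0 \<le> l" "l \<le> 1"
  shows "cost P (update l w ws) \<le> mix_cost P l w ws"
  using running_total_update_le[OF assms state_continuous[OF update_embedded[OF assms]]]
  by (simp add: cost_def mix_cost_def mix_state_eq[OF assms] Let_def)

text \<open>
  Away from finitely many times the mode and the control value are continuous in time, hence measurable,
  and finitely many times do not affect measurability.
\<close>

lemma embed_embedded:
  assumes v: "v \<in> admissible_controls P"
  shows "embed P v \<in> embedded_controls P"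
proof -
  have vV: "fst (v t) \<in> {1..modes P}" "snd (v t) \<in> ctrl_set P (fst (v t))" if "t \<in> {0..T}" for t
  proof -
    have "v t \<in> mode_controls P" using v that by (simp add: admissible_controls_def)
    then show "fst (v t) \<in> {1..modes P}" "snd (v t) \<in> ctrl_set P (fst (v t))"
      by (auto simp: mode_controls_def)
  qed
  have "embed P v t \<in> embedded_values P" if t: "t \<in> {0..T}" for t
  proof -
    have "(SOME u. u \<in> ctrl_set P i) \<in> ctrl_set P i" if "i \<in> {1..modes P}" for i
      using ctrl_nonempty[OF that] by (simp add: some_in_eq)
    moreover have "(\<Sum>i=1..modes P. fst (embed P v t i)) = (\<Sum>i=1..modes P. if i = fst (v t) then 1 else 0)"
      by (intro sum.cong) (auto simp: embed_def)
    ultimately show ?thesis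
      using vV[OF t] by (auto simp: embedded_values_def embed_def)
  qed
  moreover have "(\<lambda>t. embed P v t i) \<in> borel_measurable (lebesgue_on {0..T})" for i
  proof -
    obtain S where S: "finite S" and c1: "continuous_on ({0..T} - S) (\<lambda>t. fst (v t))"
      and c2: "(\<lambda>t. snd (v t)) C1_differentiable_on ({0..T} - S)"
      using v unfolding admissible_controls_def by blast
    have meas: "{0..T} - S \<in> sets lebesgue"
      using sets.Diff[OF _ negligible_imp_sets[OF negligible_finite[OF S]], of "{0..T}"] by simp
    have "(\<lambda>t. fst (v t)) \<in> borel_measurable (lebesgue_on ({0..T} - S))"
      using c1 by (intro continuous_imp_measurable_on_sets_lebesgue meas)
    moreover have "(\<lambda>t. snd (v t)) \<in> borel_measurable (lebesgue_on ({0..T} - S))"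
      using C1_differentiable_imp_continuous_on[OF c2] by (intro continuous_imp_measurable_on_sets_lebesgue meas)
    ultimately have "(\<lambda>t. if i = fst (v t) then (1 :: real, snd (v t)) else (0, SOME u. u \<in> ctrl_set P i))
        \<in> borel_measurable (lebesgue_on ({0..T} - S))"
      by measurable
    then have "(\<lambda>t. embed P v t i) \<in> borel_measurable (lebesgue_on ({0..T} - S))" by (simp add: embed_def)
    then show ?thesis using S by (rule measurable_lebesgue_on_finite_exception) auto
  qed
  ultimately show ?thesis by (simp add: embedded_controls_def)
qed
section \<open>The uniform bound on the states\<close>

text \<open>
  In the coordinates \<open>(\<alpha>, \<alpha> u)\<close> of each mode the velocity is linear
  (\<open>velocity_coord\<close>) and the set of values is convex and compact.
\<close>

definition coord :: "(nat \<Rightarrow> real \<times> (real ^ 'k)) \<Rightarrow> nat \<Rightarrow> real \<times> (real ^ 'k)" where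
  "coord w i = (fst (w i), fst (w i) *\<^sub>R snd (w i))"

definition coord_field :: "nat \<Rightarrow> real ^ 'n \<Rightarrow> ((real \<times> (real ^ 'k)) \<Rightarrow>\<^sub>L (real ^ 'n))" where
  "coord_field i y = Blinfun (\<lambda>z. \<Phi> i y *v snd z + fst z *\<^sub>R \<Psi> i y)"

lemma coord_field_apply: "coord_field i y z = \<Phi> i y *v snd z + fst z *\<^sub>R \<Psi> i y"
proof -
  have "bounded_linear (\<lambda>z :: real \<times> (real ^ 'k). \<Phi> i y *v snd z + fst z *\<^sub>R \<Psi> i y)"
    by (intro bounded_linear_add bounded_linear_compose[OF matrix_vector_mul_bounded_linear bounded_linear_snd]
        bounded_linear_compose[OF bounded_linear_scaleR_left bounded_linear_fst])
  then show ?thesis unfolding coord_field_def by (simp add: bounded_linear_Blinfun_apply)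
qed

lemma velocity_coord:
  assumes "w \<in> embedded_values P"
  shows "velocity P y w = (\<Sum>i=1..modes P. coord_field i y (coord w i))"
  unfolding velocity_def
proof (rule sum.cong[OF refl])
  fix i assume i: "i \<in> {1..modes P}"
  then have "snd (w i) \<in> ctrl_set P i" using assms by (simp add: embedded_values_def)
  then show "fst (w i) *\<^sub>R dyn P i y (snd (w i)) = coord_field i y (coord w i)"
    using dyn_affine[OF i] by (simp add: coord_field_apply coord_def scaleR_right_distrib matrix_vector_mult_scaleR)
qed

lemma coord_field_continuous:
  fixes x :: "real \<Rightarrow> real ^ 'n"
  assumes i: "i \<in> {1..modes P}" and x: "continuous_on S x"
  shows "continuous_on S (\<lambda>s. coord_field i (x s))"
proof (rule continuous_on_blinfun_componentwise)
  fix b :: "real \<times> (real ^ 'k)"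
  have "continuous_on S (\<lambda>s. \<Phi> i (x s))" "continuous_on S (\<lambda>s. \<Psi> i (x s))"
    using continuous_on_compose2[OF coeff_continuous(1)[OF i] x] continuous_on_compose2[OF coeff_continuous(2)[OF i] x] by auto
  then show "continuous_on S (\<lambda>s. coord_field i (x s) b)"
    unfolding coord_field_apply
    by (intro continuous_intros bounded_bilinear.continuous_on[OF bounded_bilinear_matrix_vector_mult])
qed

definition coord_values :: "(nat \<Rightarrow> real \<times> (real ^ 'k)) set" where
  "coord_values = {\<zeta>. \<exists>w\<in>embedded_values P. \<forall>i\<in>{1..modes P}. \<zeta> i = coord w i}"

text \<open>
  In these coordinates \<open>update\<close> with \<open>l = 1/2\<close> is the midpoint.
\<close>

lemma coord_values_midpoint:
  assumes "a \<in> coord_values" "b \<in> coord_values"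
  shows "(\<lambda>i. (1/2) *\<^sub>R a i + (1/2) *\<^sub>R b i) \<in> coord_values"
proof -
  obtain v w where v: "v \<in> embedded_values P" "\<And>i. i \<in> {1..modes P} \<Longrightarrow> a i = coord v i"
    and w: "w \<in> embedded_values P" "\<And>i. i \<in> {1..modes P} \<Longrightarrow> b i = coord w i"
    using assms unfolding coord_values_def by blast
  define m where "m = update (1/2) (\<lambda>_. v) (\<lambda>_. w) 0"
  have "m \<in> embedded_values P" unfolding m_def using v w by (intro update_values) auto
  moreover have "(1/2) *\<^sub>R a i + (1/2) *\<^sub>R b i = coord m i" if i: "i \<in> {1..modes P}" for i
  proof -
    have *: "0 \<le> fst (v i)" "0 \<le> fst (w i)" "snd (v i) \<in> ctrl_set P i" "snd (w i) \<in> ctrl_set P i"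
      using v w i by (auto simp: embedded_values_def)
    note comp = update_component(1,4)[where w="\<lambda>_. v" and ws="\<lambda>_. w" and t=0 and i=i and l="1/2",
        OF _ _ *(1,2) ctrl_convex[OF i] *(3,4)]
    show ?thesis unfolding v(2)[OF i] w(2)[OF i] coord_def m_def
      using comp by (simp add: comp)
  qed
  ultimately show ?thesis unfolding coord_values_def by blast
qed

lemma embedded_values_weight_le_1:
  assumes "w \<in> embedded_values P" "i \<in> {1..modes P}"
  shows "fst (w i) \<le> 1"
  using member_le_sum[of i "{1..modes P}" "\<lambda>i. fst (w i)"] assms by (auto simp: embedded_values_def)

lemma cone_compact:
  assumes "i \<in> {1..modes P}"
  shows "compact ((\<lambda>(a, u). (a, a *\<^sub>R u)) ` ({0..1::real} \<times> ctrl_set P i))"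
  using ctrl_compact[OF assms]
  by (intro compact_continuous_image compact_Times) (auto simp: case_prod_beta' intro!: continuous_intros)

lemma coord_in_cone:
  assumes "w \<in> embedded_values P" "i \<in> {1..modes P}"
  shows "coord w i \<in> (\<lambda>(a, u). (a, a *\<^sub>R u)) ` ({0..1} \<times> ctrl_set P i)"
  using assms embedded_values_weight_le_1[OF assms]
  by (intro image_eqI[of _ _ "w i"]) (auto simp: coord_def embedded_values_def case_prod_beta' mem_Times_iff)

text \<open>
  In each mode the coordinates lie in the compact set of all \<open>(a, a *\<^sub>R u)\<close> with
  \<open>a \<in> {0..1}\<close> and \<open>u\<close> in the control set, and the sum of the weights is
  continuous.
\<close>

lemma coord_values_closed:
  assumes a: "\<And>n::nat. a n \<in> coord_values" and lim: "\<And>i. i \<in> {1..modes P} \<Longrightarrow> (\<lambda>n. a n i) \<longlonglongrightarrow> l i"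
  shows "l \<in> coord_values"
proof -
  have cone: "a n i \<in> (\<lambda>(a, u). (a, a *\<^sub>R u)) ` ({0..1} \<times> ctrl_set P i)" if "i \<in> {1..modes P}" for n i
    using a[of n] coord_in_cone that by (auto simp: coord_values_def)
  have "\<exists>w. fst w \<in> {0..1} \<and> snd w \<in> ctrl_set P i \<and> l i = (fst w, fst w *\<^sub>R snd w)" if i: "i \<in> {1..modes P}" for i
    using closed_sequentially[OF compact_imp_closed[OF cone_compact[OF i]] cone[OF i] lim[OF i]] by force
  then have "\<forall>i\<in>{1..modes P}. \<exists>w. fst w \<in> {0..1} \<and> snd w \<in> ctrl_set P i \<and> l i = (fst w, fst w *\<^sub>R snd w)" by blast
  from bchoice[OF this] obtain w where
    w: "\<And>i. i \<in> {1..modes P} \<Longrightarrow> fst (w i) \<in> {0..1} \<and> snd (w i) \<in> ctrl_set P i \<and> l i = (fst (w i), fst (w i) *\<^sub>R snd (w i))" by blast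
  have "(\<Sum>i=1..modes P. fst (a n i)) = 1" for n
    using a[of n] by (auto simp: coord_values_def embedded_values_def coord_def)
  moreover have "(\<lambda>n. \<Sum>i=1..modes P. fst (a n i)) \<longlonglongrightarrow> (\<Sum>i=1..modes P. fst (l i))"
    by (intro tendsto_sum tendsto_fst lim)
  ultimately have "(\<Sum>i=1..modes P. fst (l i)) = 1" by (simp add: LIMSEQ_const_iff)
  moreover have "(\<Sum>i=1..modes P. fst (l i)) = (\<Sum>i=1..modes P. fst (w i))"
    using w by (intro sum.cong) auto
  ultimately have "w \<in> embedded_values P" using w by (auto simp: embedded_values_def)
  then show ?thesis using w unfolding coord_values_def coord_def by blast
qed

lemma coord_values_bounded: "\<exists>B\<ge>0. \<forall>a\<in>coord_values. \<forall>i\<in>{1..modes P}. norm (a i) \<le> B"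
proof -
  have "\<forall>i\<in>{1..modes P}. \<exists>B. \<forall>z\<in>(\<lambda>(a, u). (a, a *\<^sub>R u)) ` ({0..1} \<times> ctrl_set P i). norm z \<le> B"
    using compact_imp_bounded[OF cone_compact] unfolding bounded_iff by blast
  from bchoice[OF this] obtain B where
    B: "\<And>i z. i \<in> {1..modes P} \<Longrightarrow> z \<in> (\<lambda>(a, u). (a, a *\<^sub>R u)) ` ({0..1} \<times> ctrl_set P i) \<Longrightarrow> norm z \<le> B i" by blast
  define b where "b = (\<Sum>j=1..modes P. \<bar>B j\<bar>)"
  have "norm (a i) \<le> b" if a: "a \<in> coord_values" and i: "i \<in> {1..modes P}" for a i
  proof -
    obtain w where "w \<in> embedded_values P" "a i = coord w i" using a i unfolding coord_values_def by blast
    then have "norm (a i) \<le> B i" using B[OF i] coord_in_cone[OF _ i] by simp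
    also have "\<dots> \<le> \<bar>B i\<bar>" by simp
    also have "\<dots> \<le> b" unfolding b_def using i by (intro member_le_sum) auto
    finally show ?thesis .
  qed
  moreover have "0 \<le> b" unfolding b_def by (intro sum_nonneg) auto
  ultimately show ?thesis by blast
qed

text \<open>
  Dividing by the weight recovers the control value where the weight is positive; where it vanishes, any
  element of the control set will do.
\<close>

lemma control_of_coord:
  assumes \<zeta>: "\<And>s. s \<in> {0..T} \<Longrightarrow> \<zeta> s \<in> coord_values"
    and m: "\<And>i. i \<in> {1..modes P} \<Longrightarrow> (\<lambda>s. \<zeta> s i) \<in> borel_measurable (lebesgue_on {0..T})"
  obtains w where "w \<in> embedded_controls P" "\<And>s i. s \<in> {0..T} \<Longrightarrow> i \<in> {1..modes P} \<Longrightarrow> coord (w s) i = \<zeta> s i"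
proof -
  define w where "w = (\<lambda>s i. (fst (\<zeta> s i), if 0 < fst (\<zeta> s i) then inverse (fst (\<zeta> s i)) *\<^sub>R snd (\<zeta> s i)
     else (SOME u. u \<in> ctrl_set P i)))"
  have *: "coord (w s) i = \<zeta> s i \<and> 0 \<le> fst (w s i) \<and> snd (w s i) \<in> ctrl_set P i"
    if s: "s \<in> {0..T}" and i: "i \<in> {1..modes P}" for s i
  proof -
    obtain v where v: "v \<in> embedded_values P" "\<zeta> s i = coord v i" using \<zeta>[OF s] i unfolding coord_values_def by blast
    then have "0 \<le> fst (v i)" "snd (v i) \<in> ctrl_set P i" using i by (auto simp: embedded_values_def)
    then show ?thesis using ctrl_nonempty[OF i] by (auto simp: w_def v(2) coord_def some_in_eq)
  qed
  have "(\<Sum>i=1..modes P. fst (w s i)) = 1" if s: "s \<in> {0..T}" for s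
    using \<zeta>[OF s] by (auto simp: w_def coord_values_def embedded_values_def coord_def)
  with * have "w s \<in> embedded_values P" if "s \<in> {0..T}" for s
    using that by (simp add: embedded_values_def)
  moreover have "(\<lambda>s. w s i) \<in> borel_measurable (lebesgue_on {0..T})" if i: "i \<in> {1..modes P}" for i
  proof -
    have m1: "(\<lambda>s. fst (\<zeta> s i)) \<in> borel_measurable (lebesgue_on {0..T})"
      and m2: "(\<lambda>s. snd (\<zeta> s i)) \<in> borel_measurable (lebesgue_on {0..T})"
      using m[OF i] by (rule borel_measurable_fst_snd)+
    then have "{s \<in> space (lebesgue_on {0..T}). 0 < fst (\<zeta> s i)} \<in> sets (lebesgue_on {0..T})"
      by (intro borel_measurable_less borel_measurable_const)
    then show ?thesis unfolding w_def
      by (intro borel_measurable_Pair measurable_If borel_measurable_scaleR borel_measurable_inverse borel_measurable_const m1 m2)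
  qed
  ultimately have "w \<in> embedded_controls P" by (simp add: embedded_controls_def)
  with * that show thesis by blast
qed
lemma state_integral:
  assumes "w \<in> embedded_controls P" "t \<in> {0..T}"
  shows "state P w t = init P + integral {0..t} (\<lambda>s. velocity P (state P w s) (w s))"
  using is_trajectory_integral(2)[OF state_is_state[OF assms(1), unfolded is_state_def] assms(2)] .

text \<open>
  Suppose that controls \<open>wn n\<close> have states exceeding \<open>n\<close>. A subsequence converges
  weakly to a control \<open>w\<close> with state \<open>x\<close>, bounded by \<open>R0\<close>. As long as the
  state \<open>y\<close> of a member of the subsequence stays within distance 1 of \<open>x\<close>, the
  velocity is Lipschitz along both, and Gronwall's inequality bounds the distance by a multiple of the
  weak error \<open>\<kappa>\<close>. Since this is less than 1, the distance never reaches 1, and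
  \<open>y\<close> stays in the ball of radius \<open>R0 + 1\<close>.
\<close>

lemma states_bounded: "\<exists>R>0. \<forall>w\<in>embedded_controls P. \<forall>t\<in>{0..T}. norm (state P w t) \<le> R"
proof (rule ccontr)
  assume neg: "\<not> ?thesis"
  have "\<exists>w\<in>embedded_controls P. \<exists>t\<in>{0..T}. real n < norm (state P w t)" for n :: nat
  proof -
    have "real n + 1 > 0" by simp
    with neg obtain w t where "w \<in> embedded_controls P" "t \<in> {0..T}" "\<not> norm (state P w t) \<le> real n + 1" by blast
    moreover from this have "real n < norm (state P w t)" by simp
    ultimately show ?thesis by blast
  qed
  then obtain wn where wn: "\<And>n. wn n \<in> embedded_controls P"
    and big: "\<And>n. \<exists>t\<in>{0..T}. real n < norm (state P (wn n) t)" by metis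
  obtain Bz where Bz: "0 \<le> Bz" "\<And>a i. a \<in> coord_values \<Longrightarrow> i \<in> {1..modes P} \<Longrightarrow> norm (a i) \<le> Bz"
    using coord_values_bounded by blast
  define z where "z = (\<lambda>n s. coord (wn n s))"
  have zC: "z n s \<in> coord_values" if "s \<in> {0..T}" for n s
    using embedded_controls_values[OF wn that] unfolding z_def coord_values_def by blast
  have zm: "(\<lambda>s. z n s i) \<in> borel_measurable (lebesgue_on {0..T})" if i: "i \<in> {1..modes P}" for n i
  proof -
    have "(\<lambda>s. wn n s i) \<in> borel_measurable (lebesgue_on {0..T})"
      using wn[of n] i by (simp add: embedded_controls_def)
    then show ?thesis unfolding z_def coord_def
      by (intro borel_measurable_Pair borel_measurable_scaleR borel_measurable_fst_snd)
  qed
  have "\<exists>r \<zeta>. strict_mono (r :: nat \<Rightarrow> nat) \<and> (\<forall>s\<in>{0..T}. \<zeta> s \<in> coord_values) \<and>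
     (\<forall>i\<in>{1..modes P}. (\<lambda>s. \<zeta> s i) \<in> borel_measurable (lebesgue_on {0..T})) \<and>
     (\<forall>i\<in>{1..modes P}. \<forall>e>0. \<exists>N. \<forall>n\<ge>N. \<forall>t\<in>{0..T}. norm (integral {0..t} (\<lambda>s. z (r n) s i - \<zeta> s i)) < e)"
  proof (rule weak_sequential_compactness[where C=coord_values and I="{1..modes P}" and B=Bz and z=z])
    show "l \<in> coord_values" if "\<And>n::nat. a n \<in> coord_values" "\<And>i. i \<in> {1..modes P} \<Longrightarrow> (\<lambda>n. a n i) \<longlonglongrightarrow> l i" for a l
      using that by (rule coord_values_closed)
    show "0 \<le> T" using horizon by simp
  qed (rule finite_atLeastAtMost coord_values_midpoint Bz(2) zC zm, assumption?, assumption?)+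
  then obtain r \<zeta> where r: "strict_mono (r :: nat \<Rightarrow> nat)" and \<zeta>C: "\<And>s. s \<in> {0..T} \<Longrightarrow> \<zeta> s \<in> coord_values"
    and \<zeta>m: "\<And>i. i \<in> {1..modes P} \<Longrightarrow> (\<lambda>s. \<zeta> s i) \<in> borel_measurable (lebesgue_on {0..T})"
    and weak: "\<And>i e. i \<in> {1..modes P} \<Longrightarrow> e > 0 \<Longrightarrow>
      \<exists>N. \<forall>n\<ge>N. \<forall>t\<in>{0..T}. norm (integral {0..t} (\<lambda>s. z (r n) s i - \<zeta> s i)) < e" by blast
  obtain w where w: "w \<in> embedded_controls P" and w\<zeta>: "\<And>s i. s \<in> {0..T} \<Longrightarrow> i \<in> {1..modes P} \<Longrightarrow> coord (w s) i = \<zeta> s i"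
    using control_of_coord[OF \<zeta>C \<zeta>m] by blast
  define x where "x = state P w"
  have xc: "continuous_on {0..T} x" unfolding x_def by (rule state_continuous[OF w])
  have "bounded (x ` {0..T})" using xc by (intro compact_imp_bounded compact_continuous_image) auto
  then obtain R0 where "R0 > 0" and R0: "\<And>s. s \<in> {0..T} \<Longrightarrow> norm (x s) \<le> R0" unfolding bounded_pos by blast
  define R where "R = R0 + 1"
  obtain B where "B > 0" and B: "\<And>v a b. v \<in> embedded_values P \<Longrightarrow> a \<in> cball 0 R \<Longrightarrow> b \<in> cball 0 R \<Longrightarrow>
      norm (avg_aug b v - avg_aug a v) \<le> B * norm (b - a)"
    using mean_aug_bounds[of R] by blast
  have vel_lip: "norm (velocity P b v - velocity P a v) \<le> B * norm (b - a)"
    if "v \<in> embedded_values P" "a \<in> cball 0 R" "b \<in> cball 0 R" for v a b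
    unfolding fst_mean_aug[symmetric] fst_diff[symmetric]
    by (rule order.trans[OF norm_fst_le' B[OF that]])
  \<comment> \<open>The choice of \<open>\<kappa>\<close> makes the Gronwall bound \<open>2 * \<kappa> * exp (2 * B * T)\<close> equal to \<open>1/4\<close>.\<close>
  define \<kappa> where "\<kappa> = inverse (8 * exp (2 * B * T))"
  have \<kappa>: "\<kappa> > 0" "2 * \<kappa> * exp (2 * B * T) < 1" by (auto simp: \<kappa>_def field_simps)
  define M where "M = real (modes P)"
  have M: "M > 0" using modes by (simp add: M_def)
  have "\<forall>\<^sub>F n in sequentially. \<forall>t\<in>{0..T}. norm (integral {0..t} (\<lambda>s. coord_field i (x s) (z (r n) s i - \<zeta> s i))) < \<kappa> / M"
    if i: "i \<in> {1..modes P}" for i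
  proof -
    obtain d where "d > 0" and d: "\<And>f. f \<in> borel_measurable (lebesgue_on {0..T}) \<Longrightarrow> (\<forall>s\<in>{0..T}. norm (f s) \<le> 2 * Bz) \<Longrightarrow>
      (\<forall>t\<in>{0..T}. norm (integral {0..t} f) < d) \<Longrightarrow>
      (\<forall>t\<in>{0..T}. norm (integral {0..t} (\<lambda>s. coord_field i (x s) (f s))) < \<kappa> / M)"
      using weak_null_against_continuous[OF horizon coord_field_continuous[OF i xc] divide_pos_pos[OF \<kappa>(1) M],
          of "2 * Bz"] Bz(1) by auto
    obtain N where N: "\<And>n. n \<ge> N \<Longrightarrow> \<forall>t\<in>{0..T}. norm (integral {0..t} (\<lambda>s. z (r n) s i - \<zeta> s i)) < d"
      using weak[OF i \<open>d > 0\<close>] by blast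
    have "\<forall>t\<in>{0..T}. norm (integral {0..t} (\<lambda>s. coord_field i (x s) (z (r n) s i - \<zeta> s i))) < \<kappa> / M" if "n \<ge> N" for n
    proof (rule d[OF _ _ N[OF that]])
      show "(\<lambda>s. z (r n) s i - \<zeta> s i) \<in> borel_measurable (lebesgue_on {0..T})"
        by (intro borel_measurable_diff zm \<zeta>m i)
      show "\<forall>s\<in>{0..T}. norm (z (r n) s i - \<zeta> s i) \<le> 2 * Bz"
      proof
        fix s assume s: "s \<in> {0..T}"
        have "norm (z (r n) s i - \<zeta> s i) \<le> norm (z (r n) s i) + norm (\<zeta> s i)" by (rule norm_triangle_ineq4)
        also have "\<dots> \<le> 2 * Bz" using Bz(2)[OF zC[OF s] i, of "r n"] Bz(2)[OF \<zeta>C[OF s] i] by simp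
        finally show "norm (z (r n) s i - \<zeta> s i) \<le> 2 * Bz" .
      qed
    qed
    then show ?thesis unfolding eventually_sequentially by blast
  qed
  then have "\<forall>\<^sub>F n in sequentially. \<forall>i\<in>{1..modes P}. \<forall>t\<in>{0..T}.
      norm (integral {0..t} (\<lambda>s. coord_field i (x s) (z (r n) s i - \<zeta> s i))) < \<kappa> / M"
    by (intro eventually_ball_finite) auto
  then obtain N where N: "\<And>n i t. n \<ge> N \<Longrightarrow> i \<in> {1..modes P} \<Longrightarrow> t \<in> {0..T} \<Longrightarrow>
      norm (integral {0..t} (\<lambda>s. coord_field i (x s) (z (r n) s i - \<zeta> s i))) < \<kappa> / M"
    unfolding eventually_sequentially by blast
  obtain N' :: nat where N': "R < real N'" using reals_Archimedean2 by blast
  define n where "n = max N N'"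
  define w' where "w' = wn (r n)"
  have w': "w' \<in> embedded_controls P" by (simp add: w'_def wn)
  define y where "y = state P w'"
  have yc: "continuous_on {0..T} y" unfolding y_def by (rule state_continuous[OF w'])
  have q: "norm (integral {0..t} (\<lambda>s. velocity P (x s) (w' s) - velocity P (x s) (w s))) \<le> \<kappa>" if t: "t \<in> {0..T}" for t
  proof -
    have ci: "(\<lambda>s. coord_field i (x s) (z (r n) s i - \<zeta> s i)) integrable_on {0..t}" if i: "i \<in> {1..modes P}" for i
    proof -
      have "(\<lambda>s. coord_field i (x s) (z (r n) s i - \<zeta> s i)) absolutely_integrable_on {0..T}"
      proof (rule continuous_blinfun_apply_absolutely_integrable)
        show "(\<lambda>s. z (r n) s i - \<zeta> s i) \<in> borel_measurable (lebesgue_on {0..T})"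
          by (intro borel_measurable_diff zm \<zeta>m i)
        show "norm (z (r n) s i - \<zeta> s i) \<le> Bz + Bz" if s: "s \<in> {0..T}" for s
          by (intro order.trans[OF norm_triangle_ineq4] add_mono Bz(2) zC \<zeta>C s i)
      qed (rule coord_field_continuous[OF i xc])
      then show ?thesis using t by (rule integrable_on_initial)
    qed
    have "velocity P (x s) (w' s) - velocity P (x s) (w s) = (\<Sum>i=1..modes P. coord_field i (x s) (z (r n) s i - \<zeta> s i))"
      if s: "s \<in> {0..t}" for s
    proof -
      have s': "s \<in> {0..T}" using s t by auto
      have "velocity P (x s) (w' s) - velocity P (x s) (w s)
          = (\<Sum>i=1..modes P. coord_field i (x s) (coord (w' s) i) - coord_field i (x s) (coord (w s) i))"
        by (simp add: velocity_coord embedded_controls_values[OF w s'] embedded_controls_values[OF w' s'] sum_subtractf)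
      then show ?thesis by (simp add: blinfun.diff_right z_def w'_def w\<zeta>[OF s'])
    qed
    then have "integral {0..t} (\<lambda>s. velocity P (x s) (w' s) - velocity P (x s) (w s))
        = integral {0..t} (\<lambda>s. \<Sum>i=1..modes P. coord_field i (x s) (z (r n) s i - \<zeta> s i))"
      by (intro integral_cong) auto
    also have "\<dots> = (\<Sum>i=1..modes P. integral {0..t} (\<lambda>s. coord_field i (x s) (z (r n) s i - \<zeta> s i)))"
      using ci by (intro integral_sum) auto
    also have "norm \<dots> \<le> (\<Sum>i=1..modes P. \<kappa> / M)"
      using N[of n _ t] t by (intro sum_norm_le) (auto simp: n_def intro: less_imp_le)
    also have "\<dots> = \<kappa>" using M by (simp add: M_def)
    finally show ?thesis .
  qed
  have close: "norm (y t - x t) < 1" if t: "t \<in> {0..T}" for t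
  proof (rule bootstrap_bound[where c=1, OF _ _ _ _ t])
    show "continuous_on {0..T} (\<lambda>t. y t - x t)" by (intro continuous_intros xc yc)
    show "y 0 - x 0 = 0" using state_integral[OF w, of 0] state_integral[OF w', of 0] horizon by (simp add: x_def y_def)
    fix t assume t: "t \<in> {0..T}" and le1: "\<And>s. s \<in> {0..t} \<Longrightarrow> norm (y s - x s) \<le> 1"
    have "norm (y u - x u) \<le> \<kappa> + B * integral {0..u} (\<lambda>s. norm (y s - x s))" if u: "u \<in> {0..t}" for u
    proof -
      have u': "u \<in> {0..T}" using u t by auto
      note i1 = integrable_on_initial[OF velocity_integrable[OF w xc] u']
        and i2 = integrable_on_initial[OF velocity_integrable[OF w' yc] u']
        and i3 = integrable_on_initial[OF velocity_integrable[OF w' xc] u']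
      have "y u - x u = integral {0..u} (\<lambda>s. velocity P (y s) (w' s)) - integral {0..u} (\<lambda>s. velocity P (x s) (w s))"
        using state_integral[OF w u'] state_integral[OF w' u'] by (simp add: x_def y_def)
      also have "\<dots> = integral {0..u} (\<lambda>s. velocity P (x s) (w' s) - velocity P (x s) (w s))
          + integral {0..u} (\<lambda>s. velocity P (y s) (w' s) - velocity P (x s) (w' s))"
        by (simp add: integral_diff i1 i2 i3)
      also have "norm \<dots> \<le> \<kappa> + integral {0..u} (\<lambda>s. B * norm (y s - x s))"
      proof (rule norm_triangle_mono[OF q[OF u']])
        show "norm (integral {0..u} (\<lambda>s. velocity P (y s) (w' s) - velocity P (x s) (w' s))) \<le> integral {0..u} (\<lambda>s. B * norm (y s - x s))"
        proof (rule Henstock_Kurzweil_Integration.integral_norm_bound_integral)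
          show "(\<lambda>s. velocity P (y s) (w' s) - velocity P (x s) (w' s)) integrable_on {0..u}"
            by (intro integrable_diff i2 i3)
          show "(\<lambda>s. B * norm (y s - x s)) integrable_on {0..u}"
            using u' by (intro integrable_continuous_interval continuous_intros continuous_on_subset[OF xc] continuous_on_subset[OF yc]) auto
          fix s assume s: "s \<in> {0..u}"
          have s': "s \<in> {0..T}" "s \<in> {0..t}" using s u' u by auto
          have "norm (y s) \<le> norm (y s - x s) + norm (x s)" using norm_triangle_ineq[of "y s - x s" "x s"] by simp
          also have "\<dots> \<le> R" using le1[OF s'(2)] R0[OF s'(1)] by (simp add: R_def)
          finally show "norm (velocity P (y s) (w' s) - velocity P (x s) (w' s)) \<le> B * norm (y s - x s)"
            using R0[OF s'(1)] by (intro vel_lip embedded_controls_values[OF w' s'(1)]) (auto simp: R_def)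
        qed
      qed
      finally show ?thesis by simp
    qed
    moreover have "continuous_on {0..t} (\<lambda>s. norm (y s - x s))"
      using t by (intro continuous_intros continuous_on_subset[OF xc] continuous_on_subset[OF yc]) auto
    ultimately have "norm (y t - x t) \<le> 2 * \<kappa> * exp (2 * B * t)"
      using t \<kappa> \<open>B > 0\<close> by (intro gronwall_forward[where T=t]) auto
    also have "\<dots> \<le> 2 * \<kappa> * exp (2 * B * T)" using t \<kappa> \<open>B > 0\<close> by (intro mult_left_mono) auto
    also have "\<dots> < 1" by (rule \<kappa>)
    finally show "norm (y t - x t) < 1" .
  qed simp
  obtain t where t: "t \<in> {0..T}" "real (r n) < norm (y t)" using big[of "r n"] by (auto simp: y_def w'_def)
  have "norm (y t) \<le> norm (y t - x t) + norm (x t)" using norm_triangle_ineq[of "y t - x t" "x t"] by simp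
  also have "\<dots> < R" using close[OF t(1)] R0[OF t(1)] by (simp add: R_def)
  also have "R < real N'" by (rule N')
  also have "\<dots> \<le> real (r n)" using seq_suble[OF r, of n] by (simp add: n_def)
  finally show False using t by simp
qed

section \<open>Costates\<close>

definition costate_field :: "nat \<Rightarrow> real ^ 'n \<Rightarrow> real ^ 'n \<Rightarrow> real ^ 'k \<Rightarrow> real ^ 'n" where
  "costate_field i x p u = - (transpose (jacobian (\<lambda>y. dyn P i y u) (at x)) *v p + gradient (\<lambda>y. running_cost P i y u) x)"

lemma costate_rhs_mean: "costate_rhs P x w p = mean P (\<lambda>i u. costate_field i x p u) w"
  unfolding costate_rhs_def mean_def costate_field_def scaleR_minus_right sum_negf by (rule refl)

text \<open>
  The costate equation is adjoint to the linearization of the augmented field. All later uses of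
  \<open>costate_rhs\<close> go through this identity.
\<close>

lemma costate_field_inner:
  assumes i: "i \<in> {1..modes P}" and u: "u \<in> ctrl_set P i"
  shows "costate_field i x p u \<bullet> h = - ((p, 1) \<bullet> daug P i x u h)"
proof -
  have aug_der: "((\<lambda>y. aug P i y u) has_derivative daug P i x u) (at x)"
    using aug_C1[OF i] u by (simp add: C1_in_state_def)
  have dyn_der: "((\<lambda>y. dyn P i y u) has_derivative (\<lambda>h. fst (daug P i x u h))) (at x)"
    using has_derivative_fst[OF aug_der] by (simp add: aug_def)
  have lin: "bounded_linear (frechet_derivative (\<lambda>y. dyn P i y u) (at x))"
    unfolding frechet_derivative_at[OF dyn_der, symmetric] by (rule has_derivative_bounded_linear[OF dyn_der])
  have "bounded_linear (\<lambda>h. (frechet_derivative (\<lambda>y. dyn P i y u) (at x) h, gradient (\<lambda>y. running_cost P i y u) x \<bullet> h))"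
    by (intro bounded_linear_Pair lin bounded_linear_inner_right)
  then have app: "daug P i x u h = (frechet_derivative (\<lambda>y. dyn P i y u) (at x) h, gradient (\<lambda>y. running_cost P i y u) x \<bullet> h)"
    unfolding daug_def by (simp add: bounded_linear_Blinfun_apply)
  have "(transpose (jacobian (\<lambda>y. dyn P i y u) (at x)) *v p) \<bullet> h = p \<bullet> frechet_derivative (\<lambda>y. dyn P i y u) (at x) h"
    unfolding frechet_derivative_at[OF jacobian_works[THEN iffD1, OF differentiableI[OF dyn_der]], symmetric]
    by (simp add: dot_lmul_matrix)
  then show ?thesis by (simp add: costate_field_def app inner_add_left inner_diff_left)
qed

lemma costate_field_continuous:
  assumes i: "i \<in> {1..modes P}"
  shows "continuous_on (UNIV \<times> ctrl_set P i) (\<lambda>z. costate_field i (fst (fst z)) (snd (fst z)) (snd z))"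
  unfolding continuous_on_componentwise[where f="\<lambda>z. costate_field i (fst (fst z)) (snd (fst z)) (snd z)"]
proof
  fix b :: "real ^ 'n"
  have "continuous_on (UNIV \<times> ctrl_set P i) (\<lambda>(x, u). daug P i x u)" using aug_C1[OF i] by (simp add: C1_in_state_def)
  then have "continuous_on (UNIV \<times> ctrl_set P i) (\<lambda>z. (case (fst (fst z), snd z) of (x, u) \<Rightarrow> daug P i x u))"
    by (rule continuous_on_compose2[where f="\<lambda>z. (fst (fst z), snd z)"]) (auto intro!: continuous_intros)
  then have "continuous_on (UNIV \<times> ctrl_set P i) (\<lambda>z. - ((snd (fst z), 1) \<bullet> daug P i (fst (fst z)) (snd z) b))"
    by (intro continuous_intros) auto
  then show "continuous_on (UNIV \<times> ctrl_set P i) (\<lambda>z. costate_field i (fst (fst z)) (snd (fst z)) (snd z) \<bullet> b)"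
    by (rule continuous_on_eq) (auto simp: costate_field_inner[OF i])
qed

lemma costate_rhs_inner:
  assumes "w \<in> embedded_values P"
  shows "costate_rhs P x w p \<bullet> h = - ((p, 1) \<bullet> avg_daug x w h)"
proof -
  have "costate_rhs P x w p \<bullet> h = (\<Sum>i=1..modes P. fst (w i) * (costate_field i x p (snd (w i)) \<bullet> h))"
    by (simp add: costate_rhs_mean mean_def inner_sum_left)
  also have "\<dots> = (\<Sum>i=1..modes P. fst (w i) * - ((p, 1) \<bullet> daug P i x (snd (w i)) h))"
    using assms by (intro sum.cong refl arg_cong2[where f="(*)"] costate_field_inner) (auto simp: embedded_values_def)
  also have "\<dots> = - ((p, 1) \<bullet> avg_daug x w h)"
    by (simp add: mean_def blinfun.sum_left blinfun.scaleR_left inner_sum_right sum_negf del: inner_Pair)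
  finally show ?thesis .
qed

lemma costate_rhs_integrable:
  assumes "w \<in> embedded_controls P" "continuous_on {0..T} x" "continuous_on {0..T} p"
  shows "(\<lambda>s. costate_rhs P (x s) (w s) (p s)) absolutely_integrable_on {0..T}"
  using mean_absolutely_integrable[OF assms(1), of "\<lambda>s. (x s, p s)" "\<lambda>i z. costate_field i (fst (fst z)) (snd (fst z)) (snd z)",
      OF _ costate_field_continuous ctrl_compact] assms(2,3)
  by (simp add: costate_rhs_mean continuous_on_Pair)

lemma costate_rhs_bounds:
  assumes w: "w \<in> embedded_values P" and B: "norm (avg_daug x w) \<le> B"
  shows "norm (costate_rhs P x w p - costate_rhs P x w q) \<le> B * norm (p - q)"
    and "norm (costate_rhs P x w p) \<le> B * (norm p + 1)"
proof -
  let ?D = "avg_daug x w"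
  have B0: "0 \<le> B" using B norm_ge_zero order.trans by blast
  have D: "norm (?D h) \<le> B * norm h" for h
    using B by (intro order.trans[OF norm_blinfun] mult_right_mono) auto
  show "norm (costate_rhs P x w p - costate_rhs P x w q) \<le> B * norm (p - q)"
  proof (rule norm_le_if_inner_le)
    fix h
    have "(costate_rhs P x w p - costate_rhs P x w q) \<bullet> h = (q - p, 0) \<bullet> ?D h"
      by (simp add: inner_diff_left costate_rhs_inner[OF w] inner_prod_def)
    also have "\<dots> \<le> norm (q - p, 0::real) * norm (?D h)" by (rule norm_cauchy_schwarz)
    also have "\<dots> \<le> norm (p - q) * (B * norm h)" using D by (intro mult_mono) (auto simp: norm_Pair norm_minus_commute)
    finally show "(costate_rhs P x w p - costate_rhs P x w q) \<bullet> h \<le> B * norm (p - q) * norm h" by (simp add: mult_ac)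
  qed (use B0 in simp)
  show "norm (costate_rhs P x w p) \<le> B * (norm p + 1)"
  proof (rule norm_le_if_inner_le)
    fix h
    have "costate_rhs P x w p \<bullet> h = (- p, - 1) \<bullet> ?D h"
      by (simp add: costate_rhs_inner[OF w] inner_prod_def)
    also have "\<dots> \<le> norm (- p, - 1::real) * norm (?D h)" by (rule norm_cauchy_schwarz)
    also have "\<dots> \<le> (norm p + 1) * (B * norm h)"
      using D norm_Pair_le[of "- p" "- 1::real"] by (intro mult_mono) auto
    finally show "costate_rhs P x w p \<bullet> h \<le> B * (norm p + 1) * norm h" by (simp add: mult_ac)
  qed (use B0 in simp)
qed
lemma is_costate_iff:
  assumes w: "w \<in> embedded_controls P"
  shows "is_costate P w p \<longleftrightarrow> continuous_on {0..T} p \<and>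
     (\<forall>t\<in>{0..T}. p t = gradient (final_cost P) (state P w T)
        - integral {t..T} (\<lambda>s. costate_rhs P (state P w s) (w s) (p s)))"
proof -
  have "(LINT s:{t..T}|lebesgue. costate_rhs P (state P w s) (w s) (p s))
      = integral {t..T} (\<lambda>s. costate_rhs P (state P w s) (w s) (p s))"
    if "continuous_on {0..T} p" "t \<in> {0..T}" for t
    using that by (intro set_lebesgue_integral_eq_integral(2) absolutely_integrable_on_subinterval[OF
          costate_rhs_integrable[OF w state_continuous[OF w] that(1)]]) auto
  then show ?thesis
    unfolding is_costate_def using costate_rhs_integrable[OF w state_continuous[OF w]] by (simp cong: conj_cong)
qed

text \<open>
  The costate equation is linear in the costate with coefficients that are bounded along the state and
  measurable in time.
\<close>

lemma costate_exists:
  assumes w: "w \<in> embedded_controls P"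
  shows "\<exists>p. is_costate P w p"
proof -
  obtain R where R: "\<And>t. t \<in> {0..T} \<Longrightarrow> norm (state P w t) \<le> R" using states_bounded w by blast
  obtain B where "B > 0" and B: "\<And>v x. v \<in> embedded_values P \<Longrightarrow> x \<in> cball 0 R \<Longrightarrow> norm (avg_daug x v) \<le> B"
    using mean_aug_bounds[of R] by blast
  obtain p where "continuous_on {0..T} p" "\<And>t. t \<in> {0..T} \<Longrightarrow> p t = gradient (final_cost P) (state P w T)
        - integral {t..T} (\<lambda>s. costate_rhs P (state P w s) (w s) (p s))"
  proof (rule picard_backward[of T B "\<lambda>s p. costate_rhs P (state P w s) (w s) p" "gradient (final_cost P) (state P w T)"])
    show "(\<lambda>s. costate_rhs P (state P w s) (w s) (p s)) integrable_on {0..T}" if "continuous_on {0..T} p" for p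
      by (intro set_lebesgue_integral_eq_integral(1) costate_rhs_integrable w state_continuous that)
    show "norm (costate_rhs P (state P w s) (w s) y - costate_rhs P (state P w s) (w s) z) \<le> B * norm (y - z)"
      if s: "s \<in> {0..T}" for s y z
      using R[OF s] by (intro costate_rhs_bounds(1) embedded_controls_values[OF w s] B) auto
  qed (use horizon \<open>B > 0\<close> in auto)
  then show ?thesis unfolding is_costate_iff[OF w] by blast
qed

lemma costate_continuous: "w \<in> embedded_controls P \<Longrightarrow> continuous_on {0..T} (costate P w)"
  and costate_integral: "w \<in> embedded_controls P \<Longrightarrow> t \<in> {0..T} \<Longrightarrow>
     costate P w t = gradient (final_cost P) (state P w T)
        - integral {t..T} (\<lambda>s. costate_rhs P (state P w s) (w s) (costate P w s))"
  using someI_ex[OF costate_exists] is_costate_iff unfolding costate_def[symmetric] by blast+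

lemma costates_bounded: "\<exists>Q>0. \<forall>w\<in>embedded_controls P. \<forall>t\<in>{0..T}. norm (costate P w t) \<le> Q"
proof -
  obtain R where R: "\<And>w t. w \<in> embedded_controls P \<Longrightarrow> t \<in> {0..T} \<Longrightarrow> norm (state P w t) \<le> R"
    using states_bounded by blast
  obtain B where "B > 0" and B: "\<And>v x. v \<in> embedded_values P \<Longrightarrow> x \<in> cball 0 R \<Longrightarrow> norm (avg_daug x v) \<le> B"
    using mean_aug_bounds[of R] by blast
  have "continuous_on (cball 0 R) (gradient (final_cost P))"
    using final_C1 by (auto simp: C1_scalar_def intro: continuous_on_subset)
  then have "bounded (gradient (final_cost P) ` cball 0 R)" by (intro compact_imp_bounded compact_continuous_image) auto
  then obtain G where "G > 0" and G: "\<And>x. x \<in> cball 0 R \<Longrightarrow> norm (gradient (final_cost P) x) \<le> G" unfolding bounded_pos by blast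
  define Q where "Q = 2 * (G + B * T) * exp (2 * B * T)"
  have "norm (costate P w t) \<le> Q" if w: "w \<in> embedded_controls P" and t: "t \<in> {0..T}" for w t
    unfolding Q_def
  proof (rule gronwall_backward[OF _ \<open>B > 0\<close> _ _ t])
    let ?r = "\<lambda>s. costate_rhs P (state P w s) (w s) (costate P w s)"
    show "continuous_on {0..T} (\<lambda>t. norm (costate P w t))" by (intro continuous_intros costate_continuous w)
    show "0 \<le> G + B * T" using \<open>G > 0\<close> \<open>B > 0\<close> horizon by simp
    fix t assume t: "t \<in> {0..T}"
    have T: "T \<in> {0..T}" using horizon by simp
    have ni: "(\<lambda>s. norm (costate P w s)) integrable_on {t..T}"
      using t by (intro integrable_continuous_interval continuous_intros continuous_on_subset[OF costate_continuous[OF w]]) auto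
    have "norm (integral {t..T} ?r) \<le> integral {t..T} (\<lambda>s. B * (norm (costate P w s) + 1))"
    proof (rule Henstock_Kurzweil_Integration.integral_norm_bound_integral)
      show "?r integrable_on {t..T}"
        using t by (intro integrable_subinterval_real[OF set_lebesgue_integral_eq_integral(1)[OF
              costate_rhs_integrable[OF w state_continuous[OF w] costate_continuous[OF w]]]]) auto
      show "(\<lambda>s. B * (norm (costate P w s) + 1)) integrable_on {t..T}"
        by (intro integrable_on_mult_right integrable_add ni) auto
      fix s assume s: "s \<in> {t..T}"
      then have s': "s \<in> {0..T}" using t by auto
      show "norm (?r s) \<le> B * (norm (costate P w s) + 1)"
        using R[OF w s'] by (intro costate_rhs_bounds(2) embedded_controls_values[OF w s'] B) auto
    qed
    also have "\<dots> = B * (integral {t..T} (\<lambda>s. norm (costate P w s)) + (T - t))"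
      using t integral_add[OF ni integrable_const_ivl[of 1]] by simp
    also have "\<dots> \<le> B * (integral {t..T} (\<lambda>s. norm (costate P w s)) + T)"
      using t \<open>B > 0\<close> by (intro mult_left_mono) auto
    finally have "norm (integral {t..T} ?r) \<le> B * T + B * integral {t..T} (\<lambda>s. norm (costate P w s))"
      by (simp add: algebra_simps)
    moreover have "norm (costate P w t) \<le> norm (gradient (final_cost P) (state P w T)) + norm (integral {t..T} ?r)"
      unfolding costate_integral[OF w t] by (rule norm_triangle_ineq4)
    moreover have "norm (gradient (final_cost P) (state P w T)) \<le> G" using R[OF w T] by (intro G) auto
    ultimately show "norm (costate P w t) \<le> (G + B * T) + B * integral {t..T} (\<lambda>s. norm (costate P w s))" by simp
  qed
  moreover have "Q > 0" unfolding Q_def using \<open>G > 0\<close> \<open>B > 0\<close> horizon by (intro mult_pos_pos add_pos_pos) auto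
  ultimately show ?thesis by blast
qed

section \<open>The first-order expansion of the cost\<close>

text \<open>
  The final cost is treated as a field with a single dummy control value, so that
  \<open>C1_in_state_linearization\<close> applies.
\<close>

lemma final_cost_linearization:
  assumes "e > 0"
  shows "\<exists>d>0. \<forall>x\<in>cball 0 R. \<forall>y\<in>cball 0 R. norm (y - x) < d \<longrightarrow>
     final_cost P y - final_cost P x \<le> gradient (final_cost P) x \<bullet> (y - x) + e * norm (y - x)"
proof -
  have gc: "continuous_on UNIV (gradient (final_cost P))" using final_C1 by (simp add: C1_scalar_def)
  have "C1_in_state {0::real} (\<lambda>x u. final_cost P x) (\<lambda>x u. blinfun_inner_right (gradient (final_cost P) x))"
    unfolding C1_in_state_def
  proof (intro conjI allI ballI)
    have "continuous_on UNIV (final_cost P)"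
      using has_derivative_continuous_on[OF C1_scalar_gradient[OF final_C1]] by blast
    from continuous_on_compose2[OF this continuous_on_fst[OF continuous_on_id]]
    show "continuous_on (UNIV \<times> {0}) (\<lambda>(x, u :: real). final_cost P x)" by (simp add: case_prod_beta')
    have "continuous_on (UNIV \<times> {0}) (\<lambda>z :: (real ^ 'n) \<times> real. gradient (final_cost P) (fst z))"
      using continuous_on_compose2[OF gc continuous_on_fst[OF continuous_on_id]] by simp
    then show "continuous_on (UNIV \<times> {0}) (\<lambda>(x, u :: real). blinfun_inner_right (gradient (final_cost P) x))"
      unfolding case_prod_beta' by (rule bounded_linear.continuous_on[OF bounded_linear_blinfun_inner_right])
    show "(final_cost P has_derivative blinfun_inner_right (gradient (final_cost P) x)) (at x)" for x
      using C1_scalar_gradient[OF final_C1] by simp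
  qed
  from C1_in_state_linearization[OF this _ assms, of R] obtain d where "d > 0" and
    d: "\<And>x y. x \<in> cball 0 R \<Longrightarrow> y \<in> cball 0 R \<Longrightarrow> norm (y - x) < d \<Longrightarrow>
      norm (final_cost P y - final_cost P x - gradient (final_cost P) x \<bullet> (y - x)) \<le> e * norm (y - x)" by auto
  have "final_cost P y - final_cost P x \<le> gradient (final_cost P) x \<bullet> (y - x) + e * norm (y - x)"
    if "x \<in> cball 0 R" "y \<in> cball 0 R" "norm (y - x) < d" for x y
    using d[OF that] by (simp add: abs_le_iff)
  with \<open>d > 0\<close> show ?thesis by blast
qed

lemma mean_aug_linearization:
  assumes "e > 0"
  shows "\<exists>d>0. \<forall>w\<in>embedded_values P. \<forall>x\<in>cball 0 R. \<forall>y\<in>cball 0 R. norm (y - x) < d \<longrightarrow>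
     norm (avg_aug y w - avg_aug x w - avg_daug x w (y - x)) \<le> e * norm (y - x)"
proof -
  obtain d where "d > 0" and d: "\<And>i x y u. i \<in> {1..modes P} \<Longrightarrow> x \<in> cball 0 R \<Longrightarrow> y \<in> cball 0 R \<Longrightarrow> u \<in> ctrl_set P i \<Longrightarrow>
     norm (y - x) < d \<Longrightarrow> norm (aug P i y u - aug P i x u - daug P i x u (y - x)) \<le> e * norm (y - x)"
    using aug_linearization[OF assms, of R] by blast
  have "norm (avg_aug y w - avg_aug x w - avg_daug x w (y - x)) \<le> e * norm (y - x)"
    if w: "w \<in> embedded_values P" and "x \<in> cball 0 R" "y \<in> cball 0 R" "norm (y - x) < d" for w x y
  proof -
    have "avg_daug x w (y - x) = mean P (\<lambda>i u. daug P i x u (y - x)) w"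
      by (simp add: mean_def blinfun.sum_left blinfun.scaleR_left)
    then have "avg_aug y w - avg_aug x w - avg_daug x w (y - x)
        = mean P (\<lambda>i u. aug P i y u - aug P i x u - daug P i x u (y - x)) w"
      by (simp only: mean_diff)
    then show ?thesis using d that by (simp only:) (intro mean_norm_le[OF w], blast)
  qed
  with \<open>d > 0\<close> show ?thesis by blast
qed

lemma ham_embedded_aug: "ham_embedded P x w p = (p, 1) \<bullet> avg_aug x w"
  by (simp add: ham_embedded_def mean_def ham_def aug_def inner_sum_right inner_prod_def fst_sum snd_sum sum.distrib distrib_left)
lemma mix_trajectory:
  assumes w: "w \<in> embedded_controls P" and ws: "ws \<in> embedded_controls P" and l: "0 \<le> l" "l \<le> 1"
    and t: "t \<in> {0..T}"
  defines "y \<equiv> mix_state P l w ws"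
  shows "y t = init P + integral {0..t} (\<lambda>s. (1 - l) *\<^sub>R velocity P (y s) (w s) + l *\<^sub>R velocity P (y s) (ws s))"
proof -
  have y: "y = state P (update l w ws)" unfolding y_def by (rule mix_state_eq[OF w ws l])
  have "y t = init P + integral {0..t} (\<lambda>s. velocity P (y s) (update l w ws s))"
    unfolding y by (rule state_integral[OF update_embedded[OF w ws l] t])
  also have "integral {0..t} (\<lambda>s. velocity P (y s) (update l w ws s))
      = integral {0..t} (\<lambda>s. (1 - l) *\<^sub>R velocity P (y s) (w s) + l *\<^sub>R velocity P (y s) (ws s))"
    using t by (intro integral_cong velocity_update[OF w ws l]) auto
  finally show ?thesis .
qed

text \<open>
  Both velocities agree up to a Lipschitz term in the deviation and a term of size \<open>2 * B * l\<close>
  caused by the admixture of \<open>ws\<close>.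
\<close>

lemma mix_deviation:
  "\<exists>C>0. \<forall>w\<in>embedded_controls P. \<forall>ws\<in>embedded_controls P. \<forall>l\<in>{0..1}. \<forall>t\<in>{0..T}.
     norm (mix_state P l w ws t - state P w t) \<le> C * l"
proof -
  obtain R where R: "\<And>w t. w \<in> embedded_controls P \<Longrightarrow> t \<in> {0..T} \<Longrightarrow> norm (state P w t) \<le> R"
    using states_bounded by blast
  obtain B where "B > 0" and B: "\<And>v a b. v \<in> embedded_values P \<Longrightarrow> a \<in> cball 0 R \<Longrightarrow> b \<in> cball 0 R \<Longrightarrow>
      norm (avg_aug b v - avg_aug a v) \<le> B * norm (b - a)"
    and Bb: "\<And>v a. v \<in> embedded_values P \<Longrightarrow> a \<in> cball 0 R \<Longrightarrow> norm (avg_aug a v) \<le> B"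
    using mean_aug_bounds[of R] by blast
  have vel_lip: "norm (velocity P b v - velocity P a v) \<le> B * norm (b - a)"
    if "v \<in> embedded_values P" "a \<in> cball 0 R" "b \<in> cball 0 R" for v a b
    unfolding fst_mean_aug[symmetric] fst_diff[symmetric] by (rule order.trans[OF norm_fst_le' B[OF that]])
  have vel_b: "norm (velocity P a v) \<le> B" if "v \<in> embedded_values P" "a \<in> cball 0 R" for v a
    unfolding fst_mean_aug[symmetric] by (rule order.trans[OF norm_fst_le' Bb[OF that]])
  define C where "C = 2 * (2 * B * T) * exp (2 * B * T)"
  have "norm (mix_state P l w ws t - state P w t) \<le> C * l"
    if w: "w \<in> embedded_controls P" and ws: "ws \<in> embedded_controls P" and l: "l \<in> {0..1}" and t: "t \<in> {0..T}" for w ws l t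
  proof -
    define x y where "x = state P w" and "y = mix_state P l w ws"
    have l': "0 \<le> l" "l \<le> 1" using l by auto
    have y: "y = state P (update l w ws)" unfolding y_def by (rule mix_state_eq[OF w ws l'])
    have xc: "continuous_on {0..T} x" unfolding x_def by (rule state_continuous[OF w])
    have yc: "continuous_on {0..T} y" unfolding y by (rule state_continuous[OF update_embedded[OF w ws l']])
    have xR: "x s \<in> cball 0 R" if "s \<in> {0..T}" for s using R[OF w that] by (simp add: x_def)
    have yR: "y s \<in> cball 0 R" if "s \<in> {0..T}" for s using R[OF update_embedded[OF w ws l'] that] by (simp add: y)
    define g where "g = (\<lambda>s. ((1 - l) *\<^sub>R velocity P (y s) (w s) + l *\<^sub>R velocity P (y s) (ws s)) - velocity P (x s) (w s))"
    have "norm (y t - x t) \<le> 2 * (2 * B * T * l) * exp (2 * B * T)"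
    proof (rule gronwall_forward[OF _ \<open>B > 0\<close> _ _ t])
      show "continuous_on {0..T} (\<lambda>t. norm (y t - x t))" by (intro continuous_intros xc yc)
      show "0 \<le> 2 * B * T * l" using \<open>B > 0\<close> horizon l' by simp
      fix t assume t: "t \<in> {0..T}"
      note i1 = integrable_on_initial[OF velocity_integrable[OF w xc] t]
        and i2 = integrable_on_initial[OF velocity_integrable[OF w yc] t]
        and i3 = integrable_on_initial[OF velocity_integrable[OF ws yc] t]
      have imix: "(\<lambda>s. (1 - l) *\<^sub>R velocity P (y s) (w s) + l *\<^sub>R velocity P (y s) (ws s)) integrable_on {0..t}"
        by (intro integrable_add integrable_cmul i2 i3)
      have ni: "(\<lambda>s. norm (y s - x s)) integrable_on {0..t}"
        using t by (intro integrable_continuous_interval continuous_intros continuous_on_subset[OF xc] continuous_on_subset[OF yc]) auto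
      have "y t - x t = integral {0..t} g"
        unfolding g_def integral_diff[OF imix i1]
        using mix_trajectory[OF w ws l' t] state_integral[OF w t] by (simp add: x_def y_def)
      also have "norm \<dots> \<le> integral {0..t} (\<lambda>s. B * norm (y s - x s) + 2 * B * l)"
      proof (rule Henstock_Kurzweil_Integration.integral_norm_bound_integral)
        show "g integrable_on {0..t}" unfolding g_def by (intro integrable_diff imix i1)
        show "(\<lambda>s. B * norm (y s - x s) + 2 * B * l) integrable_on {0..t}"
          by (intro integrable_add integrable_on_mult_right ni) auto
        fix s assume s: "s \<in> {0..t}"
        then have s': "s \<in> {0..T}" using t by auto
        have "g s = (velocity P (y s) (w s) - velocity P (x s) (w s)) + l *\<^sub>R (velocity P (y s) (ws s) - velocity P (y s) (w s))"
          by (simp add: g_def algebra_simps)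
        also have "norm \<dots> \<le> B * norm (y s - x s) + l * (B + B)"
        proof (rule norm_triangle_mono)
          show "norm (velocity P (y s) (w s) - velocity P (x s) (w s)) \<le> B * norm (y s - x s)"
            by (intro vel_lip embedded_controls_values[OF w s'] xR yR s')
          have "norm (velocity P (y s) (ws s) - velocity P (y s) (w s)) \<le> B + B"
            by (intro order.trans[OF norm_triangle_ineq4] add_mono vel_b embedded_controls_values[OF w s'] embedded_controls_values[OF ws s'] yR s')
          then show "norm (l *\<^sub>R (velocity P (y s) (ws s) - velocity P (y s) (w s))) \<le> l * (B + B)"
            using l' by (simp add: mult_left_mono)
        qed
        finally show "norm (g s) \<le> B * norm (y s - x s) + 2 * B * l" by (simp add: algebra_simps)
      qed
      also have "\<dots> = B * integral {0..t} (\<lambda>s. norm (y s - x s)) + 2 * B * l * t"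
        using t integral_add[OF integrable_on_mult_right[OF ni, of B] integrable_const_ivl[of "2 * B * l"]] by simp
      also have "2 * B * l * t \<le> 2 * B * T * l"
        using t l' \<open>B > 0\<close> mult_left_mono[of t T "2 * B * l"] by (simp add: mult_ac)
      finally show "norm (y t - x t) \<le> 2 * B * T * l + B * integral {0..t} (\<lambda>s. norm (y s - x s))" by simp
    qed
    then show ?thesis by (simp add: C_def x_def y_def mult_ac)
  qed
  moreover have "C > 0" unfolding C_def using \<open>B > 0\<close> horizon by simp
  ultimately show ?thesis by blast
qed

text \<open>
  An exact identity: the difference of the running costs is the integral of \<open>snd (D s)\<close>, and
  integration by parts turns \<open>p T \<bullet> (y T - x T)\<close> into integrals of \<open>fst (D s)\<close>
  and of the linearized field along the deviation. What remains outside the integral is the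
  linearization error of the final cost.
\<close>

lemma mix_cost_variation:
  assumes w: "w \<in> embedded_controls P" and ws: "ws \<in> embedded_controls P" and l: "0 \<le> l" "l \<le> 1"
  defines "x \<equiv> state P w" and "y \<equiv> mix_state P l w ws" and "p \<equiv> costate P w"
  defines "D \<equiv> \<lambda>s. (1 - l) *\<^sub>R avg_aug (y s) (w s) + l *\<^sub>R avg_aug (y s) (ws s)
      - avg_aug (x s) (w s)"
  defines "F \<equiv> \<lambda>s. (p s, 1) \<bullet> (D s - avg_daug (x s) (w s) (y s - x s))"
  shows "F integrable_on {0..T}"
    and "mix_cost P l w ws - cost P w = integral {0..T} F
      + (final_cost P (y T) - final_cost P (x T) - gradient (final_cost P) (x T) \<bullet> (y T - x T))"
proof -
  have y: "y = state P (update l w ws)" unfolding y_def by (rule mix_state_eq[OF w ws l])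
  have xc: "continuous_on {0..T} x" unfolding x_def by (rule state_continuous[OF w])
  have yc: "continuous_on {0..T} y" unfolding y by (rule state_continuous[OF update_embedded[OF w ws l]])
  have pc: "continuous_on {0..T} p" unfolding p_def by (rule costate_continuous[OF w])
  obtain R where R: "\<And>v t. v \<in> embedded_controls P \<Longrightarrow> t \<in> {0..T} \<Longrightarrow> norm (state P v t) \<le> R"
    using states_bounded by blast
  obtain Q where Q: "\<And>t. t \<in> {0..T} \<Longrightarrow> norm (p t) \<le> Q" using costates_bounded w unfolding p_def by blast
  obtain B where "B > 0" and Bb: "\<And>v a. v \<in> embedded_values P \<Longrightarrow> a \<in> cball 0 R \<Longrightarrow>
      norm (avg_aug a v) \<le> B \<and> norm (avg_daug a v) \<le> B"
    using mean_aug_bounds[of R] by blast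
  define r where "r = (\<lambda>s. costate_rhs P (x s) (w s) (p s))"
  have Dint: "D absolutely_integrable_on {0..T}" unfolding D_def
    by (intro set_integral_diff set_integral_add absolutely_integrable_scaleR_left mean_aug_integrable w ws xc yc)
  have D1: "fst (D s) = (1 - l) *\<^sub>R velocity P (y s) (w s) + l *\<^sub>R velocity P (y s) (ws s) - velocity P (x s) (w s)" for s
    by (simp add: D_def fst_mean_aug)
  have D2: "snd (D s) = (1 - l) * mean P (\<lambda>i u. running_cost P i (y s) u) (w s) + l * mean P (\<lambda>i u. running_cost P i (y s) u) (ws s)
      - mean P (\<lambda>i u. running_cost P i (x s) u) (w s)" for s
    by (simp add: D_def snd_mean_aug)
  have D1int: "(\<lambda>s. fst (D s)) absolutely_integrable_on {0..T}" and D2int: "(\<lambda>s. snd (D s)) absolutely_integrable_on {0..T}"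
    using absolutely_integrable_linear[OF Dint bounded_linear_fst] absolutely_integrable_linear[OF Dint bounded_linear_snd]
    by (simp_all add: o_def)
  have rint: "r absolutely_integrable_on {0..T}" unfolding r_def by (rule costate_rhs_integrable[OF w xc pc])
  have h: "y t - x t = integral {0..t} (\<lambda>s. fst (D s))" if t: "t \<in> {0..T}" for t
  proof -
    note i1 = integrable_on_initial[OF velocity_integrable[OF w xc] t]
      and i2 = integrable_on_initial[OF velocity_integrable[OF w yc] t]
      and i3 = integrable_on_initial[OF velocity_integrable[OF ws yc] t]
    have imix: "(\<lambda>s. (1 - l) *\<^sub>R velocity P (y s) (w s) + l *\<^sub>R velocity P (y s) (ws s)) integrable_on {0..t}"
      by (intro integrable_add integrable_cmul i2 i3)
    show ?thesis unfolding D1 integral_diff[OF imix i1]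
      using mix_trajectory[OF w ws l t] state_integral[OF w t] by (simp add: x_def y_def)
  qed
  have p: "p t = gradient (final_cost P) (x T) - integral {t..T} r" if t: "t \<in> {0..T}" for t
    unfolding r_def p_def x_def by (rule costate_integral[OF w t])
  have T: "T \<in> {0..T}" using horizon by simp
  \<comment> \<open>Any common bound for the two integrands will do here.\<close>
  define c where "c = 3 * B + B * (Q + 1)"
  have Q0: "0 \<le> Q" using Q[OF T] norm_ge_zero order.trans by blast
  have byparts: "p T \<bullet> (y T - x T) = integral {0..T} (\<lambda>s. p s \<bullet> fst (D s) + (y s - x s) \<bullet> r s)"
  proof (rule inner_integral_by_parts[OF _ D1int rint, where C=c])
    fix s assume s: "s \<in> {0..T}"
    note wv = embedded_controls_values[OF w s] and wsv = embedded_controls_values[OF ws s]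
    have xR: "x s \<in> cball 0 R" using R[OF w s] by (simp add: x_def)
    have yR: "y s \<in> cball 0 R" using R[OF update_embedded[OF w ws l] s] by (simp add: y)
    have "norm (D s) \<le> ((1 - l) * B + l * B) + B" unfolding D_def
    proof (intro order.trans[OF norm_triangle_ineq4] add_mono order.trans[OF norm_triangle_ineq])
      show "norm ((1 - l) *\<^sub>R avg_aug (y s) (w s)) \<le> (1 - l) * B"
        using l Bb[OF wv yR] by (simp add: mult_left_mono)
      show "norm (l *\<^sub>R avg_aug (y s) (ws s)) \<le> l * B"
        using l Bb[OF wsv yR] by (simp add: mult_left_mono)
      show "norm (avg_aug (x s) (w s)) \<le> B" using Bb[OF wv xR] by simp
    qed
    then have "norm (D s) \<le> 2 * B" by (simp add: algebra_simps)
    then show "norm (fst (D s)) \<le> c"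
      using norm_fst_le'[of "D s"] \<open>B > 0\<close> Q0 mult_nonneg_nonneg[of B "Q + 1"] unfolding c_def by linarith
    have "norm (r s) \<le> B * (norm (p s) + 1)" unfolding r_def using Bb[OF wv xR] by (intro costate_rhs_bounds(2)[OF wv]) auto
    also have "\<dots> \<le> B * (Q + 1)" using Q[OF s] \<open>B > 0\<close> by (intro mult_left_mono) auto
    finally show "norm (r s) \<le> c" using \<open>B > 0\<close> by (simp add: c_def)
  qed (use horizon h p in auto)
  have Feq: "F s = (p s \<bullet> fst (D s) + (y s - x s) \<bullet> r s) + snd (D s)" if s: "s \<in> {0..T}" for s
  proof -
    have "(y s - x s) \<bullet> r s = - ((p s, 1) \<bullet> avg_daug (x s) (w s) (y s - x s))"
      unfolding r_def by (subst inner_commute) (rule costate_rhs_inner[OF embedded_controls_values[OF w s]])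
    moreover have "(p s, 1) \<bullet> D s = p s \<bullet> fst (D s) + snd (D s)" by (simp add: inner_prod_def)
    ultimately show ?thesis unfolding F_def inner_diff_right by linarith
  qed
  have i1: "(\<lambda>s. p s \<bullet> fst (D s) + (y s - x s) \<bullet> r s) integrable_on {0..T}"
    by (intro integrable_add set_lebesgue_integral_eq_integral(1) continuous_inner_absolutely_integrable continuous_intros D1int rint pc xc yc)
  note i2 = set_lebesgue_integral_eq_integral(1)[OF D2int]
  have "F integrable_on {0..T} \<longleftrightarrow> (\<lambda>s. (p s \<bullet> fst (D s) + (y s - x s) \<bullet> r s) + snd (D s)) integrable_on {0..T}"
    by (rule integrable_cong[OF Feq])
  then show "F integrable_on {0..T}" using integrable_add[OF i1 i2] by simp
  have "integral {0..T} F = p T \<bullet> (y T - x T) + integral {0..T} (\<lambda>s. snd (D s))"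
    using integral_cong[of "{0..T}" F, OF Feq] integral_add[OF i1 i2] byparts by simp
  moreover have "p T = gradient (final_cost P) (x T)" using p[OF T] by simp
  moreover have "integral {0..T} (\<lambda>s. snd (D s))
      = (1 - l) * running_total P y w + l * running_total P y ws - running_total P x w"
  proof -
    have ri: "(\<lambda>s. mean P (\<lambda>i u. running_cost P i (q s) u) (v s)) integrable_on {0..T}"
      if "v \<in> embedded_controls P" "continuous_on {0..T} q" for v q
      using set_lebesgue_integral_eq_integral(1)[OF absolutely_integrable_linear[OF mean_aug_integrable[OF that] bounded_linear_snd]]
      by (simp add: o_def snd_mean_aug)
    have "((\<lambda>s. snd (D s)) has_integral (1 - l) * running_total P y w + l * running_total P y ws - running_total P x w) {0..T}"
      unfolding D2 running_total_mean[OF w yc] running_total_mean[OF ws yc] running_total_mean[OF w xc]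
      by (intro has_integral_diff has_integral_add has_integral_mult_right integrable_integral ri w ws xc yc)
    then show ?thesis by (rule integral_unique)
  qed
  moreover have "mix_cost P l w ws = (1 - l) * running_total P y w + l * running_total P y ws + final_cost P (y T)"
    by (simp add: mix_cost_def y_def Let_def)
  moreover have "cost P w = running_total P x w + final_cost P (x T)" by (simp add: cost_def x_def)
  ultimately show "mix_cost P l w ws - cost P w = integral {0..T} F
      + (final_cost P (y T) - final_cost P (x T) - gradient (final_cost P) (x T) \<bullet> (y T - x T))"
    by simp
qed

text \<open>
  In \<open>mix_cost_variation\<close> the integrand equals \<open>l\<close> times the difference of the
  Hamiltonians plus two errors: \<open>E1\<close>, the linearization error of the field, which is
  \<open>o(l)\<close>, and \<open>l E2\<close>, where \<open>E2\<close> compares the fields at \<open>y\<close> and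
  \<open>x\<close>, which is \<open>O(l\<^sup>2)\<close>. All constants come from the balls that contain every
  state and every costate, so \<open>l0\<close> depends on \<open>e\<close> only.
\<close>

lemma uniform_first_order_estimate:
  assumes e: "e > 0"
  shows "\<exists>l0. 0 < l0 \<and> l0 \<le> 1 \<and> (\<forall>w\<in>embedded_controls P. \<forall>ws\<in>embedded_controls P. \<forall>l. 0 < l \<and> l \<le> l0 \<longrightarrow>
     mix_cost P l w ws - cost P w \<le> l * integral {0..T} (\<lambda>s. ham_embedded P (state P w s) (ws s) (costate P w s)
        - ham_embedded P (state P w s) (w s) (costate P w s)) + e * l)"
proof -
  obtain R where R: "\<And>v t. v \<in> embedded_controls P \<Longrightarrow> t \<in> {0..T} \<Longrightarrow> norm (state P v t) \<le> R"
    using states_bounded by blast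
  obtain Q where "Q > 0" and Q: "\<And>w t. w \<in> embedded_controls P \<Longrightarrow> t \<in> {0..T} \<Longrightarrow> norm (costate P w t) \<le> Q"
    using costates_bounded by blast
  obtain B where "B > 0" and B: "\<And>v a b. v \<in> embedded_values P \<Longrightarrow> a \<in> cball 0 R \<Longrightarrow> b \<in> cball 0 R \<Longrightarrow>
      norm (avg_aug b v - avg_aug a v) \<le> B * norm (b - a)"
    using mean_aug_bounds[of R] by blast
  obtain C where "C > 0" and C: "\<And>w ws l t. w \<in> embedded_controls P \<Longrightarrow> ws \<in> embedded_controls P \<Longrightarrow> l \<in> {0..1} \<Longrightarrow> t \<in> {0..T} \<Longrightarrow>
     norm (mix_state P l w ws t - state P w t) \<le> C * l" using mix_deviation by blast
  define K where "K = T * (Q + 1)"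
  have K: "K > 0" using horizon \<open>Q > 0\<close> by (simp add: K_def)
  \<comment> \<open>One third of \<open>e\<close> each for the final cost, the linearization error \<open>E1\<close> and the
    quadratic error \<open>l E2\<close>; the last bound on \<open>l0\<close> takes care of the third.\<close>
  define e1 e2 where "e1 = e / (3 * C)" and "e2 = e / (3 * K * C)"
  have e12: "e1 > 0" "e2 > 0" using e \<open>C > 0\<close> K by (auto simp: e1_def e2_def)
  obtain d1 where "d1 > 0" and d1: "\<And>x y. x \<in> cball 0 R \<Longrightarrow> y \<in> cball 0 R \<Longrightarrow> norm (y - x) < d1 \<Longrightarrow>
     final_cost P y - final_cost P x \<le> gradient (final_cost P) x \<bullet> (y - x) + e1 * norm (y - x)"
    using final_cost_linearization[OF e12(1), of R] by blast
  obtain d2 where "d2 > 0" and d2: "\<And>w x y. w \<in> embedded_values P \<Longrightarrow> x \<in> cball 0 R \<Longrightarrow> y \<in> cball 0 R \<Longrightarrow> norm (y - x) < d2 \<Longrightarrow>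
     norm (avg_aug y w - avg_aug x w - avg_daug x w (y - x)) \<le> e2 * norm (y - x)"
    using mean_aug_linearization[OF e12(2), of R] by blast
  define l0 where "l0 = min 1 (min (min (d1 / (2 * C)) (d2 / (2 * C))) (e / (6 * B * C * K)))"
  have l0: "0 < l0" "l0 \<le> 1" "l0 \<le> d1 / (2 * C)" "l0 \<le> d2 / (2 * C)" "l0 \<le> e / (6 * B * C * K)"
    using \<open>d1 > 0\<close> \<open>d2 > 0\<close> \<open>C > 0\<close> \<open>B > 0\<close> K e by (auto simp: l0_def)
  have "mix_cost P l w ws - cost P w \<le> l * integral {0..T} (\<lambda>s. ham_embedded P (state P w s) (ws s) (costate P w s)
        - ham_embedded P (state P w s) (w s) (costate P w s)) + e * l"
    if w: "w \<in> embedded_controls P" and ws: "ws \<in> embedded_controls P" and l: "0 < l" "l \<le> l0" for w ws l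
  proof -
    have l01: "0 \<le> l" "l \<le> 1" using l l0 by auto
    define x y p where "x = state P w" and "y = mix_state P l w ws" and "p = costate P w"
    have yu: "y = state P (update l w ws)" unfolding y_def by (rule mix_state_eq[OF w ws l01])
    have xc: "continuous_on {0..T} x" unfolding x_def by (rule state_continuous[OF w])
    have pc: "continuous_on {0..T} p" unfolding p_def by (rule costate_continuous[OF w])
    have xR: "x s \<in> cball 0 R" if "s \<in> {0..T}" for s using R[OF w that] by (simp add: x_def)
    have yR: "y s \<in> cball 0 R" if "s \<in> {0..T}" for s using R[OF update_embedded[OF w ws l01] that] by (simp add: yu)
    have hC: "norm (y s - x s) \<le> C * l" if "s \<in> {0..T}" for s
      using C[OF w ws _ that, of l] l01 by (simp add: x_def y_def)
    have small: "C * l < d1" "C * l < d2"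
    proof -
      have "C * l \<le> C * (d1 / (2 * C))" "C * l \<le> C * (d2 / (2 * C))"
        using \<open>C > 0\<close> by (intro mult_left_mono[OF order.trans[OF l(2) l0(3)]] mult_left_mono[OF order.trans[OF l(2) l0(4)]]; simp)+
      then have "C * l \<le> d1 / 2" "C * l \<le> d2 / 2" using \<open>C > 0\<close> by simp_all
      then show "C * l < d1" "C * l < d2" using \<open>d1 > 0\<close> \<open>d2 > 0\<close> by linarith+
    qed
    let ?A = "\<lambda>q v s. avg_aug (q s) (v s)"
    define D where "D = (\<lambda>s. (1 - l) *\<^sub>R ?A y w s + l *\<^sub>R ?A y ws s - ?A x w s)"
    define F where "F = (\<lambda>s. (p s, 1) \<bullet> (D s - avg_daug (x s) (w s) (y s - x s)))"
    define \<Delta> where "\<Delta> = (\<lambda>s. ham_embedded P (x s) (ws s) (p s) - ham_embedded P (x s) (w s) (p s))"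
    have \<Delta>: "\<Delta> s = (p s, 1) \<bullet> (?A x ws s - ?A x w s)" for s
      by (simp only: \<Delta>_def ham_embedded_aug inner_diff_right)
    have \<Delta>int: "\<Delta> integrable_on {0..T}"
      unfolding \<Delta> by (intro set_lebesgue_integral_eq_integral(1) continuous_inner_absolutely_integrable
          continuous_on_Pair pc continuous_on_const set_integral_diff mean_aug_integrable w ws xc)
    have Fint: "F integrable_on {0..T}"
      using mix_cost_variation(1)[OF w ws l01] by (simp only: F_def D_def x_def y_def p_def)
    have var: "mix_cost P l w ws - cost P w = integral {0..T} F
      + (final_cost P (y T) - final_cost P (x T) - gradient (final_cost P) (x T) \<bullet> (y T - x T))"
      using mix_cost_variation(2)[OF w ws l01] by (simp only: F_def D_def x_def y_def p_def)
    define k where "k = (Q + 1) * (e2 * (C * l) + l * (2 * B * (C * l)))"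
    have Fle: "F s \<le> l * \<Delta> s + k" if s: "s \<in> {0..T}" for s
    proof -
      note wv = embedded_controls_values[OF w s] and wsv = embedded_controls_values[OF ws s]
      define E1 where "E1 = ?A y w s - ?A x w s - avg_daug (x s) (w s) (y s - x s)"
      define E2 where "E2 = (?A y ws s - ?A x ws s) - (?A y w s - ?A x w s)"
      have split: "D s - avg_daug (x s) (w s) (y s - x s) = l *\<^sub>R (?A x ws s - ?A x w s) + (E1 + l *\<^sub>R E2)"
        unfolding D_def E1_def E2_def by (simp add: algebra_simps)
      have "norm E1 \<le> e2 * norm (y s - x s)"
        unfolding E1_def using hC[OF s] small by (intro d2 wv xR yR s) auto
      also have "\<dots> \<le> e2 * (C * l)" using hC[OF s] e12 by (intro mult_left_mono) auto
      finally have E1: "norm E1 \<le> e2 * (C * l)" .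
      have "norm E2 \<le> B * norm (y s - x s) + B * norm (y s - x s)"
        unfolding E2_def by (intro order.trans[OF norm_triangle_ineq4] add_mono B wv wsv xR yR s)
      also have "\<dots> \<le> B * (C * l) + B * (C * l)" using hC[OF s] \<open>B > 0\<close> by (intro add_mono mult_left_mono) auto
      finally have E2: "norm E2 \<le> 2 * B * (C * l)" by simp
      have "norm (E1 + l *\<^sub>R E2) \<le> e2 * (C * l) + l * (2 * B * (C * l))"
        using E1 E2 l01 by (intro norm_triangle_mono) (auto intro: mult_left_mono)
      moreover have "norm (p s, 1::real) \<le> Q + 1"
        using Q[OF w s] norm_Pair_le[of "p s" "1::real"] by (simp add: p_def)
      ultimately have "(p s, 1) \<bullet> (E1 + l *\<^sub>R E2) \<le> k"
        unfolding k_def using \<open>Q > 0\<close> by (intro order.trans[OF norm_cauchy_schwarz] mult_mono) auto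
      then show ?thesis unfolding F_def split \<Delta> inner_add_right[of "(p s, 1)" "l *\<^sub>R (?A x ws s - ?A x w s)"] inner_scaleR_right[of "(p s, 1)" l "?A x ws s - ?A x w s"]
        by linarith
    qed
    have "integral {0..T} F \<le> integral {0..T} (\<lambda>s. l * \<Delta> s + k)"
      by (intro integral_le Fint Fle integrable_add integrable_on_mult_right \<Delta>int) auto
    also have "\<dots> = l * integral {0..T} \<Delta> + k * T"
      using integral_add[OF integrable_on_mult_right[OF \<Delta>int, of l] integrable_const_ivl[of k]] horizon by simp
    finally have F: "integral {0..T} F \<le> l * integral {0..T} \<Delta> + k * T" .
    have kT: "k * T \<le> e * l / 3 + e * l / 3"
    proof -
      have "2 * B * C * K * l \<le> 2 * B * C * K * (e / (6 * B * C * K))"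
        using K \<open>B > 0\<close> \<open>C > 0\<close> by (intro mult_left_mono[OF order.trans[OF l(2) l0(5)]]) simp
      also have "\<dots> = e / 3" using K \<open>B > 0\<close> \<open>C > 0\<close> by simp
      finally have le: "2 * B * C * K * l \<le> e / 3" .
      have "k * T = l * (K * C * e2) + l * (2 * B * C * K * l)" by (simp add: k_def K_def algebra_simps)
      also have "K * C * e2 = e / 3" using K \<open>C > 0\<close> by (simp add: e2_def)
      also have "l * (e / 3) + l * (2 * B * C * K * l) \<le> l * (e / 3) + l * (e / 3)"
        by (rule add_left_mono[OF mult_left_mono[OF le l01(1)]])
      finally have "k * T \<le> l * (e / 3) + l * (e / 3)" .
      then show ?thesis by (simp add: mult_ac)
    qed
    have T: "T \<in> {0..T}" using horizon by simp
    have "final_cost P (y T) - final_cost P (x T) - gradient (final_cost P) (x T) \<bullet> (y T - x T) \<le> e1 * norm (y T - x T)"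
      using d1[OF xR[OF T] yR[OF T]] hC[OF T] small by simp
    also have "\<dots> \<le> e1 * (C * l)" using hC[OF T] e12 by (intro mult_left_mono) auto
    also have "\<dots> = e * l / 3" using \<open>C > 0\<close> by (simp add: e1_def)
    finally have "mix_cost P l w ws - cost P w \<le> l * integral {0..T} \<Delta> + (e * l / 3 + e * l / 3) + e * l / 3"
      unfolding var using F kT by linarith
    then show ?thesis by (simp add: \<Delta>_def x_def p_def)
  qed
  with l0 show ?thesis by blast
qed
section \<open>Existence of descent controls\<close>

lemma ham_aug: "ham P x v p = (p, 1) \<bullet> aug P (fst v) x (snd v)"
  by (simp add: ham_def aug_def inner_prod_def)

lemma mode_controls_compact: "compact (mode_controls P)"
proof -
  have "mode_controls P = (\<Union>i\<in>{1..modes P}. {i} \<times> ctrl_set P i)" by (auto simp: mode_controls_def)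
  then show ?thesis using ctrl_compact by (auto intro!: compact_UN compact_Times)
qed

lemma mode_controls_nonempty: "mode_controls P \<noteq> {}"
proof -
  have "1 \<in> {1..modes P}" using modes by simp
  with ctrl_nonempty[OF this] obtain u where "(1, u) \<in> mode_controls P" unfolding mode_controls_def by blast
  then show ?thesis by blast
qed

text \<open>
  The modes form a discrete space, so continuity can be checked in each mode separately.
\<close>

lemma ham_continuous:
  fixes x p :: "real \<Rightarrow> real ^ 'n"
  assumes x: "continuous_on S x" and p: "continuous_on S p"
  shows "continuous_on (S \<times> mode_controls P) (\<lambda>(s, v). ham P (x s) v (p s))"
  unfolding continuous_on_eq_continuous_within
proof
  fix z assume "z \<in> S \<times> mode_controls P"
  then obtain s i u where z: "z = (s, (i :: nat, u))" and s: "s \<in> S" and i: "i \<in> {1..modes P}" and u: "u \<in> ctrl_set P i"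
    by (auto simp: mode_controls_def)
  let ?N = "UNIV \<times> ({i} \<times> UNIV) :: (real \<times> (nat \<times> (real ^ 'k))) set"
  let ?W = "S \<times> ({i} \<times> ctrl_set P i)"
  have "continuous_on ?W (\<lambda>z. (case (x (fst z), snd (snd z)) of (x, u) \<Rightarrow> aug P i x u))"
    by (rule continuous_on_compose2[OF aug_continuous[OF i]])
      (auto intro!: continuous_intros continuous_on_compose2[OF x])
  moreover have "continuous_on ?W (\<lambda>z. p (fst z))" by (rule continuous_on_compose2[OF p]) (auto intro!: continuous_intros)
  ultimately have "continuous_on ?W (\<lambda>z. (p (fst z), 1) \<bullet> aug P i (x (fst z)) (snd (snd z)))"
    by (auto intro!: continuous_on_inner continuous_on_Pair continuous_on_const)
  then have "continuous_on ?W (\<lambda>(s, v). ham P (x s) v (p s))"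
    by (rule continuous_on_eq) (auto simp: ham_aug)
  then have "continuous (at z within ?W) (\<lambda>(s, v). ham P (x s) v (p s))"
    using s u unfolding z continuous_on_eq_continuous_within by blast
  moreover have "at z within ?W = at z within (S \<times> mode_controls P)"
  proof (rule at_within_nhd[of z ?N])
    have "open {i}" by (rule discrete_topology_class.open_discrete)
    then show "open ?N" by (intro open_Times open_UNIV)
    show "?W \<inter> ?N - {z} = S \<times> mode_controls P \<inter> ?N - {z}" using i by (auto simp: mode_controls_def)
  qed (simp add: z)
  ultimately show "continuous (at z within S \<times> mode_controls P) (\<lambda>(s, v). ham P (x s) v (p s))" by simp
qed

lemma relaxed_controls_nonempty: "relaxed_controls P \<noteq> {}"
proof -
  obtain v where v: "v \<in> mode_controls P" using mode_controls_nonempty by blast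
  have "(\<lambda>_. return (restrict_space borel (mode_controls P)) v) \<in> relaxed_controls P"
    using v by (auto simp: relaxed_controls_def space_restrict_space intro!: prob_space_return)
  then show ?thesis by blast
qed

lemma ham_embed:
  assumes "v s \<in> mode_controls P"
  shows "ham_embedded P x (embed P v s) p = ham P x (v s) p"
proof -
  have "ham_embedded P x (embed P v s) p = (\<Sum>i=1..modes P. if i = fst (v s) then ham P x (v s) p else 0)"
    unfolding ham_embedded_def by (intro sum.cong) (auto simp: embed_def)
  then show ?thesis using assms by (auto simp: mode_controls_def)
qed

lemma floor_sampling_near:
  fixes N :: nat and s :: real
  assumes N: "N > 0" and s: "s \<in> {0..T}"
  defines "\<sigma> \<equiv> of_int \<lfloor>s * real N / T\<rfloor> * (T / real N)"
  shows "\<sigma> \<in> {0..T} \<and> \<bar>s - \<sigma>\<bar> \<le> T / N"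
proof -
  have TN: "T / N > 0" using horizon N by simp
  define q where "q = s * N / T"
  have sq: "s = q * (T / N)" using horizon N by (simp add: q_def)
  have q0: "0 \<le> q" using s horizon by (simp add: q_def)
  have "0 \<le> \<lfloor>q\<rfloor>" using q0 by simp
  moreover have "q - real_of_int \<lfloor>q\<rfloor> \<le> 1" by linarith
  ultimately have fl: "0 \<le> real_of_int \<lfloor>q\<rfloor>" "real_of_int \<lfloor>q\<rfloor> \<le> q" "q - real_of_int \<lfloor>q\<rfloor> \<le> 1" by simp_all
  have eq: "\<sigma> = of_int \<lfloor>q\<rfloor> * (T / N)" by (simp add: \<sigma>_def q_def)
  have "0 \<le> \<sigma>" unfolding eq using fl(1) TN by (intro mult_nonneg_nonneg) auto
  moreover have "\<sigma> \<le> q * (T / N)" unfolding eq using fl TN by (intro mult_right_mono) auto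
  moreover have "(q - of_int \<lfloor>q\<rfloor>) * (T / N) \<le> 1 * (T / N)" using fl TN by (intro mult_right_mono) auto
  then have "s - \<sigma> \<le> T / N" unfolding eq left_diff_distrib sq[symmetric] by simp
  ultimately show ?thesis using s sq by auto
qed

text \<open>
  Sampling \<open>vs\<close> at the grid point to the left gives a control that is constant between the grid
  points, whatever the regularity of \<open>vs\<close> is. The times \<open>S\<close> are the grid points.
\<close>

lemma floor_sampling_admissible:
  fixes N :: nat and vs :: "real \<Rightarrow> nat \<times> (real ^ 'k)"
  assumes N: "N > 0" and vs: "\<And>s. s \<in> {0..T} \<Longrightarrow> vs s \<in> mode_controls P"
  defines "\<sigma> \<equiv> \<lambda>s :: real. of_int \<lfloor>s * real N / T\<rfloor> * (T / real N)"
  shows "(\<lambda>s. vs (\<sigma> s)) \<in> admissible_controls P"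
proof -
  define S where "S = (\<lambda>j. real j * (T / N)) ` {0..N}"
  have loc: "\<exists>U. open U \<and> s \<in> U \<and> (\<forall>s'\<in>U. vs (\<sigma> s') = vs (\<sigma> s))" if s: "s \<in> {0..T} - S" for s
  proof -
    define q where "q = s * N / T"
    have q0: "0 \<le> q" using s horizon by (simp add: q_def)
    have qN: "q \<le> N" using s horizon N by (simp add: q_def pos_divide_le_eq mult.commute mult_right_mono)
    have "q \<noteq> of_int \<lfloor>q\<rfloor>"
    proof
      assume *: "q = of_int \<lfloor>q\<rfloor>"
      define j where "j = nat \<lfloor>q\<rfloor>"
      have j: "real j = q" using * q0 by (simp add: j_def)
      then have "s = real j * (T / N)" using horizon N by (simp add: q_def)
      moreover have "j \<in> {0..N}" using j qN by simp
      ultimately show False using s by (auto simp: S_def)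
    qed
    then have fl: "of_int \<lfloor>q\<rfloor> < q" "q < of_int \<lfloor>q\<rfloor> + 1" by linarith+
    define U where "U = (\<lambda>s :: real. s * real N / T) -` {of_int \<lfloor>q\<rfloor><..<of_int \<lfloor>q\<rfloor> + 1}"
    have "open U" unfolding U_def by (intro open_vimage continuous_intros) (use horizon in auto)
    moreover have "s \<in> U" using fl by (simp add: U_def q_def)
    moreover have "vs (\<sigma> s') = vs (\<sigma> s)" if "s' \<in> U" for s'
    proof -
      have "\<lfloor>s' * N / T\<rfloor> = \<lfloor>q\<rfloor>" using that by (intro floor_unique) (auto simp: U_def)
      then show ?thesis by (simp add: \<sigma>_def q_def)
    qed
    ultimately show ?thesis by blast
  qed
  have "continuous_on ({0..T} - S) (\<lambda>t. fst (vs (\<sigma> t)))"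
  proof (intro continuous_at_imp_continuous_on ballI)
    fix s assume s: "s \<in> {0..T} - S"
    obtain U where U: "open U" "s \<in> U" "\<And>s'. s' \<in> U \<Longrightarrow> vs (\<sigma> s') = vs (\<sigma> s)" using loc[OF s] by blast
    have "continuous_on U (\<lambda>t. fst (vs (\<sigma> t)))"
      by (rule continuous_on_eq[OF continuous_on_const]) (drule U(3), simp)
    then show "isCont (\<lambda>t. fst (vs (\<sigma> t))) s" using U(1,2) by (simp add: continuous_on_eq_continuous_at)
  qed
  moreover have "(\<lambda>t. snd (vs (\<sigma> t))) C1_differentiable_on ({0..T} - S)"
    unfolding C1_differentiable_on_def
  proof (intro exI[of _ "\<lambda>_. 0"] conjI ballI)
    fix s assume s: "s \<in> {0..T} - S"
    obtain U where U: "open U" "s \<in> U" "\<And>s'. s' \<in> U \<Longrightarrow> vs (\<sigma> s') = vs (\<sigma> s)" using loc[OF s] by blast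
    show "((\<lambda>t. snd (vs (\<sigma> t))) has_vector_derivative 0) (at s)"
      by (rule has_vector_derivative_transform_within_open[OF has_vector_derivative_const U(1,2)]) (drule U(3), simp)
  qed simp
  moreover have "vs (\<sigma> s) \<in> mode_controls P" if "s \<in> {0..T}" for s
    using vs floor_sampling_near[OF N that] unfolding \<sigma>_def by blast
  moreover have "finite S" by (simp add: S_def)
  ultimately show "(\<lambda>s. vs (\<sigma> s)) \<in> admissible_controls P"
    unfolding admissible_controls_def by blast
qed

text \<open>
  Minimizers of the Hamiltonian need not depend measurably on time. Their values at the grid points
  suffice, since the Hamiltonian is uniformly continuous in time, uniformly in the control value.
\<close>

lemma near_minimizer_exists:
  assumes x: "continuous_on {0..T} x" and p: "continuous_on {0..T} p" and e: "e > 0"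
  shows "\<exists>v\<in>admissible_controls P. \<forall>s\<in>{0..T}. \<forall>u\<in>mode_controls P. ham P (x s) (v s) (p s) \<le> ham P (x s) u (p s) + e"
proof -
  let ?H = "\<lambda>s v. ham P (x s) v (p s)"
  have "\<exists>d>0. \<forall>s\<in>{0..T}. \<forall>s'\<in>{0..T}. \<forall>u\<in>ctrl_set P i. \<bar>s - s'\<bar> < d \<longrightarrow> \<bar>?H s (i, u) - ?H s' (i, u)\<bar> < e / 2"
    if i: "i \<in> {1..modes P}" for i
  proof -
    have "continuous_on ({0..T} \<times> ctrl_set P i) (\<lambda>z. case (fst z, (i, snd z)) of (s, v) \<Rightarrow> ?H s v)"
      by (rule continuous_on_compose2[OF ham_continuous[OF x p]])
        (use i in \<open>auto intro!: continuous_intros simp: mode_controls_def\<close>)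
    moreover have "compact ({0..T} \<times> ctrl_set P i)" by (intro compact_Times ctrl_compact i) auto
    ultimately have "uniformly_continuous_on ({0..T} \<times> ctrl_set P i) (\<lambda>z. ?H (fst z) (i, snd z))"
      by (intro compact_uniformly_continuous) auto
    then obtain d where "d > 0" and d: "\<And>z z'. z \<in> {0..T} \<times> ctrl_set P i \<Longrightarrow> z' \<in> {0..T} \<times> ctrl_set P i \<Longrightarrow>
        dist z' z < d \<Longrightarrow> dist (?H (fst z') (i, snd z')) (?H (fst z) (i, snd z)) < e / 2"
      unfolding uniformly_continuous_on_def using half_gt_zero[OF e] by blast
    have "\<bar>?H s (i, u) - ?H s' (i, u)\<bar> < e / 2"
      if "s \<in> {0..T}" "s' \<in> {0..T}" "u \<in> ctrl_set P i" "\<bar>s - s'\<bar> < d" for s s' u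
      using d[of "(s', u)" "(s, u)"] that by (simp add: dist_Pair_Pair dist_real_def)
    with \<open>d > 0\<close> show ?thesis by blast
  qed
  then have "\<forall>i\<in>{1..modes P}. \<exists>d>0. \<forall>s\<in>{0..T}. \<forall>s'\<in>{0..T}. \<forall>u\<in>ctrl_set P i. \<bar>s - s'\<bar> < d \<longrightarrow> \<bar>?H s (i, u) - ?H s' (i, u)\<bar> < e / 2"
    by blast
  from bchoice[OF this] obtain \<delta> where \<delta>: "\<And>i. i \<in> {1..modes P} \<Longrightarrow> \<delta> i > 0 \<and>
      (\<forall>s\<in>{0..T}. \<forall>s'\<in>{0..T}. \<forall>u\<in>ctrl_set P i. \<bar>s - s'\<bar> < \<delta> i \<longrightarrow> \<bar>?H s (i, u) - ?H s' (i, u)\<bar> < e / 2)" by blast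
  define d where "d = Min (\<delta> ` {1..modes P})"
  have "d > 0" unfolding d_def using modes \<delta> by (subst Min_gr_iff) auto
  have d: "\<bar>?H s v - ?H s' v\<bar> < e / 2"
    if "s \<in> {0..T}" "s' \<in> {0..T}" and v: "v \<in> mode_controls P" and "\<bar>s - s'\<bar> < d" for s s' v
  proof -
    obtain i u where iu: "v = (i, u)" "i \<in> {1..modes P}" "u \<in> ctrl_set P i" using v by (auto simp: mode_controls_def)
    have "d \<le> \<delta> i" unfolding d_def using iu by (intro Min_le) auto
    then show ?thesis using \<delta>[OF iu(2)] that(1,2,4) iu(3) unfolding iu(1) by (meson less_le_trans)
  qed
  have "\<exists>v\<in>mode_controls P. \<forall>u\<in>mode_controls P. ?H s v \<le> ?H s u" if s: "s \<in> {0..T}" for s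
  proof (rule continuous_attains_inf[OF mode_controls_compact mode_controls_nonempty])
    have "continuous_on (mode_controls P) (\<lambda>v. case (s, v) of (s, v) \<Rightarrow> ?H s v)"
      by (rule continuous_on_compose2[OF ham_continuous[OF x p]]) (use s in \<open>auto intro!: continuous_intros\<close>)
    then show "continuous_on (mode_controls P) (?H s)" by simp
  qed
  then have "\<forall>s\<in>{0..T}. \<exists>v. v \<in> mode_controls P \<and> (\<forall>u\<in>mode_controls P. ?H s v \<le> ?H s u)" by blast
  from bchoice[OF this] obtain vs where vs: "\<And>s. s \<in> {0..T} \<Longrightarrow> vs s \<in> mode_controls P"
    and min: "\<And>s u. s \<in> {0..T} \<Longrightarrow> u \<in> mode_controls P \<Longrightarrow> ?H s (vs s) \<le> ?H s u" by blast
  obtain N :: nat where N0: "T / d < N" using reals_Archimedean2 by blast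
  moreover have "0 < T / d" using horizon \<open>d > 0\<close> by simp
  ultimately have "0 < real N" by (rule less_trans[rotated])
  with N0 \<open>d > 0\<close> have N: "N > 0" "T / N < d" by (simp_all add: pos_divide_less_eq mult.commute)
  define \<sigma> where "\<sigma> = (\<lambda>s :: real. of_int \<lfloor>s * real N / T\<rfloor> * (T / real N))"
  have adm: "(\<lambda>s. vs (\<sigma> s)) \<in> admissible_controls P"
    unfolding \<sigma>_def by (rule floor_sampling_admissible[OF N(1) vs])
  have \<sigma>: "\<sigma> s \<in> {0..T}" "\<bar>s - \<sigma> s\<bar> < d" if "s \<in> {0..T}" for s
    using floor_sampling_near[OF N(1) that] N(2) unfolding \<sigma>_def by auto
  have close: "\<bar>?H s u - ?H (\<sigma> s) u\<bar> < e / 2" if "s \<in> {0..T}" "u \<in> mode_controls P" for s u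
    using d[OF that(1) \<sigma>(1)[OF that(1)] that(2) \<sigma>(2)[OF that(1)]] .
  have "?H s (vs (\<sigma> s)) \<le> ?H s u + e" if s: "s \<in> {0..T}" and u: "u \<in> mode_controls P" for s u
    using close[OF s vs[OF \<sigma>(1)[OF s]]] close[OF s u] min[OF \<sigma>(1)[OF s] u] by linarith
  then show ?thesis by (intro bexI[OF _ adm] ballI)
qed

text \<open>
  Some relaxed control \<open>\<nu>\<close> has an integral below \<open>(1 - \<eta>) \<theta>(w)\<close>. A
  nearly pointwise minimizer of the Hamiltonian does almost as well as \<open>\<nu>\<close>, because an
  average over a probability measure is at least the minimum.
\<close>

lemma descent_control_exists:
  assumes w: "w \<in> embedded_controls P" and \<theta>: "theta P w < 0" and \<eta>: "0 < \<eta>" "\<eta> < 1"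
  shows "\<exists>v. descent_control P \<eta> w v"
proof -
  define x p where "x = state P w" and "p = costate P w"
  have xc: "continuous_on {0..T} x" unfolding x_def by (rule state_continuous[OF w])
  have pc: "continuous_on {0..T} p" unfolding p_def by (rule costate_continuous[OF w])
  define A where "A = (\<lambda>\<nu> t. ham_relaxed P (x t) (\<nu> t) (p t) - ham_embedded P (x t) (w t) (p t))"
  have "theta P w < (1 - \<eta>) * theta P w" using \<theta> \<eta> by (simp add: mult_less_cancel_right)
  moreover have "theta P w = Inf ((\<lambda>\<nu>. LINT t:{0..T}|lebesgue. A \<nu> t) ` relaxed_controls P)"
    by (simp add: theta_def A_def x_def p_def)
  ultimately obtain \<nu> where \<nu>: "\<nu> \<in> relaxed_controls P" and less: "(LINT t:{0..T}|lebesgue. A \<nu> t) < (1 - \<eta>) * theta P w"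
    using cInf_lessD[of "(\<lambda>\<nu>. LINT t:{0..T}|lebesgue. A \<nu> t) ` relaxed_controls P" "(1 - \<eta>) * theta P w"]
      relaxed_controls_nonempty by auto
  \<comment> \<open>The integral of a function that is not integrable is 0 by convention; as this one is negative, the
    integrand is integrable.\<close>
  have "(LINT t:{0..T}|lebesgue. A \<nu> t) \<noteq> 0" using less \<eta> \<theta> mult_pos_neg[of "1 - \<eta>" "theta P w"] by linarith
  then have Aint: "(A \<nu>) absolutely_integrable_on {0..T}"
    unfolding set_integrable_def set_lebesgue_integral_def using not_integrable_integral_eq by blast
  define e where "e = ((1 - \<eta>) * theta P w - (LINT t:{0..T}|lebesgue. A \<nu> t)) / (2 * T)"
  have e: "e > 0" using less horizon by (simp add: e_def)
  obtain v where v: "v \<in> admissible_controls P"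
    and vmin: "\<And>s u. s \<in> {0..T} \<Longrightarrow> u \<in> mode_controls P \<Longrightarrow> ham P (x s) (v s) (p s) \<le> ham P (x s) u (p s) + e"
    using near_minimizer_exists[OF xc pc e] by blast
  have vV: "v s \<in> mode_controls P" if "s \<in> {0..T}" for s using v that by (simp add: admissible_controls_def)
  define I where "I = (\<lambda>t. ham P (x t) (v t) (p t) - ham_embedded P (x t) (w t) (p t))"
  have "(\<lambda>t. ham_embedded P (x t) (embed P v t) (p t) - ham_embedded P (x t) (w t) (p t)) absolutely_integrable_on {0..T}"
    unfolding ham_embedded_aug by (intro set_integral_diff continuous_inner_absolutely_integrable continuous_on_Pair
        pc continuous_on_const mean_aug_integrable w embed_embedded v xc)
  then have Iint: "I absolutely_integrable_on {0..T}"
    by (rule set_integrable_cong[THEN iffD1, rotated -1]) (auto simp: I_def ham_embed vV)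
  have le: "I t \<le> A \<nu> t + e" if t: "t \<in> {0..T}" for t
  proof -
    interpret prob_space "\<nu> t" using \<nu> t by (simp add: relaxed_controls_def)
    have sets: "sets (\<nu> t) = sets (restrict_space borel (mode_controls P))" using \<nu> t by (simp add: relaxed_controls_def)
    have space: "space (\<nu> t) = mode_controls P" using sets_eq_imp_space_eq[OF sets] by (simp add: space_restrict_space)
    let ?h = "\<lambda>v. ham P (x t) v (p t)"
    have "continuous_on (mode_controls P) (\<lambda>v. case (t, v) of (s, v) \<Rightarrow> ham P (x s) v (p s))"
      by (rule continuous_on_compose2[OF ham_continuous[OF xc pc]]) (use t in \<open>auto intro!: continuous_intros\<close>)
    then have hc: "continuous_on (mode_controls P) ?h" by simp
    have hm: "?h \<in> borel_measurable (\<nu> t)"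
      using borel_measurable_continuous_on_restrict[OF hc] measurable_cong_sets[OF sets refl, of borel] by blast
    have "bounded (?h ` mode_controls P)" by (intro compact_imp_bounded compact_continuous_image hc mode_controls_compact)
    then obtain b where "\<And>v. v \<in> mode_controls P \<Longrightarrow> norm (?h v) \<le> b" unfolding bounded_iff by blast
    then have "integrable (\<nu> t) ?h" using hm by (intro integrable_const_bound[of _ b] AE_I2) (auto simp: space)
    then have "ham P (x t) (v t) (p t) - e \<le> expectation ?h"
      by (rule integral_ge_const[OF _ AE_I2]) (simp add: space diff_le_eq vmin[OF t])
    then show ?thesis by (simp add: I_def A_def ham_relaxed_def)
  qed
  have "integral {0..T} I \<le> integral {0..T} (\<lambda>t. A \<nu> t + e)"
    using set_lebesgue_integral_eq_integral(1)[OF Iint] set_lebesgue_integral_eq_integral(1)[OF Aint] le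
    by (intro integral_le integrable_add) auto
  also have "\<dots> = integral {0..T} (A \<nu>) + e * T"
    using integral_add[OF set_lebesgue_integral_eq_integral(1)[OF Aint] integrable_const_ivl[of e]] horizon by simp
  also have "e * T = ((1 - \<eta>) * theta P w - integral {0..T} (A \<nu>)) / 2"
    using horizon by (simp add: e_def set_lebesgue_integral_eq_integral(2)[OF Aint])
  also have "integral {0..T} (A \<nu>) + \<dots> < (1 - \<eta>) * theta P w"
  proof -
    have "a + (b - a) / 2 < b" if "a < b" for a b :: real using that by (simp add: field_simps)
    from this[OF less] show ?thesis by (simp only: set_lebesgue_integral_eq_integral(2)[OF Aint])
  qed
  finally have "(LINT t:{0..T}|lebesgue. I t) < (1 - \<eta>) * theta P w"
    by (simp add: set_lebesgue_integral_eq_integral(2)[OF Iint])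
  then have "descent_control P \<eta> w v" unfolding descent_control_def I_def x_def p_def using v by simp
  then show ?thesis by blast
qed
section \<open>Step sizes and sufficient descent\<close>

text \<open>
  The gap between \<open>1 - \<eta>\<close> and \<open>\<alpha>\<close>, multiplied by \<open>\<rho>\<close>, is the
  error \<open>e\<close> that the first-order estimate may have.
\<close>

lemma sufficient_step_uniform:
  assumes \<eta>: "\<eta> < 1" and \<alpha>: "\<alpha> < 1 - \<eta>" and \<rho>: "0 < \<rho>"
  shows "\<exists>l0. 0 < l0 \<and> l0 \<le> 1 \<and> (\<forall>w\<in>embedded_controls P. \<forall>v. \<forall>l.
     theta P w < - \<rho> \<longrightarrow> descent_control P \<eta> w v \<longrightarrow> 0 < l \<longrightarrow> l \<le> l0 \<longrightarrow> sufficient_step P \<alpha> w v l)"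
proof -
  define e where "e = (1 - \<eta> - \<alpha>) * \<rho>"
  have e: "e > 0" using \<alpha> \<rho> by (simp add: e_def)
  obtain l0 where l0: "0 < l0" "l0 \<le> 1" and est: "\<And>w ws l. w \<in> embedded_controls P \<Longrightarrow> ws \<in> embedded_controls P \<Longrightarrow> 0 < l \<Longrightarrow> l \<le> l0 \<Longrightarrow>
     mix_cost P l w ws - cost P w \<le> l * integral {0..T} (\<lambda>s. ham_embedded P (state P w s) (ws s) (costate P w s)
        - ham_embedded P (state P w s) (w s) (costate P w s)) + e * l"
    using uniform_first_order_estimate[OF e] by blast
  have "sufficient_step P \<alpha> w v l"
    if w: "w \<in> embedded_controls P" and \<theta>: "theta P w < - \<rho>" and dc: "descent_control P \<eta> w v" and l: "0 < l" "l \<le> l0" for w v l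
  proof -
    have v: "v \<in> admissible_controls P" using dc by (simp add: descent_control_def)
    have vV: "v s \<in> mode_controls P" if "s \<in> {0..T}" for s using v that by (simp add: admissible_controls_def)
    let ?\<Delta> = "\<lambda>s. ham_embedded P (state P w s) (embed P v s) (costate P w s) - ham_embedded P (state P w s) (w s) (costate P w s)"
    have "?\<Delta> absolutely_integrable_on {0..T}"
      unfolding ham_embedded_aug by (intro set_integral_diff continuous_inner_absolutely_integrable continuous_on_Pair
        costate_continuous state_continuous continuous_on_const mean_aug_integrable w embed_embedded v)
    then have "integral {0..T} ?\<Delta> = (LINT t:{0..T}|lebesgue. ?\<Delta> t)"
      by (simp add: set_lebesgue_integral_eq_integral(2))
    also have "\<dots> = (LINT t:{0..T}|lebesgue. (ham P (state P w t) (v t) (costate P w t)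
         - ham_embedded P (state P w t) (w t) (costate P w t)))"
      using vV by (intro set_lebesgue_integral_cong) (auto simp: ham_embed)
    also have "\<dots> < (1 - \<eta>) * theta P w" using dc by (simp add: descent_control_def)
    finally have "l * integral {0..T} ?\<Delta> < l * ((1 - \<eta>) * theta P w)" using l by (intro mult_strict_left_mono)
    moreover have "e * l \<le> (1 - \<eta> - \<alpha>) * (- theta P w) * l"
      unfolding e_def using \<alpha> \<theta> l by (intro mult_right_mono mult_left_mono) auto
    ultimately have "mix_cost P l w (embed P v) - cost P w < l * ((1 - \<eta>) * theta P w) + (1 - \<eta> - \<alpha>) * (- theta P w) * l"
      using est[OF w embed_embedded[OF v] l] by linarith
    also have "\<dots> = \<alpha> * l * theta P w" by (simp add: algebra_simps)
    finally show ?thesis by (simp add: sufficient_step_def)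
  qed
  with l0 show ?thesis by blast
qed

lemma armijo_step_exists:
  assumes \<beta>: "0 < \<beta>" "\<beta> < 1" and l0: "0 < l0"
    and suff: "\<And>l. 0 < l \<Longrightarrow> l \<le> l0 \<Longrightarrow> sufficient_step P \<alpha> w v l"
  shows "\<exists>l. armijo_step P \<alpha> \<beta> w v l"
proof -
  obtain m0 where "\<beta> ^ m0 < l0" using real_arch_pow_inv[OF l0 \<beta>(2)] by blast
  then have m0: "sufficient_step P \<alpha> w v (\<beta> ^ m0)" using \<beta> by (intro suff) auto
  define m where "m = (LEAST m. sufficient_step P \<alpha> w v (\<beta> ^ m))"
  have "sufficient_step P \<alpha> w v (\<beta> ^ m)" unfolding m_def using m0 by (rule LeastI)
  moreover have "\<beta> ^ k \<le> \<beta> ^ m" if "sufficient_step P \<alpha> w v (\<beta> ^ k)" for k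
    using Least_le[of "\<lambda>m. sufficient_step P \<alpha> w v (\<beta> ^ m)", OF that] \<beta> unfolding m_def by (intro power_decreasing) auto
  ultimately have "armijo_step P \<alpha> \<beta> w v (\<beta> ^ m)" unfolding armijo_step_def by blast
  then show ?thesis by blast
qed

text \<open>
  If the first trial step is rejected, the last rejected one exceeds \<open>l0\<close>, and the accepted
  step is \<open>\<beta>\<close> times that.
\<close>

lemma armijo_step_lower_bound:
  assumes \<beta>: "0 < \<beta>" "\<beta> < 1" and l0: "0 < l0" "l0 \<le> 1"
    and suff: "\<And>l. 0 < l \<Longrightarrow> l \<le> l0 \<Longrightarrow> sufficient_step P \<alpha> w v l"
    and step: "armijo_step P \<alpha> \<beta> w v l"
  shows "\<beta> * l0 \<le> l"
proof -
  obtain m where m: "l = \<beta> ^ m" and max: "\<And>k. sufficient_step P \<alpha> w v (\<beta> ^ k) \<Longrightarrow> \<beta> ^ k \<le> l"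
    using step unfolding armijo_step_def by blast
  show ?thesis
  proof (cases m)
    case 0
    have "\<beta> * l0 \<le> 1 * 1" using \<beta> l0 by (intro mult_mono) auto
    then show ?thesis using m 0 by simp
  next
    case (Suc k)
    have "\<not> \<beta> ^ k \<le> l" using \<beta> unfolding m Suc by (simp add: not_le)
    then have "\<not> \<beta> ^ k \<le> l0" using max suff \<beta> zero_less_power by blast
    then have "\<beta> * l0 \<le> \<beta> * \<beta> ^ k" using \<beta> by (intro mult_left_mono) auto
    then show ?thesis using m Suc by simp
  qed
qed

lemma armijo_step_positive:
  "armijo_step P \<alpha> \<beta> w v l \<Longrightarrow> 0 < \<beta> \<Longrightarrow> \<beta> < 1 \<Longrightarrow> 0 < l \<and> l \<le> 1"
  by (auto simp: armijo_step_def power_le_one)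

lemma iteration_exists:
  assumes \<eta>: "0 < \<eta>" "\<eta> < 1" and \<alpha>: "\<alpha> < 1 - \<eta>" and \<beta>: "0 < \<beta>" "\<beta> < 1" and w: "w \<in> embedded_controls P"
  shows "\<exists>y. iteration P \<eta> \<alpha> \<beta> w y"
proof (cases "theta P w < 0")
  case True
  \<comment> \<open>The uniform statement requires a strict inequality, hence the factor \<open>1/2\<close>.\<close>
  define \<rho> where "\<rho> = - theta P w / 2"
  have \<rho>: "0 < \<rho>" "theta P w < - \<rho>" using True by (auto simp: \<rho>_def)
  obtain v where v: "descent_control P \<eta> w v" using descent_control_exists[OF w True \<eta>] by blast
  obtain l0 where "0 < l0" and "\<And>l. 0 < l \<Longrightarrow> l \<le> l0 \<Longrightarrow> sufficient_step P \<alpha> w v l"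
    using sufficient_step_uniform[OF \<eta>(2) \<alpha> \<rho>(1)] w \<rho>(2) v by blast
  from armijo_step_exists[OF \<beta> this] v True show ?thesis unfolding iteration_def by auto
qed (simp add: iteration_def)

lemma iteration_descent:
  assumes \<alpha>: "0 < \<alpha>" and \<beta>: "0 < \<beta>" "\<beta> < 1" and w: "w \<in> embedded_controls P"
    and \<theta>: "theta P w < 0" and it: "iteration P \<eta> \<alpha> \<beta> w y"
  obtains v l where "descent_control P \<eta> w v" "armijo_step P \<alpha> \<beta> w v l" "0 < l"
    "y \<in> embedded_controls P" "cost P y - cost P w < \<alpha> * l * theta P w"
proof -
  obtain v l where v: "descent_control P \<eta> w v" and l: "armijo_step P \<alpha> \<beta> w v l" and y: "y = update l w (embed P v)"
    using it \<theta> unfolding iteration_def by auto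
  have l01: "0 < l" "0 \<le> l" "l \<le> 1" using armijo_step_positive[OF l \<beta>] by auto
  have e: "embed P v \<in> embedded_controls P" using v by (intro embed_embedded) (simp add: descent_control_def)
  have "mix_cost P l w (embed P v) - cost P w < \<alpha> * l * theta P w"
    using l by (simp add: armijo_step_def sufficient_step_def)
  then have "cost P y - cost P w < \<alpha> * l * theta P w"
    using cost_update_le_mix_cost[OF w e l01(2,3)] unfolding y by linarith
  moreover have "y \<in> embedded_controls P" unfolding y by (rule update_embedded[OF w e l01(2,3)])
  ultimately show thesis using that v l l01 by blast
qed

text \<open>
  The decrease is at least \<open>\<alpha> * l * \<rho>\<close> with \<open>l\<close> not below
  \<open>\<beta> * l0\<close>, where \<open>l0\<close> depends on \<open>\<rho>\<close> only.
\<close>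

lemma algorithm_sufficient_descent:
  assumes \<eta>: "0 < \<eta>" "\<eta> < 1" and \<alpha>: "0 < \<alpha>" "\<alpha> < 1 - \<eta>" and \<beta>: "0 < \<beta>" "\<beta> < 1"
    and S: "algorithm_map P \<eta> \<alpha> \<beta> S"
  shows "sufficient_descent P S"
proof -
  have it: "iteration P \<eta> \<alpha> \<beta> w (S w)" if "w \<in> embedded_controls P" for w
    using S that by (simp add: algorithm_map_def)
  have desc: "S w \<in> embedded_controls P \<and> cost P (S w) \<le> cost P w" if w: "w \<in> embedded_controls P" for w
  proof (cases "theta P w < 0")
    case True
    obtain l where "0 < l" "S w \<in> embedded_controls P" "cost P (S w) - cost P w < \<alpha> * l * theta P w"
      using iteration_descent[OF \<alpha>(1) \<beta> w True it[OF w]] by metis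
    moreover from this have "\<alpha> * l * theta P w < 0" using \<alpha> True by (simp add: mult_pos_neg)
    ultimately show ?thesis by auto
  next
    case False
    then show ?thesis using it[OF w] w by (simp add: iteration_def)
  qed
  have "\<exists>\<delta>>0. \<forall>w\<in>embedded_controls P. theta P w < - \<rho> \<longrightarrow> cost P (S w) - cost P w < - \<delta>" if \<rho>: "\<rho> > 0" for \<rho>
  proof -
    obtain l0 where l0: "0 < l0" "l0 \<le> 1" and suff: "\<And>w v l. w \<in> embedded_controls P \<Longrightarrow> theta P w < - \<rho> \<Longrightarrow>
        descent_control P \<eta> w v \<Longrightarrow> 0 < l \<Longrightarrow> l \<le> l0 \<Longrightarrow> sufficient_step P \<alpha> w v l"
      using sufficient_step_uniform[OF \<eta>(2) \<alpha>(2) \<rho>] by blast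
    define \<delta> where "\<delta> = \<alpha> * (\<beta> * l0) * \<rho>"
    have "cost P (S w) - cost P w < - \<delta>" if w: "w \<in> embedded_controls P" and \<theta>: "theta P w < - \<rho>" for w
    proof -
      have \<theta>0: "theta P w < 0" using \<theta> \<rho> by simp
      obtain v l where v: "descent_control P \<eta> w v" and l: "armijo_step P \<alpha> \<beta> w v l"
        and less: "cost P (S w) - cost P w < \<alpha> * l * theta P w"
        by (rule iteration_descent[OF \<alpha>(1) \<beta> w \<theta>0 it[OF w]])
      have "\<beta> * l0 \<le> l" by (rule armijo_step_lower_bound[OF \<beta> l0 suff[OF w \<theta> v] l])
      then have "\<alpha> * (\<beta> * l0) * \<rho> \<le> \<alpha> * l * (- theta P w)"
        using \<alpha> \<beta> l0 \<rho> \<theta> armijo_step_positive[OF l \<beta>] by (intro mult_mono) auto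
      then show ?thesis using less unfolding \<delta>_def by simp
    qed
    moreover have "\<delta> > 0" using \<alpha> \<beta> l0 \<rho> by (simp add: \<delta>_def)
    ultimately show ?thesis by blast
  qed
  with desc show ?thesis unfolding sufficient_descent_def by blast
qed

end

theorem theorem2:
  fixes P :: "('n::finite, 'k::finite) switched_problem"
    and K :: "nat \<Rightarrow> 'k set"
    and \<Phi> :: "nat \<Rightarrow> real ^ 'n \<Rightarrow> real ^ 'k ^ 'n"
    and \<Psi> :: "nat \<Rightarrow> real ^ 'n \<Rightarrow> real ^ 'n"
  assumes "0 < horizon P" and "1 \<le> modes P"
    and "\<And>i. i \<in> {1..modes P} \<Longrightarrow> compact (ctrl_set P i) \<and> ctrl_set P i \<subseteq> coord_subspace (K i)"
    and "C1_scalar (final_cost P)"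
    and state_exists: "\<And>w. w \<in> embedded_controls P \<Longrightarrow> \<exists>x. is_state P w x"
    and A_i: "\<And>i x u. i \<in> {1..modes P} \<Longrightarrow> u \<in> ctrl_set P i \<Longrightarrow> dyn P i x u = \<Phi> i x *v u + \<Psi> i x"
    and A_ii: "\<And>i x. i \<in> {1..modes P} \<Longrightarrow> convex_on (ctrl_set P i) (running_cost P i x)"
    and B_i: "\<And>i. i \<in> {1..modes P} \<Longrightarrow> C2_map (\<Phi> i) \<and> C2_map (\<Psi> i)"
    and B_ii_C1: "\<And>i u. i \<in> {1..modes P} \<Longrightarrow> u \<in> ctrl_set P i
           \<Longrightarrow> C1_scalar (\<lambda>x. running_cost P i x u)"
    and B_ii_lip: "\<And>i. i \<in> {1..modes P} \<Longrightarrow>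
           locally_lipschitz_on (UNIV \<times> ctrl_set P i) (\<lambda>(x, u). running_cost P i x u) \<and>
           locally_lipschitz_on (UNIV \<times> ctrl_set P i)
             (\<lambda>(x, u). gradient (\<lambda>y. running_cost P i y u) x)"
  shows "\<forall>\<eta>\<in>{0<..<1}. \<exists>\<alpha>bar\<in>{0<..<1}. \<forall>\<alpha>\<in>{0<..<\<alpha>bar}. \<forall>\<beta>\<in>{0<..<1}.
           (\<exists>T. algorithm_map P \<eta> \<alpha> \<beta> T) \<and>
           (\<forall>T. algorithm_map P \<eta> \<alpha> \<beta> T \<longrightarrow> sufficient_descent P T)"
proof (cases "\<forall>i\<in>{1..modes P}. ctrl_set P i \<noteq> {}")
  case False
  then obtain i where i: "i \<in> {1..modes P}" "ctrl_set P i = {}" by blast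
  \<comment> \<open>With an empty control set in some mode there are no embedded controls, and all claims are vacuous.\<close>
  have "embedded_controls P = {}"
  proof (rule equals0I)
    fix w assume "w \<in> embedded_controls P"
    moreover have "0 \<in> {0..horizon P}" using \<open>0 < horizon P\<close> by simp
    ultimately have "w 0 \<in> embedded_values P" by (rule embedded_controls_values)
    with i show False by (auto simp: embedded_values_def)
  qed
  then show ?thesis
    by (intro ballI bexI[of _ "1/2"]) (auto simp: algorithm_map_def sufficient_descent_def intro!: exI[of _ 1])
next
  case True
  interpret switched_system P \<Phi> \<Psi>
    using assms True by unfold_locales blast+
  show ?thesis
  proof (intro ballI)
    fix \<eta> :: real assume \<eta>: "\<eta> \<in> {0<..<1}"
    have "(\<exists>S. algorithm_map P \<eta> \<alpha> \<beta> S) \<and> (\<forall>S. algorithm_map P \<eta> \<alpha> \<beta> S \<longrightarrow> sufficient_descent P S)"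
      if \<alpha>: "\<alpha> \<in> {0<..<1 - \<eta>}" and \<beta>: "\<beta> \<in> {0<..<1}" for \<alpha> \<beta>
    proof
      have "\<forall>w\<in>embedded_controls P. \<exists>y. iteration P \<eta> \<alpha> \<beta> w y"
        using iteration_exists[of \<eta> \<alpha> \<beta>] \<eta> \<alpha> \<beta> by auto
      from bchoice[OF this] show "\<exists>S. algorithm_map P \<eta> \<alpha> \<beta> S" unfolding algorithm_map_def .
      show "\<forall>S. algorithm_map P \<eta> \<alpha> \<beta> S \<longrightarrow> sufficient_descent P S"
        using algorithm_sufficient_descent[of \<eta> \<alpha> \<beta>] \<eta> \<alpha> \<beta> by auto
    qed
    moreover have "1 - \<eta> \<in> {0<..<1}" using \<eta> by auto
    ultimately show "\<exists>\<alpha>bar\<in>{0<..<1}. \<forall>\<alpha>\<in>{0<..<\<alpha>bar}. \<forall>\<beta>\<in>{0<..<1}.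
           (\<exists>T. algorithm_map P \<eta> \<alpha> \<beta> T) \<and> (\<forall>T. algorithm_map P \<eta> \<alpha> \<beta> T \<longrightarrow> sufficient_descent P T)"
      by blast
  qed
qed

end
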